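(* Let $T_1,T_2,\dots$ be i.i.d. positive waiting times with distribution function $\Phi$, and let $X_1,X_2,\dots$ be i.i.d. real jumps with distribution function $W$, the two sequences being independent of each other. Assume that $W$ is symmetric, i.e. $W(-x)+W(x)=1$ for all continuity points $x$ of $W$, and that either (a) $\sigma^2:=\int_{-\infty}^{\infty}x^2\,dW(x)<\infty$ with $\sigma^2>0$, in which case put $\alpha=2$, $\mu=\sigma^2/2$; or (b) there are $0<\alpha<2$ and $b>0$ such that $\int_x^\infty dW(x')\sim b\,\alpha^{-1}x^{-\alpha}$ as $x\to\infty$, in which case put $\mu=\dfrac{b\,\pi}{\Gamma(\alpha+1)\sin(\alpha\pi/2)}$. Assume that $\Phi(0)=0$, $\Phi(\infty)=1$ and that either (A) $\rho:=\int_0^\infty t\,d\Phi(t)<\infty$, in which case put $\beta=1$, $\lambda=\rho$; or (B) there are $0<\beta<1$ and $c>0$ such that $1-\Phi(t)\sim c\,\beta^{-1}t^{-\beta}$ as $t\to\infty$, in which case put $\lambda=\dfrac{c\,\pi}{\Gamma(\beta+1)\sin(\beta\pi)}$. For $h,\tau>0$ let $p_{h,\tau}(\cdot,t)$ be the law at time $t$ of the continuous time random walk with jumps $hX_n$ and waiting times $\tau T_n$. Let $h\to0^+$ and $\tau\to0^+$ under the scaling relation $$\frac{\mu h^\alpha}{\lambda\tau^\beta}=1 .$$ Then for all fixed real $\kappa\neq0$ and $s>0$, $$\widehat{\widetilde p}_{h,\tau}(\kappa,s)\longrightarrow \frac{s^{\beta-1}}{|\kappa|^\alpha+s^\beta},$$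 which is the Fourier-Laplace transform $\widehat{\widetilde u}(\kappa,s)$ of the solution $u$ of the space-time fractional Cauchy problem $${}_tD_*^{\beta}u(x,t)={}_xD_0^{\alpha}u(x,t),\qquad u(x,0)=\delta(x),\qquad x\in\mathbb R,\ t\ge0;$$ and for every fixed $t>0$ the law $p_{h,\tau}(\cdot,t)$ converges weakly to $u(\cdot,t)$.
   Context: Continuous time random walk (CTRW): with waiting times $T_n$ and jumps $X_n$, put $t_0=0$, $t_n=T_1+\dots+T_n$, $x_0=0$, $x_n=X_1+\dots+X_n$, and $x(t)=x_n$ for $t_n\le t<t_{n+1}$; $p(\cdot,t)$ denotes the law of $x(t)$ (written as a possibly generalized density). The rescaled walk has positions $h\,x_n$ and jump instants $\tau\,t_n$. Transforms: $\widehat f(\kappa)=\int_{-\infty}^{\infty}e^{i\kappa x}f(x)\,dx$ for $\kappa\in\mathbb R$ (for measures, integrate against the measure), $\widetilde g(s)=\int_0^\infty e^{-st}g(t)\,dt$; $\widehat{\widetilde p}(\kappa,s)$ is the Fourier transform in $x$ and Laplace transform in $t$ of $p$. Fractional operators: ${}_xD_0^\alpha$ is the Riesz operator, defined by $\widehat{{}_xD_0^\alpha f}(\kappa)=-|\kappa|^\alpha\widehat f(\kappa)$. For $0<\beta<1$, ${}_tD_*^\beta$ is the Caputo (regularized) derivative ${}_tD_*^\beta g(t)=\frac{1}{\Gamma(1-\beta)}\frac{d}{dt}\int_0^t\frac{g(t')}{(t-t')^\beta}dt'-\frac{g(0)t^{-\beta}}{\Gamma(1-\beta)}$, and ${}_tD_*^1=\frac{d}{dt}$.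 The Cauchy problem is understood in the Fourier-Laplace domain, where it reads $s^\beta\widehat{\widetilde u}(\kappa,s)-s^{\beta-1}=-|\kappa|^\alpha\widehat{\widetilde u}(\kappa,s)$; its solution $u(\cdot,t)$ is the probability law with Fourier transform $\widehat u(\kappa,t)=E_\beta(-|\kappa|^\alpha t^\beta)$, where $E_\beta(z)=\sum_{n\ge0}z^n/\Gamma(1+\beta n)$. *)

theory Defs
  imports "HOL-Probability.Probability" "HOL-Library.Landau_Symbols"
begin

text \<open>Sequences are indexed from 0, so \<open>T k\<close> and \<open>X k\<close> are the waiting time and the jump
  usually written with index \<open>k + 1\<close>.\<close>

definition jump_instant :: "(nat \<Rightarrow> 'a \<Rightarrow> real) \<Rightarrow> nat \<Rightarrow> 'a \<Rightarrow> real" where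
  "jump_instant T n \<omega> = (\<Sum>k<n. T k \<omega>)"

definition position_after :: "(nat \<Rightarrow> 'a \<Rightarrow> real) \<Rightarrow> nat \<Rightarrow> 'a \<Rightarrow> real" where
  "position_after X n \<omega> = (\<Sum>k<n. X k \<omega>)"

text \<open>For positive waiting times whose sum diverges, which is almost surely the case for i.i.d.
  ones, exactly one index satisfies the condition below. \<open>LEAST\<close> rather than \<open>THE\<close> makes the
  index a measurable function of \<open>\<omega>\<close> even on the exceptional null set.\<close>

definition jump_count :: "(nat \<Rightarrow> 'a \<Rightarrow> real) \<Rightarrow> real \<Rightarrow> 'a \<Rightarrow> nat" where
  "jump_count T t \<omega> = (LEAST n. jump_instant T n \<omega> \<le> t \<and> t < jump_instant T (Suc n) \<omega>)"

definition ctrw :: "(nat \<Rightarrow> 'a \<Rightarrow> real) \<Rightarrow> (nat \<Rightarrow> 'a \<Rightarrow> real) \<Rightarrow> real \<Rightarrow> 'a \<Rightarrow> real" where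
  "ctrw T X t \<omega> = position_after X (jump_count T t \<omega>) \<omega>"

definition scaled_law ::
  "'a measure \<Rightarrow> (nat \<Rightarrow> 'a \<Rightarrow> real) \<Rightarrow> (nat \<Rightarrow> 'a \<Rightarrow> real) \<Rightarrow> real \<Rightarrow> real \<Rightarrow> real \<Rightarrow> real measure"
  where
  "scaled_law M T X h \<tau> t = distr M borel (ctrw (\<lambda>n \<omega>. \<tau> * T n \<omega>) (\<lambda>n \<omega>. h * X n \<omega>) t)"

definition iid :: "'a measure \<Rightarrow> (nat \<Rightarrow> 'a \<Rightarrow> real) \<Rightarrow> (real \<Rightarrow> real) \<Rightarrow> bool" where
  "iid M Y F \<longleftrightarrow> prob_space.indep_vars M (\<lambda>_. borel) Y UNIV \<and>
     (\<forall>n. cdf (distr M borel (Y n)) = F)"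

definition indep_sequences ::
  "'a measure \<Rightarrow> (nat \<Rightarrow> 'a \<Rightarrow> real) \<Rightarrow> (nat \<Rightarrow> 'a \<Rightarrow> real) \<Rightarrow> bool" where
  "indep_sequences M Y Z \<longleftrightarrow>
     prob_space.indep_var M (\<Pi>\<^sub>M n\<in>UNIV. borel) (\<lambda>\<omega> n. Y n \<omega>) (\<Pi>\<^sub>M n\<in>UNIV. borel) (\<lambda>\<omega> n. Z n \<omega>)"

text \<open>Integrals against a distribution function are taken with respect to its
  Lebesgue-Stieltjes measure \<open>interval_measure\<close>.\<close>

definition jump_regime :: "(real \<Rightarrow> real) \<Rightarrow> real \<Rightarrow> real \<Rightarrow> bool" where
  "jump_regime W \<alpha> \<mu> \<longleftrightarrow>
     (integrable (interval_measure W) (\<lambda>x. x\<^sup>2) \<and>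
      (LINT x|interval_measure W. x\<^sup>2) > 0 \<and>
      \<alpha> = 2 \<and> \<mu> = (LINT x|interval_measure W. x\<^sup>2) / 2)
   \<or> (0 < \<alpha> \<and> \<alpha> < 2 \<and>
      (\<exists>b>0. (\<lambda>x. measure (interval_measure W) {x<..}) \<sim>[at_top] (\<lambda>x. b / \<alpha> * x powr (- \<alpha>)) \<and>
         \<mu> = b * pi / (Gamma (\<alpha> + 1) * sin (\<alpha> * pi / 2))))"

definition waiting_regime :: "(real \<Rightarrow> real) \<Rightarrow> real \<Rightarrow> real \<Rightarrow> bool" where
  "waiting_regime \<Phi> \<beta> lam \<longleftrightarrow>
     (set_integrable (interval_measure \<Phi>) {0..} (\<lambda>t. t) \<and>
      \<beta> = 1 \<and> lam = (LINT t:{0..}|interval_measure \<Phi>. t))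
   \<or> (0 < \<beta> \<and> \<beta> < 1 \<and>
      (\<exists>c>0. (\<lambda>t. 1 - \<Phi> t) \<sim>[at_top] (\<lambda>t. c / \<beta> * t powr (- \<beta>)) \<and>
         lam = c * pi / (Gamma (\<beta> + 1) * sin (\<beta> * pi))))"

text \<open>\<open>h\<close> and \<open>\<tau>\<close> tend to \<open>0\<close> from above, jointly and along the scaling relation.\<close>

definition scaling_limit :: "real \<Rightarrow> real \<Rightarrow> real \<Rightarrow> real \<Rightarrow> (real \<times> real) filter" where
  "scaling_limit \<alpha> \<beta> \<mu> lam =
     inf (at_right 0 \<times>\<^sub>F at_right 0)
         (principal {(h, \<tau>). \<mu> * h powr \<alpha> / (lam * \<tau> powr \<beta>) = 1})"

text \<open>The library's weak convergence is for sequences; along a general filter it is required for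
  every sequence converging along that filter.\<close>

definition weak_conv_along :: "('b \<Rightarrow> real measure) \<Rightarrow> real measure \<Rightarrow> 'b filter \<Rightarrow> bool" where
  "weak_conv_along \<nu> \<nu>' F \<longleftrightarrow>
     (\<forall>g :: nat \<Rightarrow> 'b. filterlim g F sequentially \<longrightarrow> weak_conv_m (\<lambda>n. \<nu> (g n)) \<nu>')"

text \<open>The Fourier transform of a law is its characteristic function.\<close>

definition fourier_laplace :: "(real \<Rightarrow> real measure) \<Rightarrow> real \<Rightarrow> real \<Rightarrow> complex" where
  "fourier_laplace p \<kappa> s = (LBINT t:{0..}. exp (- s * t) *\<^sub>R char (p t) \<kappa>)"

definition mittag_leffler :: "real \<Rightarrow> real \<Rightarrow> real" where
  "mittag_leffler \<beta> z = (\<Sum>n. z ^ n / Gamma (1 + \<beta> * real n))"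

text \<open>The space-time fractional Cauchy problem in the Fourier-Laplace domain. The Riesz operator
  has symbol \<open>- \<bar>\<kappa>\<bar> powr \<alpha>\<close>, and the Caputo derivative of order \<open>\<beta>\<close> of \<open>g\<close> has Laplace transform
  \<open>s powr \<beta> * L g s - s powr (\<beta> - 1) * g 0\<close>, where \<open>L g\<close> is the Laplace transform of \<open>g\<close>. Here
  \<open>g 0 = 1\<close>, the Fourier transform of the initial Dirac measure.\<close>

definition solves_fractional_cauchy :: "real \<Rightarrow> real \<Rightarrow> (real \<Rightarrow> real measure) \<Rightarrow> bool" where
  "solves_fractional_cauchy \<alpha> \<beta> u \<longleftrightarrow>
     (\<forall>t\<ge>0. real_distribution (u t)) \<and>
     u 0 = return borel 0 \<and>
     (\<forall>\<kappa> s. s > 0 \<longrightarrow>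
        set_integrable lborel {0..} (\<lambda>t. exp (- s * t) *\<^sub>R char (u t) \<kappa>) \<and>
        of_real (s powr \<beta>) * fourier_laplace u \<kappa> s - of_real (s powr (\<beta> - 1)) =
          - of_real (\<bar>\<kappa>\<bar> powr \<alpha>) * fourier_laplace u \<kappa> s)"

end

theory Submission
  imports Defs
begin

text \<open>
  Let \<open>S\<^sub>n\<close> be the jump instants of the unscaled walk, \<open>w\<close> the characteristic function of a jump
  and \<open>\<phi>\<close> the Laplace transform of a waiting time. Conditioning on the number of jumps up to time
  \<open>t\<close> gives the characteristic function of the walk as \<open>\<Sum>n. w\<^sup>n P(S\<^sub>n \<le> t < S\<^sub>n\<^sub>+\<^sub>1)\<close>. Since \<open>P(S\<^sub>n \<le> t)\<close>
  has Laplace transform \<open>\<phi>(s)\<^sup>n / s\<close>, the Fourier-Laplace transform of the rescaled walk is the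
  Montroll-Weiss quotient \<open>(1 - \<phi>(\<tau> s)) / (s (1 - w(h \<kappa>) \<phi>(\<tau> s)))\<close>
  (\<open>char_ctrw\<close>, \<open>fourier_laplace_scaled_law\<close>).

  The two regimes enter only through \<open>1 - w(\<kappa>) \<sim> \<mu> \<bar>\<kappa>\<bar> powr \<alpha>\<close> and \<open>1 - \<phi>(s) \<sim> lam * s powr \<beta>\<close>
  at the origin (\<open>jump_regime_asymptotics\<close>, \<open>waiting_regime_asymptotics\<close>). With finite moments this
  is dominated convergence. With regularly varying tails an integration by parts turns
  \<open>\<integral>f(\<kappa> x) dP(x)\<close> into an integral of \<open>f'\<close> against the tail of \<open>P\<close>, to which dominated convergence
  applies when \<open>\<bar>f'(u)\<bar> u powr (- \<alpha>)\<close> is integrable (\<open>abelian_regular_tail\<close>). For the cosine that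
  integral converges only conditionally when \<open>\<alpha> \<le> 1\<close>, so the cosine is cut off after finitely many
  full periods. Under the scaling relation the quotient then tends to
  \<open>s powr (\<beta> - 1) / (\<bar>\<kappa>\<bar> powr \<alpha> + s powr \<beta>)\<close>.

  Convergence of the laws at a fixed time needs an inversion of the Laplace transform, and here
  the symmetry of the jumps is decisive: \<open>w\<close> is real, and close to the origin it lies in \<open>[0, 1]\<close>,
  so the characteristic function of the walk, an expectation of \<open>w\<close> raised to the number of jumps
  up to time \<open>t\<close>, is nonincreasing in \<open>t\<close>. For monotone functions convergence of the Laplace
  transforms to that of a continuous function forces pointwise convergence
  (\<open>laplace_continuity_monotone\<close>). The limit is \<open>E\<^sub>\<beta>(- \<bar>\<kappa>\<bar> powr \<alpha> * t powr \<beta>)\<close>, whose Laplace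
  transform is computed from the series for large \<open>s\<close>
  (\<open>has_bochner_integral_laplace_mittag_leffler\<close>). It is continuous at \<open>\<kappa> = 0\<close>, so by Levy's
  theorem it is a characteristic function (\<open>levy_limit_is_char\<close>); this constructs the limit law and,
  along every admissible sequence, gives weak convergence to it. That the Laplace transform of the
  limit has the stated form for all \<open>s > 0\<close>, and not only for large \<open>s\<close>, follows by passing to the
  limit in the transforms of the walks, which are bounded by 1.
\<close>

section \<open>Exponential and Gamma integrals\<close>

lemma has_bochner_integral_laplace_powr:
  fixes x s :: real
  assumes "x > 0" "s > 0"
  shows "has_bochner_integral lborel (\<lambda>t. indicator {0..} t * (exp (- s * t) * t powr (x - 1))) (Gamma x / s powr x)"
proof -
  have G: "Gamma x > 0" using assms by (simp add: Gamma_real_pos)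
  have "has_bochner_integral lborel (\<lambda>t. indicator {0..} t * t powr (x - 1) / exp t) (Gamma x)"
    using G Gamma_conv_nn_integral_real[OF assms(1)] by (intro has_bochner_integral_nn_integral) auto
  then have "has_bochner_integral lborel (\<lambda>t. indicator {0..} (0 + s * t) * (0 + s * t) powr (x - 1) / exp (0 + s * t))
      (Gamma x /\<^sub>R \<bar>s\<bar>)"
    using assms by (subst (asm) lborel_has_bochner_integral_real_affine_iff[where c=s and t=0]) auto
  then have "has_bochner_integral lborel
      (\<lambda>t. (1 / s powr (x - 1)) * (indicator {0..} (0 + s * t) * (0 + s * t) powr (x - 1) / exp (0 + s * t)))
      ((1 / s powr (x - 1)) * (Gamma x /\<^sub>R \<bar>s\<bar>))"
    by (rule has_bochner_integral_mult_right)
  also have "(\<lambda>t. (1 / s powr (x - 1)) * (indicator {0..} (0 + s * t) * (0 + s * t) powr (x - 1) / exp (0 + s * t)))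
      = (\<lambda>t. indicator {0..} t * (exp (- s * t) * t powr (x - 1)))"
    using assms by (auto simp: fun_eq_iff indicator_def powr_mult exp_minus field_simps zero_le_mult_iff)
  also have "(1 / s powr (x - 1)) * (Gamma x /\<^sub>R \<bar>s\<bar>) = Gamma x / s powr x"
    using assms by (simp add: powr_diff divide_simps)
  finally show ?thesis .
qed

lemma has_bochner_integral_exp_atLeast:
  fixes a s :: real
  assumes "s > 0"
  shows "has_bochner_integral lborel (\<lambda>t. indicator {a..} t * exp (- s * t)) (exp (- s * a) / s)"
proof -
  have "has_bochner_integral lborel (\<lambda>t. indicator {0..} t * exp (- s * t)) (1 / s)"
  proof (rule has_bochner_integralI_AE)
    show "has_bochner_integral lborel (\<lambda>t. indicator {0..} t * (exp (- s * t) * t powr 0)) (1 / s)"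
      using has_bochner_integral_laplace_powr[of 1 s] assms by simp
    show "AE t in lborel. indicator {0..} t * (exp (- s * t) * t powr 0) = indicator {0..} t * exp (- s * t)"
      using AE_lborel_singleton[of 0] by eventually_elim auto
  qed (use assms in auto)
  then have "has_bochner_integral lborel (\<lambda>t. indicator {0..} (- a + 1 * t) * exp (- s * (- a + 1 * t))) (1 / s)"
    by (subst (asm) lborel_has_bochner_integral_real_affine_iff[where c=1 and t="- a"]) auto
  then have "has_bochner_integral lborel
      (\<lambda>t. exp (- s * a) * (indicator {0..} (- a + 1 * t) * exp (- s * (- a + 1 * t)))) (exp (- s * a) * (1 / s))"
    by (rule has_bochner_integral_mult_right)
  also have "(\<lambda>t. exp (- s * a) * (indicator {0..} (- a + 1 * t) * exp (- s * (- a + 1 * t))))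
      = (\<lambda>t. indicator {a..} t * exp (- s * t))"
    by (auto simp: fun_eq_iff indicator_def exp_add[symmetric] algebra_simps)
  finally show ?thesis by simp
qed

section \<open>Existence of the limit in Levy's continuity theorem\<close>

text \<open>Fubini, and the fact that the standard normal density is its own characteristic function up to a factor.\<close>

lemma gaussian_average_char:
  assumes "real_distribution \<mu>"
  shows "(LINT \<kappa>|std_normal_distribution. char \<mu> (\<epsilon> * \<kappa>)) = of_real (LINT x|\<mu>. exp (- (\<epsilon> * x)\<^sup>2 / 2))"
proof -
  interpret \<mu>: real_distribution \<mu> by fact
  interpret N: real_distribution std_normal_distribution by (rule real_dist_normal_dist)
  interpret P: pair_prob_space \<mu> std_normal_distribution ..
  have "(LINT \<kappa>|std_normal_distribution. LINT x|\<mu>. iexp (\<epsilon> * \<kappa> * x)) =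
      (LINT x|\<mu>. LINT \<kappa>|std_normal_distribution. iexp (\<epsilon> * \<kappa> * x))"
  proof (rule P.Fubini_integral, rule P.integrable_const_bound[where B=1])
    show "(\<lambda>(x, \<kappa>). iexp (\<epsilon> * \<kappa> * x)) \<in> borel_measurable (\<mu> \<Otimes>\<^sub>M std_normal_distribution)"
      by measurable
  qed (auto simp del: of_real_mult)
  also have "\<dots> = (LINT x|\<mu>. char std_normal_distribution (\<epsilon> * x))"
    unfolding char_def by (simp add: mult_ac)
  finally show ?thesis
    unfolding char_std_normal_distribution by (simp add: char_def)
qed

text \<open>Averaging \<open>1 - char \<mu>\<close> over a Gaussian of width \<open>\<epsilon>\<close> integrates \<open>1 - exp (- (\<epsilon> x)\<^sup>2 / 2)\<close> against \<open>\<mu>\<close>,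
  which stays away from 0 as soon as \<open>\<bar>x\<bar> \<ge> 1 / \<epsilon>\<close>. So the behaviour of the characteristic function
  near 0 controls the tails.\<close>

lemma tail_le_gaussian_average:
  assumes "real_distribution \<mu>" "\<epsilon> > 0"
  shows "(1 - exp (- 1 / 2)) * measure \<mu> {x. 1 / \<epsilon> \<le> \<bar>x\<bar>}
    \<le> norm (LINT \<kappa>|std_normal_distribution. 1 - char \<mu> (\<epsilon> * \<kappa>))"
proof -
  interpret \<mu>: real_distribution \<mu> by fact
  interpret N: real_distribution std_normal_distribution by (rule real_dist_normal_dist)
  let ?e = "\<lambda>x. exp (- (\<epsilon> * x)\<^sup>2 / 2)"
  have int: "integrable \<mu> ?e"
    by (rule \<mu>.integrable_const_bound[where B=1]) auto
  have "(1 - exp (- 1 / 2)) * measure \<mu> {x. 1 / \<epsilon> \<le> \<bar>x\<bar>}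
      = (LINT x|\<mu>. (1 - exp (- 1 / 2)) * indicator {x. 1 / \<epsilon> \<le> \<bar>x\<bar>} x)"
    by simp
  also have "\<dots> \<le> (LINT x|\<mu>. 1 - ?e x)"
  proof (rule integral_mono)
    show "integrable \<mu> (\<lambda>x. (1 - exp (- 1 / 2)) * indicator {x. 1 / \<epsilon> \<le> \<bar>x\<bar>} x)"
      by (intro integrable_mult_right \<mu>.integrable_const_bound[where B=1]) (auto simp: indicator_def)
    fix x
    show "(1 - exp (- 1 / 2)) * indicator {x. 1 / \<epsilon> \<le> \<bar>x\<bar>} x \<le> 1 - ?e x"
    proof (cases "1 / \<epsilon> \<le> \<bar>x\<bar>")
      case True
      then have "1 \<le> \<bar>\<epsilon> * x\<bar>"
        using assms by (simp add: field_simps abs_mult)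
      then have "1 \<le> (\<epsilon> * x)\<^sup>2"
        using abs_le_square_iff[of 1 "\<epsilon> * x"] by simp
      with True show ?thesis by simp
    qed auto
  qed (use int in auto)
  also have "\<dots> = 1 - (LINT x|\<mu>. ?e x)"
    using int \<mu>.prob_space by simp
  also have "\<dots> = Re (LINT \<kappa>|std_normal_distribution. 1 - char \<mu> (\<epsilon> * \<kappa>))"
  proof -
    have "integrable std_normal_distribution (\<lambda>\<kappa>. char \<mu> (\<epsilon> * \<kappa>))"
      by (rule N.integrable_const_bound[where B=1]) (auto simp: \<mu>.cmod_char_le_1)
    then show ?thesis
      using N.prob_space by (simp add: gaussian_average_char[OF assms(1)])
  qed
  also have "\<dots> \<le> norm (LINT \<kappa>|std_normal_distribution. 1 - char \<mu> (\<epsilon> * \<kappa>))"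
    by (rule complex_Re_le_cmod)
  finally show ?thesis .
qed

text \<open>The tail estimate gives tightness, and every weak limit of a subsequence has the characteristic
  function \<open>g\<close>.\<close>

theorem levy_limit_is_char:
  fixes \<mu> :: "nat \<Rightarrow> real measure" and g :: "real \<Rightarrow> complex"
  assumes distr: "\<And>n. real_distribution (\<mu> n)"
    and conv: "\<And>\<kappa>. (\<lambda>n. char (\<mu> n) \<kappa>) \<longlonglongrightarrow> g \<kappa>"
    and cont: "isCont g 0"
  obtains \<nu> where "real_distribution \<nu>" "\<And>\<kappa>. char \<nu> \<kappa> = g \<kappa>"
proof -
  interpret \<mu>: real_distribution "\<mu> n" for n by (rule distr)
  let ?N = std_normal_distribution
  interpret N: real_distribution ?N by (rule real_dist_normal_dist)
  have g_meas [measurable]: "g \<in> borel_measurable borel"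
    by (rule borel_measurable_LIMSEQ_metric[OF _ conv]) simp
  have g_le: "norm (g \<kappa>) \<le> 1" for \<kappa>
    by (rule LIMSEQ_le_const2[OF tendsto_norm[OF conv]]) (auto simp: \<mu>.cmod_char_le_1)
  have g0: "g 0 = 1"
    using LIMSEQ_unique[OF conv[of 0]] by (simp add: \<mu>.char_zero)
  have le2: "norm (1 - z) \<le> 2" if "norm z \<le> 1" for z :: complex
    using norm_triangle_ineq4[of 1 z] that by simp
  have I_lim: "(\<lambda>n. LINT \<kappa>|?N. 1 - char (\<mu> n) (\<epsilon> * \<kappa>)) \<longlonglongrightarrow> (LINT \<kappa>|?N. 1 - g (\<epsilon> * \<kappa>))" for \<epsilon>
    by (rule integral_dominated_convergence[where w="\<lambda>_. 2"])
      (auto intro!: tendsto_intros conv le2 simp: \<mu>.cmod_char_le_1)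
  have I0: "(\<lambda>k. LINT \<kappa>|?N. 1 - g (inverse (real (Suc k)) * \<kappa>)) \<longlonglongrightarrow> (LINT \<kappa>|?N. 0)"
  proof (rule integral_dominated_convergence[where w="\<lambda>_. 2"])
    show "AE \<kappa> in ?N. (\<lambda>k. 1 - g (inverse (real (Suc k)) * \<kappa>)) \<longlonglongrightarrow> 0"
    proof (rule AE_I2)
      fix \<kappa> :: real
      have "(\<lambda>k. inverse (real (Suc k)) * \<kappa>) \<longlonglongrightarrow> 0 * \<kappa>"
        by (intro tendsto_intros LIMSEQ_inverse_real_of_nat)
      then have "(\<lambda>k. g (inverse (real (Suc k)) * \<kappa>)) \<longlonglongrightarrow> g 0"
        by (intro isCont_tendsto_compose[OF cont]) simp
      then show "(\<lambda>k. 1 - g (inverse (real (Suc k)) * \<kappa>)) \<longlonglongrightarrow> 0"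
        using tendsto_diff[OF tendsto_const[of 1]] g0 by fastforce
    qed
  qed (auto intro!: le2 g_le)
  have "\<exists>a b. a < b \<and> (\<forall>n. 1 - e < measure (\<mu> n) {a<..b})" if "e > 0" for e
  proof -
    \<comment> \<open>All but finitely many laws are handled by the tail estimate with one \<open>\<epsilon>\<close>, the others one by one.\<close>
    let ?c = "1 - exp (- 1 / 2) :: real"
    have c: "?c > 0" by simp
    have "\<forall>\<^sub>F k in sequentially. norm (LINT \<kappa>|?N. 1 - g (inverse (real (Suc k)) * \<kappa>)) < ?c * e"
      using order_tendstoD(2)[OF tendsto_norm[OF I0], of "?c * e"] c \<open>e > 0\<close> by simp
    then obtain k where k: "norm (LINT \<kappa>|?N. 1 - g (inverse (real (Suc k)) * \<kappa>)) < ?c * e"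
      using eventually_happens trivial_limit_sequentially by blast
    define \<epsilon> where "\<epsilon> = inverse (real (Suc k))"
    have \<epsilon>: "\<epsilon> > 0" by (simp add: \<epsilon>_def)
    obtain N where N: "norm (LINT \<kappa>|?N. 1 - char (\<mu> n) (\<epsilon> * \<kappa>)) < ?c * e" if "n \<ge> N" for n
      using order_tendstoD(2)[OF tendsto_norm[OF I_lim[of \<epsilon>]], of "?c * e"] k
      by (auto simp: eventually_sequentially \<epsilon>_def)
    have large: "1 - e < measure (\<mu> n) {- real K<..real K}" if "n \<ge> N" "real K \<ge> 1 / \<epsilon>" for n K
    proof -
      have "?c * measure (\<mu> n) {x. 1 / \<epsilon> \<le> \<bar>x\<bar>} < ?c * e"
        using tail_le_gaussian_average[OF distr \<epsilon>, of n] N[OF that(1)] by (rule le_less_trans)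
      then have "measure (\<mu> n) {x. 1 / \<epsilon> \<le> \<bar>x\<bar>} < e"
        using c mult_less_cancel_left_pos by blast
      moreover have "measure (\<mu> n) (UNIV - {- real K<..real K}) \<le> measure (\<mu> n) {x. 1 / \<epsilon> \<le> \<bar>x\<bar>}"
        using that(2) by (intro \<mu>.finite_measure_mono) auto
      ultimately show ?thesis
        using \<mu>.prob_compl[of "{- real K<..real K}" n] by simp
    qed
    have "\<forall>\<^sub>F K in sequentially. 1 - e < measure (\<mu> n) {- real K<..real K}" for n
    proof -
      have "(\<lambda>K. cdf (\<mu> n) (real K) - cdf (\<mu> n) (- real K)) \<longlonglongrightarrow> 1 - 0"
        by (intro tendsto_diff \<mu>.cdf_lim_infty_prob \<mu>.cdf_lim_neg_infty)
      then have "\<forall>\<^sub>F K in sequentially. 1 - e < cdf (\<mu> n) (real K) - cdf (\<mu> n) (- real K)"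
        using \<open>e > 0\<close> by (intro order_tendstoD) auto
      then show ?thesis
        using eventually_gt_at_top[of 0]
        by eventually_elim (simp add: \<mu>.cdf_diff_eq)
    qed
    then have "\<forall>\<^sub>F K in sequentially. \<forall>n\<in>{..<N}. 1 - e < measure (\<mu> n) {- real K<..real K}"
      by (intro eventually_ball_finite) auto
    moreover have "\<forall>\<^sub>F K in sequentially. real K \<ge> 1 / \<epsilon>"
      using filterlim_real_sequentially by (auto simp: filterlim_at_top)
    ultimately have "\<forall>\<^sub>F K in sequentially. - real K < real K \<and>
        (\<forall>n. 1 - e < measure (\<mu> n) {- real K<..real K})"
      using eventually_gt_at_top[of 0]
    proof eventually_elim
      case (elim K)
      then show ?case using large by (metis lessThan_iff neg_less_0_iff_less of_nat_0_less_iff order_less_trans not_le)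
    qed
    then show ?thesis
      using eventually_happens trivial_limit_sequentially by blast
  qed
  then have "tight \<mu>"
    using distr by (simp add: tight_def)
  then obtain r \<nu> where r: "strict_mono r" "real_distribution \<nu>" "weak_conv_m (\<mu> \<circ> id \<circ> r) \<nu>"
    using tight_imp_convergent_subsubsequence[of \<mu> id] by (auto simp: strict_mono_id)
  have "char \<nu> \<kappa> = g \<kappa>" for \<kappa>
  proof (rule LIMSEQ_unique)
    show "(\<lambda>n. char ((\<mu> \<circ> r) n) \<kappa>) \<longlonglongrightarrow> char \<nu> \<kappa>"
      using r distr by (intro levy_continuity1) (auto simp: comp_def)
    show "(\<lambda>n. char ((\<mu> \<circ> r) n) \<kappa>) \<longlonglongrightarrow> g \<kappa>"
      using LIMSEQ_subseq_LIMSEQ[OF conv r(1)] by (simp add: comp_def)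
  qed
  with r(2) show ?thesis by (rule that)
qed

section \<open>Laplace transforms of monotone functions\<close>

text \<open>In the variable \<open>x = exp (- t)\<close> the hypothesis says that the integrals against all monomials \<open>x\<^sup>i\<close>
  tend to 0; by the Weierstrass theorem the same holds for continuous functions of \<open>x\<close>.\<close>

lemma laplace_null_continuous_test:
  fixes d :: "'b \<Rightarrow> real \<Rightarrow> real"
  assumes int: "\<And>n. integrable lborel (\<lambda>t. exp (- s0 * t) * d n t)"
    and supp: "\<And>n t. t < 0 \<Longrightarrow> d n t = 0"
    and bound: "\<forall>\<^sub>F n in F. (LINT t|lborel. exp (- s0 * t) * \<bar>d n t\<bar>) \<le> C"
    and lim: "\<And>s. s \<ge> s0 \<Longrightarrow> ((\<lambda>n. LINT t|lborel. exp (- s * t) * d n t) \<longlongrightarrow> 0) F"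
    and f: "continuous_on {0..1} f" "f \<in> borel_measurable borel"
  shows "((\<lambda>n. LINT t|lborel. f (exp (- t)) * (exp (- s0 * t) * d n t)) \<longlongrightarrow> 0) F"
proof -
  have int_test: "integrable lborel (\<lambda>t. p (exp (- t)) * (exp (- s0 * t) * d n t))"
    if p: "continuous_on {0..1} p" "p \<in> borel_measurable borel" for p :: "real \<Rightarrow> real" and n
  proof -
    have "compact (p ` {0..1})"
      using p(1) by (intro compact_continuous_image) auto
    then obtain B where B: "\<And>x. x \<in> {0..1} \<Longrightarrow> \<bar>p x\<bar> \<le> B"
      using compact_imp_bounded bounded_iff by (metis imageI real_norm_def)
    show ?thesis
    proof (rule Bochner_Integration.integrable_bound)
      show "integrable lborel (\<lambda>t. B * (exp (- s0 * t) * d n t))"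
        by (intro integrable_mult_right int)
      have [measurable]: "(\<lambda>t. exp (- s0 * t) * d n t) \<in> borel_measurable borel"
        using borel_measurable_integrable[OF int] by simp
      show "(\<lambda>t. p (exp (- t)) * (exp (- s0 * t) * d n t)) \<in> borel_measurable lborel"
        using p(2) by measurable
      show "AE t in lborel. norm (p (exp (- t)) * (exp (- s0 * t) * d n t))
          \<le> norm (B * (exp (- s0 * t) * d n t))"
      proof (rule AE_I2)
        fix t :: real
        show "norm (p (exp (- t)) * (exp (- s0 * t) * d n t)) \<le> norm (B * (exp (- s0 * t) * d n t))"
        proof (cases "t < 0")
          case False
          then have "\<bar>p (exp (- t))\<bar> \<le> B" by (intro B) auto
          then show ?thesis
            by (simp add: abs_mult mult_right_mono)
        qed (simp add: supp)
      qed
    qed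
  qed
  have poly: "((\<lambda>n. LINT t|lborel. p (exp (- t)) * (exp (- s0 * t) * d n t)) \<longlongrightarrow> 0) F"
    if "real_polynomial_function p" for p :: "real \<Rightarrow> real"
  proof -
    obtain a N where p: "p = (\<lambda>x. \<Sum>i\<le>N. a i * x ^ i)"
      using \<open>real_polynomial_function p\<close> real_polynomial_function_iff_sum by blast
    have int_pow: "integrable lborel (\<lambda>t. exp (- t) ^ i * (exp (- s0 * t) * d n t))" for i n
      by (rule int_test[of "\<lambda>x. x ^ i"]) (auto intro!: continuous_intros)
    have exp_shift: "exp (- t) ^ i * (exp (- s0 * t) * y) = exp (- (s0 + real i) * t) * y" for i t y
    proof -
      have "exp (- t) ^ i * exp (- s0 * t) = exp (- (s0 + real i) * t)"
        unfolding exp_of_nat_mult[symmetric] exp_add[symmetric] by (simp add: algebra_simps)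
      then show ?thesis by (metis mult.assoc)
    qed
    have eq: "(LINT t|lborel. p (exp (- t)) * (exp (- s0 * t) * d n t)) =
        (\<Sum>i\<le>N. a i * (LINT t|lborel. exp (- (s0 + real i) * t) * d n t))" for n
    proof -
      have "(LINT t|lborel. p (exp (- t)) * (exp (- s0 * t) * d n t))
          = (LINT t|lborel. (\<Sum>i\<le>N. a i * (exp (- t) ^ i * (exp (- s0 * t) * d n t))))"
        by (simp add: p sum_distrib_right mult.assoc)
      also have "\<dots> = (\<Sum>i\<le>N. a i * (LINT t|lborel. exp (- t) ^ i * (exp (- s0 * t) * d n t)))"
        by (subst Bochner_Integration.integral_sum) (intro integrable_mult_right int_pow, simp)
      also have "\<dots> = (\<Sum>i\<le>N. a i * (LINT t|lborel. exp (- (s0 + real i) * t) * d n t))"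
        by (simp only: exp_shift)
      finally show ?thesis .
    qed
    have "((\<lambda>n. \<Sum>i\<le>N. a i * (LINT t|lborel. exp (- (s0 + real i) * t) * d n t))
        \<longlongrightarrow> (\<Sum>i\<le>N. a i * 0)) F"
      by (intro tendsto_intros lim) simp
    then show ?thesis by (simp only: eq mult_zero_right sum.neutral_const)
  qed
  show ?thesis
  proof (rule tendstoI)
    fix e :: real assume "e > 0"
    define e' where "e' = e / (2 * (\<bar>C\<bar> + 1))"
    have "e' > 0" using \<open>e > 0\<close> by (simp add: e'_def)
    obtain p where p: "real_polynomial_function p" "\<And>x. x \<in> {0..1} \<Longrightarrow> \<bar>f x - p x\<bar> < e'"
      using Stone_Weierstrass_real_polynomial_function[OF _ f(1) \<open>e' > 0\<close>] by blast
    have p_cont: "continuous_on S p" for S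
      using p(1) by (simp add: continuous_on_polymonial_function real_polynomial_function_eq)
    have p_meas: "p \<in> borel_measurable borel"
      using p_cont by (intro borel_measurable_continuous_onI)
    have "\<forall>\<^sub>F n in F. \<bar>LINT t|lborel. p (exp (- t)) * (exp (- s0 * t) * d n t)\<bar> < e / 2"
      using tendstoD[OF poly[OF p(1)], of "e / 2"] \<open>e > 0\<close> by simp
    with bound show "\<forall>\<^sub>F n in F. dist (LINT t|lborel. f (exp (- t)) * (exp (- s0 * t) * d n t)) 0 < e"
    proof eventually_elim
      case (elim n)
      let ?Lf = "LINT t|lborel. f (exp (- t)) * (exp (- s0 * t) * d n t)"
      let ?Lp = "LINT t|lborel. p (exp (- t)) * (exp (- s0 * t) * d n t)"
      have diff: "?Lf - ?Lp
        = (LINT t|lborel. f (exp (- t)) * (exp (- s0 * t) * d n t) - p (exp (- t)) * (exp (- s0 * t) * d n t))"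
        by (intro Bochner_Integration.integral_diff[symmetric] int_test f p_cont p_meas)
      have "\<bar>?Lf - ?Lp\<bar> \<le> (LINT t|lborel. e' * (exp (- s0 * t) * \<bar>d n t\<bar>))"
        unfolding diff
      proof (rule integral_abs_bound_integral)
        show "integrable lborel (\<lambda>t. f (exp (- t)) * (exp (- s0 * t) * d n t)
            - p (exp (- t)) * (exp (- s0 * t) * d n t))"
          by (intro Bochner_Integration.integrable_diff int_test f p_cont p_meas)
        show "integrable lborel (\<lambda>t. e' * (exp (- s0 * t) * \<bar>d n t\<bar>))"
          using integrable_abs[OF int[of n]] by (intro integrable_mult_right) (simp add: abs_mult)
        fix t :: real
        show "\<bar>f (exp (- t)) * (exp (- s0 * t) * d n t) - p (exp (- t)) * (exp (- s0 * t) * d n t)\<bar>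
            \<le> e' * (exp (- s0 * t) * \<bar>d n t\<bar>)"
        proof (cases "t < 0")
          case False
          then have "\<bar>f (exp (- t)) - p (exp (- t))\<bar> \<le> e'" by (intro less_imp_le p) auto
          then show ?thesis
            by (simp add: abs_mult left_diff_distrib[symmetric] mult_right_mono)
        qed (simp add: supp)
      qed
      moreover have "(LINT t|lborel. e' * (exp (- s0 * t) * \<bar>d n t\<bar>)) \<le> e' * C"
        using elim(1) \<open>e' > 0\<close> by simp
      moreover have "e' * C \<le> e / 2"
      proof -
        have "e' * C \<le> e' * (\<bar>C\<bar> + 1)" using \<open>e' > 0\<close> by (intro mult_left_mono) auto
        also have "\<dots> = e / 2" by (simp add: e'_def divide_simps)
        finally show ?thesis .
      qed
      ultimately have "\<bar>?Lf - ?Lp\<bar> \<le> e / 2" by linarith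
      then show ?case using elim(2) by (simp only: dist_real_def diff_0_right)
    qed
  qed
qed

text \<open>Monotonicity lets \<open>m n t0\<close> be compared with averages of \<open>m n\<close> over short intervals on either side of
  \<open>t0\<close>. Such averages are integrals against continuous bumps, so they converge to averages of \<open>g\<close>,
  and these are close to \<open>g t0\<close> by continuity.\<close>

theorem laplace_continuity_monotone:
  fixes m :: "'b \<Rightarrow> real \<Rightarrow> real" and g :: "real \<Rightarrow> real"
  assumes s0: "s0 > 0"
    and meas: "\<And>n. m n \<in> borel_measurable borel"
    and bounds: "\<And>n t. t \<ge> 0 \<Longrightarrow> \<bar>m n t\<bar> \<le> 1"
    and mono: "\<forall>\<^sub>F n in F. \<forall>t\<ge>0. \<forall>t'\<ge>t. m n t' \<le> m n t"
    and g_int: "set_integrable lborel {0..} (\<lambda>t. exp (- s0 * t) * g t)"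
    and g_cont: "continuous_on {0<..} g"
    and lim: "\<And>s. s \<ge> s0 \<Longrightarrow> ((\<lambda>n. LBINT t:{0..}. exp (- s * t) * m n t) \<longlongrightarrow>
        (LBINT t:{0..}. exp (- s * t) * g t)) F"
    and t0: "t0 > 0"
  shows "((\<lambda>n. m n t0) \<longlongrightarrow> g t0) F"
proof -
  let ?I = "indicator {0..} :: real \<Rightarrow> real"
  let ?d = "\<lambda>n t. ?I t * (m n t - g t)"
  note [measurable] = meas
  have m_int: "integrable lborel (\<lambda>t. ?I t * (exp (- s * t) * m n t))" if "s > 0" for s n
  proof (rule Bochner_Integration.integrable_bound)
    show "integrable lborel (\<lambda>t. ?I t * exp (- s * t))"
      using has_bochner_integral_exp_atLeast[OF that, of 0] by (simp add: has_bochner_integral_iff)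
    show "AE t in lborel. norm (?I t * (exp (- s * t) * m n t)) \<le> norm (?I t * exp (- s * t))"
      using bounds[of _ n] by (auto simp: indicator_def abs_mult)
  qed measurable
  have g_int': "integrable lborel (\<lambda>t. ?I t * (exp (- s * t) * g t))" if "s \<ge> s0" for s
  proof (rule Bochner_Integration.integrable_bound)
    show "integrable lborel (\<lambda>t. ?I t * (exp (- s0 * t) * g t))"
      using g_int by (simp add: set_integrable_def)
    have [measurable]: "(\<lambda>t. ?I t * (exp (- s0 * t) * g t)) \<in> borel_measurable borel"
      using borel_measurable_integrable[OF g_int[unfolded set_integrable_def]] by simp
    have "(\<lambda>t. exp ((s0 - s) * t) * (?I t * (exp (- s0 * t) * g t))) \<in> borel_measurable lborel"
      by measurable
    also have "(\<lambda>t. exp ((s0 - s) * t) * (?I t * (exp (- s0 * t) * g t))) = (\<lambda>t. ?I t * (exp (- s * t) * g t))"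
      by (auto simp: fun_eq_iff exp_add[symmetric] algebra_simps indicator_def)
    finally show "(\<lambda>t. ?I t * (exp (- s * t) * g t)) \<in> borel_measurable lborel" .
    show "AE t in lborel. norm (?I t * (exp (- s * t) * g t)) \<le> norm (?I t * (exp (- s0 * t) * g t))"
      using that by (auto simp: indicator_def abs_mult intro!: mult_right_mono)
  qed
  have d_int: "integrable lborel (\<lambda>t. exp (- s * t) * ?d n t)" if "s \<ge> s0" for s n
    using Bochner_Integration.integrable_diff[OF m_int[of s n] g_int'[OF that]] that s0
    by (simp add: algebra_simps)
  have test: "((\<lambda>n. LINT t|lborel. f (exp (- t)) * (exp (- s0 * t) * ?d n t)) \<longlongrightarrow> 0) F"
    if f: "continuous_on {0..1} f" "f \<in> borel_measurable borel" for f
  proof (rule laplace_null_continuous_test[OF _ _ _ _ f])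
    show "\<forall>\<^sub>F n in F. (LINT t|lborel. exp (- s0 * t) * \<bar>?d n t\<bar>)
        \<le> (LINT t|lborel. ?I t * exp (- s0 * t) + \<bar>?I t * (exp (- s0 * t) * g t)\<bar>)"
    proof (rule always_eventually, rule allI, rule integral_mono)
      fix n
      show "integrable lborel (\<lambda>t. exp (- s0 * t) * \<bar>?d n t\<bar>)"
        using integrable_abs[OF d_int[OF order_refl, of n]] by (simp add: abs_mult)
      show "integrable lborel (\<lambda>t. ?I t * exp (- s0 * t) + \<bar>?I t * (exp (- s0 * t) * g t)\<bar>)"
        using has_bochner_integral_exp_atLeast[OF s0, of 0] g_int'[OF order_refl]
        by (intro Bochner_Integration.integrable_add integrable_abs) (auto simp: has_bochner_integral_iff)
      fix t
      have "\<bar>m n t - g t\<bar> \<le> 1 + \<bar>g t\<bar>" if "t \<ge> 0"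
        using bounds[OF that, of n] by linarith
      then have "exp (- s0 * t) * \<bar>m n t - g t\<bar> \<le> exp (- s0 * t) * (1 + \<bar>g t\<bar>)" if "t \<ge> 0"
        using that by (intro mult_left_mono) auto
      then show "exp (- s0 * t) * \<bar>?d n t\<bar> \<le> ?I t * exp (- s0 * t) + \<bar>?I t * (exp (- s0 * t) * g t)\<bar>"
        by (auto simp: indicator_def abs_mult algebra_simps)
    qed
    fix s assume s: "s \<ge> s0"
    have "((\<lambda>n. (LBINT t:{0..}. exp (- s * t) * m n t) - (LBINT t:{0..}. exp (- s * t) * g t)) \<longlongrightarrow>
        (LBINT t:{0..}. exp (- s * t) * g t) - (LBINT t:{0..}. exp (- s * t) * g t)) F"
      by (intro tendsto_intros lim s)
    also have "(\<lambda>n. (LBINT t:{0..}. exp (- s * t) * m n t) - (LBINT t:{0..}. exp (- s * t) * g t)) =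
        (\<lambda>n. LINT t|lborel. exp (- s * t) * ?d n t)"
      unfolding set_lebesgue_integral_def real_scaleR_def
      using s s0 by (subst Bochner_Integration.integral_diff[OF m_int g_int', symmetric]) (auto simp: algebra_simps)
    finally show "((\<lambda>n. LINT t|lborel. exp (- s * t) * ?d n t) \<longlongrightarrow> 0) F" by simp
  qed (use d_int in auto)
  have bump: "\<exists>\<phi> c. c > 0 \<and> has_bochner_integral lborel \<phi> c \<and> (\<forall>t. 0 \<le> \<phi> t) \<and> (\<forall>t. t \<notin> {a..b} \<longrightarrow> \<phi> t = 0)
      \<and> (\<forall>n. integrable lborel (\<lambda>t. \<phi> t * m n t)) \<and> integrable lborel (\<lambda>t. \<phi> t * g t)
      \<and> ((\<lambda>n. (LINT t|lborel. \<phi> t * m n t) - (LINT t|lborel. \<phi> t * g t)) \<longlongrightarrow> 0) F"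
    if ab: "0 < a" "a < b" for a b :: real
  proof -
    define p q where "p = exp (- b)" and "q = exp (- a)"
    have pq: "0 < p" "p < q" "q < 1" using ab by (auto simp: p_def q_def)
    \<comment> \<open>A bump in the variable \<open>exp (- t)\<close>, positive exactly for \<open>a < t < b\<close>.\<close>
    define f where "f = (\<lambda>x. max 0 ((x - p) * (q - x)))"
    define \<phi> where "\<phi> = (\<lambda>t. f (exp (- t)) * exp (- s0 * t))"
    have f_cont: "continuous_on S f" for S
      unfolding f_def by (intro continuous_intros)
    have f_meas [measurable]: "f \<in> borel_measurable borel"
      using f_cont by (intro borel_measurable_continuous_onI)
    have \<phi>_meas [measurable]: "\<phi> \<in> borel_measurable borel"
      unfolding \<phi>_def by measurable
    have nonneg: "0 \<le> \<phi> t" for t by (simp add: \<phi>_def f_def)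
    have outside: "\<phi> t = 0" if "t \<notin> {a..b}" for t
    proof -
      have "exp (- t) < p \<or> exp (- t) > q" using that by (auto simp: p_def q_def)
      then have "(exp (- t) - p) * (q - exp (- t)) \<le> 0"
        using pq by (auto intro: mult_nonpos_nonneg mult_nonneg_nonpos)
      then show ?thesis by (simp add: \<phi>_def f_def)
    qed
    have inside: "\<phi> t > 0" if "t \<in> {a<..<b}" for t
      using that by (auto simp: \<phi>_def f_def p_def q_def less_max_iff_disj)
    have f_le: "f x \<le> 1" if "x > 0" for x
    proof (cases "p \<le> x \<and> x \<le> q")
      case True
      then have "(x - p) * (q - x) \<le> 1 * 1" using pq by (intro mult_mono) auto
      then show ?thesis by (simp add: f_def)
    next
      case False
      then have "(x - p) * (q - x) \<le> 0"
        using pq by (auto simp: not_le intro: mult_nonpos_nonneg mult_nonneg_nonpos)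
      then show ?thesis by (simp add: f_def)
    qed
    have \<phi>_le: "\<phi> t \<le> exp (- s0 * t)" for t
      using mult_right_mono[OF f_le[of "exp (- t)"], of "exp (- s0 * t)"] by (simp add: \<phi>_def)
    have \<phi>_I: "\<phi> t = ?I t * \<phi> t" for t
      using outside[of t] ab by (auto simp: indicator_def)
    have int_\<phi>: "integrable lborel \<phi>"
    proof (rule Bochner_Integration.integrable_bound)
      show "integrable lborel (\<lambda>t. ?I t * exp (- s0 * t))"
        using has_bochner_integral_exp_atLeast[OF s0, of 0] by (simp add: has_bochner_integral_iff)
      show "AE t in lborel. norm (\<phi> t) \<le> norm (?I t * exp (- s0 * t))"
      proof (rule AE_I2)
        fix t show "norm (\<phi> t) \<le> norm (?I t * exp (- s0 * t))"
          using \<phi>_I[of t] \<phi>_le[of t] nonneg[of t] by (auto simp: indicator_def)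
      qed
    qed measurable
    have "(LINT t|lborel. \<phi> t) \<noteq> 0"
    proof
      assume "(LINT t|lborel. \<phi> t) = 0"
      then have "AE t in lborel. \<phi> t = 0"
        using integral_nonneg_eq_0_iff_AE[OF int_\<phi>] nonneg by simp
      then have "AE t in lborel. t \<notin> {a<..<b}"
      proof eventually_elim
        case (elim t)
        then show ?case using inside[of t] by auto
      qed
      then have "emeasure lborel {a<..<b} = 0"
        by (subst (asm) AE_iff_measurable[of "{a<..<b}"]) auto
      then show False using ab by simp
    qed
    then have c: "(LINT t|lborel. \<phi> t) > 0"
      using Bochner_Integration.integral_nonneg[of lborel \<phi>] nonneg by (simp add: order_less_le)
    have int_h: "integrable lborel (\<lambda>t. \<phi> t * h t)"
      if h: "integrable lborel (\<lambda>t. ?I t * (exp (- s0 * t) * h t))" for h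
    proof -
      have [measurable]: "(\<lambda>t. ?I t * (exp (- s0 * t) * h t)) \<in> borel_measurable borel"
        using borel_measurable_integrable[OF h] by simp
      have eq: "\<phi> t * h t = f (exp (- t)) * (?I t * (exp (- s0 * t) * h t))" for t
        using \<phi>_I[of t] by (auto simp: \<phi>_def indicator_def)
      show ?thesis
      proof (rule Bochner_Integration.integrable_bound[OF h])
        show "AE t in lborel. norm (\<phi> t * h t) \<le> norm (?I t * (exp (- s0 * t) * h t))"
        proof (rule AE_I2)
          fix t :: real
          have "\<bar>f (exp (- t))\<bar> \<le> 1" using f_le[of "exp (- t)"] by (simp add: f_def)
          then show "norm (\<phi> t * h t) \<le> norm (?I t * (exp (- s0 * t) * h t))"
            unfolding eq norm_mult[of "f (exp (- t))"] by (simp add: mult_left_le_one_le)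
        qed
        show "(\<lambda>t. \<phi> t * h t) \<in> borel_measurable lborel"
          unfolding eq by measurable
      qed
    qed
    have "((\<lambda>n. (LINT t|lborel. \<phi> t * m n t) - (LINT t|lborel. \<phi> t * g t)) \<longlongrightarrow> 0) F"
    proof -
      have "(LINT t|lborel. \<phi> t * m n t) - (LINT t|lborel. \<phi> t * g t) =
          (LINT t|lborel. f (exp (- t)) * (exp (- s0 * t) * ?d n t))" for n
      proof -
        have "(LINT t|lborel. \<phi> t * m n t) - (LINT t|lborel. \<phi> t * g t) =
            (LINT t|lborel. \<phi> t * m n t - \<phi> t * g t)"
          using s0 by (intro Bochner_Integration.integral_diff[symmetric] int_h m_int g_int') auto
        also have "\<dots> = (LINT t|lborel. f (exp (- t)) * (exp (- s0 * t) * ?d n t))"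
        proof (rule Bochner_Integration.integral_cong[OF refl])
          fix t show "\<phi> t * m n t - \<phi> t * g t = f (exp (- t)) * (exp (- s0 * t) * ?d n t)"
            using \<phi>_I[of t] by (auto simp: \<phi>_def indicator_def algebra_simps)
        qed
        finally show ?thesis .
      qed
      then show ?thesis using test[OF f_cont f_meas] by simp
    qed
    with c int_\<phi> nonneg outside show ?thesis
      using s0 by (intro exI[of _ \<phi>] exI[of _ "LINT t|lborel. \<phi> t"])
        (auto simp: has_bochner_integral_iff intro!: int_h m_int g_int')
  qed
  have close: "\<exists>\<delta>>0. \<delta> < t0 \<and> (\<forall>t. \<bar>t - t0\<bar> \<le> \<delta> \<longrightarrow> \<bar>g t - g t0\<bar> \<le> e)" if "e > 0" for e
  proof -
    have "isCont g t0"
      using g_cont t0 by (intro continuous_on_interior[of "{0<..}"]) (auto simp: interior_open)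
    then obtain \<delta> where \<delta>: "\<delta> > 0" "\<And>t. \<bar>t - t0\<bar> < \<delta> \<Longrightarrow> \<bar>g t - g t0\<bar> < e"
      using \<open>e > 0\<close> by (auto simp: continuous_at_eps_delta dist_real_def)
    show ?thesis
      by (rule exI[of _ "min (\<delta> / 2) (t0 / 2)"]) (use \<delta> t0 in \<open>auto intro!: less_imp_le\<close>)
  qed
  show ?thesis
  proof (rule order_tendstoI)
    fix y assume "y < g t0"
    define e where "e = (g t0 - y) / 2"
    have "e > 0" using \<open>y < g t0\<close> by (simp add: e_def)
    then obtain \<delta> where \<delta>: "\<delta> > 0" "\<delta> < t0" "\<And>t. \<bar>t - t0\<bar> \<le> \<delta> \<Longrightarrow> \<bar>g t - g t0\<bar> \<le> e"
      using close by blast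
    obtain \<phi> c where \<phi>: "c > 0" "has_bochner_integral lborel \<phi> c" "\<And>t. 0 \<le> \<phi> t"
      "\<And>t. t \<notin> {t0..t0 + \<delta>} \<Longrightarrow> \<phi> t = 0" "\<And>n. integrable lborel (\<lambda>t. \<phi> t * m n t)"
      "integrable lborel (\<lambda>t. \<phi> t * g t)"
      "((\<lambda>n. (LINT t|lborel. \<phi> t * m n t) - (LINT t|lborel. \<phi> t * g t)) \<longlongrightarrow> 0) F"
      using bump[of t0 "t0 + \<delta>"] t0 \<delta> by auto
    have lower: "(g t0 - e) * c \<le> (LINT t|lborel. \<phi> t * g t)"
    proof -
      have "(LINT t|lborel. \<phi> t * (g t0 - e)) \<le> (LINT t|lborel. \<phi> t * g t)"
      proof (rule integral_mono)
        fix t show "\<phi> t * (g t0 - e) \<le> \<phi> t * g t"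
        proof (cases "t \<in> {t0..t0 + \<delta>}")
          case True
          then show ?thesis using \<delta>(3)[of t] \<phi>(3)[of t] by (intro mult_left_mono) auto
        qed (simp add: \<phi>(4))
      qed (use \<phi> in \<open>auto simp: has_bochner_integral_iff\<close>)
      then show ?thesis using \<phi>(2) by (simp add: has_bochner_integral_iff mult.commute)
    qed
    have "\<forall>\<^sub>F n in F. (LINT t|lborel. \<phi> t * m n t) - (LINT t|lborel. \<phi> t * g t) > - (e * c)"
      using order_tendstoD(1)[OF \<phi>(7)] \<open>e > 0\<close> \<phi>(1) by simp
    with mono show "\<forall>\<^sub>F n in F. y < m n t0"
    proof eventually_elim
      case (elim n)
      have "(LINT t|lborel. \<phi> t * m n t) \<le> (LINT t|lborel. \<phi> t * m n t0)"
      proof (rule integral_mono)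
        fix t show "\<phi> t * m n t \<le> \<phi> t * m n t0"
        proof (cases "t \<in> {t0..t0 + \<delta>}")
          case True
          then show ?thesis using elim(1) t0 \<phi>(3)[of t] by (intro mult_left_mono) auto
        qed (simp add: \<phi>(4))
      qed (use \<phi> in \<open>auto simp: has_bochner_integral_iff\<close>)
      then have "(g t0 - e) * c - e * c < m n t0 * c"
        using lower elim(2) \<phi>(2) by (simp add: has_bochner_integral_iff mult.commute)
      then have "(g t0 - 2 * e) * c < m n t0 * c" by (simp add: algebra_simps)
      then show ?case using \<phi>(1) by (simp add: e_def field_simps)
    qed
  next
    fix y assume "y > g t0"
    define e where "e = (y - g t0) / 2"
    have "e > 0" using \<open>y > g t0\<close> by (simp add: e_def)
    then obtain \<delta> where \<delta>: "\<delta> > 0" "\<delta> < t0" "\<And>t. \<bar>t - t0\<bar> \<le> \<delta> \<Longrightarrow> \<bar>g t - g t0\<bar> \<le> e"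
      using close by blast
    obtain \<phi> c where \<phi>: "c > 0" "has_bochner_integral lborel \<phi> c" "\<And>t. 0 \<le> \<phi> t"
      "\<And>t. t \<notin> {t0 - \<delta>..t0} \<Longrightarrow> \<phi> t = 0" "\<And>n. integrable lborel (\<lambda>t. \<phi> t * m n t)"
      "integrable lborel (\<lambda>t. \<phi> t * g t)"
      "((\<lambda>n. (LINT t|lborel. \<phi> t * m n t) - (LINT t|lborel. \<phi> t * g t)) \<longlongrightarrow> 0) F"
      using bump[of "t0 - \<delta>" t0] t0 \<delta> by auto
    have upper: "(LINT t|lborel. \<phi> t * g t) \<le> (g t0 + e) * c"
    proof -
      have "(LINT t|lborel. \<phi> t * g t) \<le> (LINT t|lborel. \<phi> t * (g t0 + e))"
      proof (rule integral_mono)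
        fix t show "\<phi> t * g t \<le> \<phi> t * (g t0 + e)"
        proof (cases "t \<in> {t0 - \<delta>..t0}")
          case True
          then show ?thesis using \<delta>(3)[of t] \<phi>(3)[of t] by (intro mult_left_mono) auto
        qed (simp add: \<phi>(4))
      qed (use \<phi> in \<open>auto simp: has_bochner_integral_iff\<close>)
      then show ?thesis using \<phi>(2) by (simp add: has_bochner_integral_iff mult.commute)
    qed
    have "\<forall>\<^sub>F n in F. (LINT t|lborel. \<phi> t * m n t) - (LINT t|lborel. \<phi> t * g t) < e * c"
      using order_tendstoD(2)[OF \<phi>(7)] \<open>e > 0\<close> \<phi>(1) by simp
    with mono show "\<forall>\<^sub>F n in F. m n t0 < y"
    proof eventually_elim
      case (elim n)
      have "(LINT t|lborel. \<phi> t * m n t0) \<le> (LINT t|lborel. \<phi> t * m n t)"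
      proof (rule integral_mono)
        fix t show "\<phi> t * m n t0 \<le> \<phi> t * m n t"
        proof (cases "t \<in> {t0 - \<delta>..t0}")
          case True
          then show ?thesis using elim(1) \<delta> \<phi>(3)[of t] by (intro mult_left_mono) auto
        qed (simp add: \<phi>(4))
      qed (use \<phi> in \<open>auto simp: has_bochner_integral_iff\<close>)
      then have "m n t0 * c < (g t0 + e) * c + e * c"
        using upper elim(2) \<phi>(2) by (simp add: has_bochner_integral_iff mult.commute)
      then have "m n t0 * c < (g t0 + 2 * e) * c" by (simp add: algebra_simps)
      then show ?case using \<phi>(1) by (simp add: e_def field_simps)
    qed
  qed
qed

section \<open>The Mittag-Leffler function\<close>

text \<open>Restrict the Gamma integral to \<open>t \<ge> R\<close>. Since \<open>R\<close> is free, this shows that \<open>Gamma (1 + x)\<close> outgrows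
  every exponential.\<close>

lemma Gamma_lower_bound:
  fixes x R :: real
  assumes "x \<ge> 0" "R > 0"
  shows "R powr x * exp (- R) \<le> Gamma (1 + x)"
proof -
  have R: "has_bochner_integral lborel (\<lambda>t. R powr x * (indicator {R..} t * exp (- 1 * t))) (R powr x * (exp (- 1 * R) / 1))"
    by (intro has_bochner_integral_mult_right has_bochner_integral_exp_atLeast) simp
  have G: "has_bochner_integral lborel (\<lambda>t. indicator {0..} t * (exp (- 1 * t) * t powr (1 + x - 1))) (Gamma (1 + x) / 1 powr (1 + x))"
    using assms by (intro has_bochner_integral_laplace_powr) auto
  have "R powr x * (exp (- 1 * R) / 1) \<le> Gamma (1 + x) / 1 powr (1 + x)"
  unfolding has_bochner_integral_integral_eq[OF R, symmetric] has_bochner_integral_integral_eq[OF G, symmetric]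
  proof (rule integral_mono[OF integrable.intros[OF R] integrable.intros[OF G]])
    fix t :: real
    show "R powr x * (indicator {R..} t * exp (- 1 * t)) \<le> indicator {0..} t * (exp (- 1 * t) * t powr (1 + x - 1))"
      using assms by (auto simp: indicator_def mult.commute intro!: mult_right_mono powr_mono2)
  qed
  then show ?thesis by simp
qed

lemma mittag_leffler_summable:
  fixes \<beta> z :: real
  assumes "\<beta> > 0"
  shows "summable (\<lambda>n. z ^ n / Gamma (1 + \<beta> * real n))"
proof (rule summable_comparison_test')
  \<comment> \<open>With this \<open>R\<close> the terms are dominated by a geometric series of ratio less than \<open>1 / 2\<close>.\<close>
  define R where "R = (2 * \<bar>z\<bar> + 1) powr (1 / \<beta>)"
  have R: "R > 0" "R powr \<beta> = 2 * \<bar>z\<bar> + 1"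
    using assms by (auto simp: R_def powr_powr)
  have "norm (\<bar>z\<bar> / (2 * \<bar>z\<bar> + 1)) < 1" by (simp add: field_simps)
  then show "summable (\<lambda>n. exp R * (\<bar>z\<bar> / (2 * \<bar>z\<bar> + 1)) ^ n)"
    by (intro summable_mult summable_geometric)
  fix n :: nat
  have "R powr (\<beta> * real n) * exp (- R) \<le> Gamma (1 + \<beta> * real n)"
    using assms R by (intro Gamma_lower_bound) auto
  also have "R powr (\<beta> * real n) = (2 * \<bar>z\<bar> + 1) ^ n"
    using R by (simp add: powr_powr[symmetric] powr_realpow)
  finally have G: "(2 * \<bar>z\<bar> + 1) ^ n * exp (- R) \<le> Gamma (1 + \<beta> * real n)" .
  have "0 < (2 * \<bar>z\<bar> + 1) ^ n * exp (- R)" by (simp add: add_nonneg_pos)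
  with G have "0 < Gamma (1 + \<beta> * real n)" by (rule less_le_trans[rotated])
  with G have "norm (z ^ n / Gamma (1 + \<beta> * real n)) \<le> \<bar>z\<bar> ^ n / ((2 * \<bar>z\<bar> + 1) ^ n * exp (- R))"
    by (auto simp: norm_divide power_abs intro!: divide_left_mono mult_pos_pos)
  also have "\<dots> = exp R * (\<bar>z\<bar> / (2 * \<bar>z\<bar> + 1)) ^ n"
    by (simp add: exp_minus field_simps power_divide)
  finally show "norm (z ^ n / Gamma (1 + \<beta> * real n)) \<le> exp R * (\<bar>z\<bar> / (2 * \<bar>z\<bar> + 1)) ^ n" .
qed

lemma mittag_leffler_0 [simp]: "mittag_leffler \<beta> 0 = 1"
proof -
  have "(\<lambda>n. (0::real) ^ n / Gamma (1 + \<beta> * real n)) sums (0 ^ 0 / Gamma (1 + \<beta> * real 0))"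
    using sums_finite[of "{0::nat}" "\<lambda>n. 0 ^ n / Gamma (1 + \<beta> * real n)"] by simp
  then show ?thesis by (simp add: mittag_leffler_def sums_iff)
qed

lemma isCont_mittag_leffler:
  assumes "\<beta> > 0"
  shows "isCont (mittag_leffler \<beta>) z"
proof -
  have "isCont (\<lambda>z. \<Sum>n. (1 / Gamma (1 + \<beta> * real n)) * z ^ n) z"
    by (rule isCont_powser_converges_everywhere) (use mittag_leffler_summable[OF assms] in simp)
  then show ?thesis unfolding mittag_leffler_def[abs_def] by simp
qed

lemma continuous_on_mittag_leffler [continuous_intros]:
  assumes "\<beta> > 0" "continuous_on S f"
  shows "continuous_on S (\<lambda>x. mittag_leffler \<beta> (f x))"
  using continuous_on_compose2[OF continuous_at_imp_continuous_on assms(2), of UNIV "mittag_leffler \<beta>"]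
    isCont_mittag_leffler[OF assms(1)] by blast

text \<open>Termwise integration produces the geometric series in \<open>- lam / s powr \<beta>\<close>. Its convergence is where
  the restriction to large \<open>s\<close> comes from.\<close>

lemma has_bochner_integral_laplace_mittag_leffler:
  fixes \<beta> lam s :: real
  assumes \<beta>: "\<beta> > 0" and lam: "lam \<ge> 0" and s: "s > 0" "lam < s powr \<beta>"
  shows "has_bochner_integral lborel (\<lambda>t. indicator {0..} t *\<^sub>R (exp (- s * t) * mittag_leffler \<beta> (- lam * t powr \<beta>)))
    (s powr (\<beta> - 1) / (lam + s powr \<beta>))"
proof -
  let ?G = "\<lambda>n. Gamma (1 + \<beta> * real n)"
  let ?f = "\<lambda>(c::real) n t. indicator {0..} t * (exp (- s * t) * ((c * t powr \<beta>) ^ n / ?G n))"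
  have G: "?G n > 0" for n using \<beta> by (intro Gamma_real_pos) (simp add: add_pos_nonneg)
  have powr_term: "has_bochner_integral lborel (?f c n) ((1 / s) * (c / s powr \<beta>) ^ n)" for c n
  proof -
    have "has_bochner_integral lborel
        (\<lambda>t. c ^ n / ?G n * (indicator {0..} t * (exp (- s * t) * t powr (1 + \<beta> * real n - 1))))
        (c ^ n / ?G n * (?G n / s powr (1 + \<beta> * real n)))"
      using \<beta> s by (intro has_bochner_integral_mult_right has_bochner_integral_laplace_powr)
        (simp_all add: add_pos_nonneg)
    also have "c ^ n / ?G n * (?G n / s powr (1 + \<beta> * real n)) = (1 / s) * (c / s powr \<beta>) ^ n"
      using s G[of n] by (simp add: powr_add powr_powr[symmetric] powr_realpow power_divide)
    finally show ?thesis
    proof (rule has_bochner_integralI_AE)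
      show "AE t in lborel. c ^ n / ?G n * (indicator {0..} t * (exp (- s * t) * t powr (1 + \<beta> * real n - 1))) = ?f c n t"
        using AE_lborel_singleton[of 0]
        by eventually_elim (auto simp: indicator_def powr_powr[symmetric] powr_realpow power_mult_distrib)
    qed measurable
  qed
  have int: "integrable lborel (?f c n)" and val: "(LINT t|lborel. ?f c n t) = (1 / s) * (c / s powr \<beta>) ^ n" for c n
    using powr_term[of c n] by (auto simp: has_bochner_integral_iff)
  have norm_eq: "norm (?f (- lam) n t) = ?f lam n t" for n t
    using lam G[of n] by (auto simp: indicator_def abs_mult power_abs)
  have sums_t: "(\<lambda>n. ?f c n t) sums (indicator {0..} t *\<^sub>R (exp (- s * t) * mittag_leffler \<beta> (c * t powr \<beta>)))" for c t
    unfolding mittag_leffler_def real_scaleR_def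
    by (intro sums_mult summable_sums mittag_leffler_summable \<beta>)
  have abs_summable: "AE t in lborel. summable (\<lambda>n. norm (?f (- lam) n t))"
    unfolding norm_eq using sums_summable[OF sums_t] by blast
  have r: "lam / s powr \<beta> < 1" using s by simp
  have norm_summable: "summable (\<lambda>n. LINT t|lborel. norm (?f (- lam) n t))"
    unfolding norm_eq val using r lam by (intro summable_mult summable_geometric) simp
  have suminf_eq: "(\<Sum>n. ?f (- lam) n t) = indicator {0..} t *\<^sub>R (exp (- s * t) * mittag_leffler \<beta> (- lam * t powr \<beta>))" for t
    by (rule sums_unique[OF sums_t, symmetric])
  have "integrable lborel (\<lambda>t. \<Sum>n. ?f (- lam) n t)"
    by (rule integrable_suminf[OF int abs_summable norm_summable])
  moreover have "(LINT t|lborel. (\<Sum>n. ?f (- lam) n t)) = (\<Sum>n. (1 / s) * (- lam / s powr \<beta>) ^ n)"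
    unfolding val[symmetric] by (rule integral_suminf[OF int abs_summable norm_summable])
  moreover have "(\<Sum>n. (1 / s) * (- lam / s powr \<beta>) ^ n) = s powr (\<beta> - 1) / (lam + s powr \<beta>)"
  proof -
    have "(\<lambda>n. (1 / s) * (- lam / s powr \<beta>) ^ n) sums ((1 / s) * (1 / (1 - - lam / s powr \<beta>)))"
      using r lam by (intro sums_mult geometric_sums) (simp add: norm_divide)
    also have "(1 / s) * (1 / (1 - - lam / s powr \<beta>)) = s powr (\<beta> - 1) / (lam + s powr \<beta>)"
      using s by (simp add: powr_diff field_simps)
    finally show ?thesis by (rule sums_unique[symmetric])
  qed
  ultimately show ?thesis
    unfolding suminf_eq by (simp add: has_bochner_integral_iff)
qed

section \<open>An Abelian theorem for regularly varying tails\<close>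

lemma regular_tail_ratio:
  fixes G :: "real \<Rightarrow> real"
  assumes "G \<sim>[at_top] (\<lambda>y. C * y powr (- a))" "C > 0"
  shows "((\<lambda>y. G y / (C * y powr (- a))) \<longlongrightarrow> 1) at_top"
proof (rule asymp_equivD_strong[OF assms(1)])
  show "\<forall>\<^sub>F y in at_top. G y \<noteq> 0 \<or> C * y powr (- a) \<noteq> 0"
    using eventually_gt_at_top[of 0] by eventually_elim (use assms(2) in simp)
qed

text \<open>A bound on the whole half line, needed as a dominating function: below the range of validity of the
  asymptotics a probability is at most 1 and \<open>y powr (- a)\<close> is bounded away from 0.\<close>

lemma regular_tail_bound:
  assumes "real_distribution P" and a: "a > 0"
    and tail: "(\<lambda>y. measure P {y<..}) \<sim>[at_top] (\<lambda>y. C * y powr (- a))" and C: "C > 0"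
  obtains K where "K > 0" "\<And>y. y > 0 \<Longrightarrow> measure P {y<..} \<le> K * y powr (- a)"
proof -
  interpret real_distribution P by fact
  have "((\<lambda>y. measure P {y<..} / (C * y powr (- a))) \<longlongrightarrow> 1) at_top"
    using tail C by (rule regular_tail_ratio)
  then have "\<forall>\<^sub>F y in at_top. measure P {y<..} / (C * y powr (- a)) < 2"
    by (rule order_tendstoD) simp
  then obtain y0 where y0: "\<And>y. y \<ge> y0 \<Longrightarrow> measure P {y<..} / (C * y powr (- a)) < 2"
    by (auto simp: eventually_at_top_linorder)
  define y1 where "y1 = max y0 1"
  have y1: "y1 \<ge> 1" "y1 \<ge> y0" by (auto simp: y1_def)
  let ?K = "max (2 * C) (y1 powr a)"
  show ?thesis
  proof (rule that[of ?K])
    show "?K > 0" using C by simp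
    fix y :: real assume y: "y > 0"
    show "measure P {y<..} \<le> ?K * y powr (- a)"
    proof (cases "y \<ge> y1")
      case True
      then have "measure P {y<..} \<le> 2 * C * y powr (- a)"
        using y0[of y] y1 C y by (simp add: field_simps)
      also have "\<dots> \<le> ?K * y powr (- a)" by (intro mult_right_mono) auto
      finally show ?thesis .
    next
      case False
      have "measure P {y<..} \<le> 1" by simp
      also have "1 \<le> (y1 / y) powr a" using False y a by (intro ge_one_powr_ge_zero) auto
      also have "\<dots> = y1 powr a * y powr (- a)" using y y1 by (simp add: powr_divide powr_minus_divide)
      also have "\<dots> \<le> ?K * y powr (- a)" by (intro mult_right_mono) auto
      finally show ?thesis .
    qed
  qed
qed

text \<open>By Fubini the integral of \<open>f (\<kappa> x)\<close> is that of \<open>\<phi> u\<close> against the tail at \<open>u / \<kappa>\<close>, that is, an integration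
  by parts. Divided by \<open>\<kappa> powr a\<close>, the tail converges to \<open>C * u powr (- a)\<close> and is dominated by a multiple
  of it. The formula for \<open>f\<close> makes it vanish on the negative half line.\<close>

lemma abelian_regular_tail:
  fixes \<phi> :: "real \<Rightarrow> real"
  assumes P: "real_distribution P" and a: "a > 0"
    and tail: "(\<lambda>y. measure P {y<..}) \<sim>[at_top] (\<lambda>y. C * y powr (- a))" and C: "C > 0"
    and \<phi>_int: "integrable lborel (\<lambda>u. indicator {0<..} u * (\<phi> u * u powr (- a)))"
    and \<phi>_meas [measurable]: "\<phi> \<in> borel_measurable borel"
    and f: "\<And>z. f z = (LINT u|lborel. indicator {0<..<z} u * \<phi> u)"
  shows "((\<lambda>\<kappa>. (LINT x|P. f (\<kappa> * x)) / \<kappa> powr a) \<longlongrightarrow>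
    C * (LINT u|lborel. indicator {0<..} u * (\<phi> u * u powr (- a)))) (at_right 0)"
proof -
  interpret real_distribution P by fact
  interpret pair_sigma_finite lborel P ..
  define G where "G = (\<lambda>y. measure P {y<..})"
  have G_anti: "G y' \<le> G y" if "y \<le> y'" for y y'
    unfolding G_def using that by (intro finite_measure_mono) auto
  have G_meas [measurable]: "G \<in> borel_measurable borel"
  proof -
    have "(\<lambda>y. - G y) \<in> borel_measurable borel"
      by (rule borel_measurable_mono) (simp add: mono_def G_anti)
    then show ?thesis by simp
  qed
  have G_nonneg: "0 \<le> G y" for y by (simp add: G_def)
  obtain K where K: "K > 0" "\<And>y. y > 0 \<Longrightarrow> G y \<le> K * y powr (- a)"
    using regular_tail_bound[OF P a tail C] unfolding G_def by blast
  have scaled_bound: "R powr a * G (R * u) \<le> K * u powr (- a)" if "R > 0" "u > 0" for R u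
  proof -
    have "R powr a * G (R * u) \<le> R powr a * (K * (R * u) powr (- a))"
      using K(2)[of "R * u"] that by (intro mult_left_mono) auto
    also have "\<dots> = K * u powr (- a)"
      using that by (simp add: powr_mult powr_minus)
    finally show ?thesis .
  qed
  have fubini: "(LINT x|P. f (x / R)) = (LINT u|lborel. indicator {0<..} u * (\<phi> u * G (R * u)))"
    if R: "R > 0" for R
  proof -
    let ?k = "\<lambda>(u, x). indicator {0<..<x / R} u * \<phi> u"
    have k_eq: "?k (u, x) = indicator {0<..} u * \<phi> u * indicator {R * u<..} x" for u x
      using R by (auto simp: indicator_def field_simps)
    have inner: "(LINT x|P. ?k (u, x)) = indicator {0<..} u * (\<phi> u * G (R * u))" for u
      unfolding k_eq by (simp add: G_def)
    have inner_norm: "(LINT x|P. norm (?k (u, x))) = indicator {0<..} u * (\<bar>\<phi> u\<bar> * G (R * u))" for u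
      unfolding k_eq by (simp add: G_def abs_mult)
    have meas: "?k \<in> borel_measurable (lborel \<Otimes>\<^sub>M P)"
    proof -
      have "(\<lambda>(u, x). indicator {0<..} u * \<phi> u * (if x > R * u then 1 else 0 :: real)) \<in> borel_measurable (lborel \<Otimes>\<^sub>M P)"
        by measurable
      also have "(\<lambda>(u, x). indicator {0<..} u * \<phi> u * (if x > R * u then 1 else 0 :: real)) = ?k"
        using R by (auto simp: fun_eq_iff indicator_def field_simps)
      finally show ?thesis .
    qed
    have int: "integrable (lborel \<Otimes>\<^sub>M P) ?k"
    proof (rule Fubini_integrable[OF meas])
      show "integrable lborel (\<lambda>u. LINT x|P. norm (?k (u, x)))"
        unfolding inner_norm
      proof (rule Bochner_Integration.integrable_bound)
        show "integrable lborel (\<lambda>u. K / R powr a * (indicator {0<..} u * (\<phi> u * u powr (- a))))"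
          by (intro integrable_mult_right \<phi>_int)
        show "AE u in lborel. norm (indicator {0<..} u * (\<bar>\<phi> u\<bar> * G (R * u)))
            \<le> norm (K / R powr a * (indicator {0<..} u * (\<phi> u * u powr (- a))))"
        proof (rule AE_I2)
          fix u
          show "norm (indicator {0<..} u * (\<bar>\<phi> u\<bar> * G (R * u)))
            \<le> norm (K / R powr a * (indicator {0<..} u * (\<phi> u * u powr (- a))))"
          proof (cases "u > 0")
            case True
            then have "G (R * u) \<le> K / R powr a * u powr (- a)"
              using scaled_bound[OF R True] R by (simp add: field_simps)
            then have "\<bar>\<phi> u\<bar> * G (R * u) \<le> \<bar>\<phi> u\<bar> * (K / R powr a * u powr (- a))"
              by (intro mult_left_mono) auto
            then show ?thesis
              using True K(1) R G_nonneg[of "R * u"] by (simp add: abs_mult mult_ac)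
          qed simp
        qed
      qed measurable
      show "AE u in lborel. integrable P (\<lambda>x. ?k (u, x))"
        unfolding k_eq by (intro AE_I2 integrable_mult_right integrable_const_bound[where B=1]) (auto simp: indicator_def)
    qed
    have "(LINT x|P. f (x / R)) = (LINT x|P. LINT u|lborel. ?k (u, x))"
      by (simp add: f)
    also have "\<dots> = (LINT u|lborel. LINT x|P. ?k (u, x))"
      using Fubini_integral[of "\<lambda>u x. ?k (u, x)"] int by simp
    finally show ?thesis unfolding inner .
  qed
  have pointwise: "((\<lambda>R. R powr a * G (R * u)) \<longlongrightarrow> C * u powr (- a)) at_top" if "u > 0" for u
  proof -
    have "((\<lambda>y. G y / (C * y powr (- a))) \<longlongrightarrow> 1) at_top"
      unfolding G_def using tail C by (rule regular_tail_ratio)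
    moreover have "filterlim (\<lambda>R. R * u) at_top at_top"
      using that by (intro filterlim_at_top_mult_tendsto_pos[OF tendsto_const]) (auto simp: filterlim_ident)
    ultimately have "((\<lambda>R. G (R * u) / (C * (R * u) powr (- a))) \<longlongrightarrow> 1) at_top"
      by (rule filterlim_compose)
    then have "((\<lambda>R. C * u powr (- a) * (G (R * u) / (C * (R * u) powr (- a)))) \<longlongrightarrow> C * u powr (- a) * 1) at_top"
      by (intro tendsto_mult tendsto_const)
    moreover have "\<forall>\<^sub>F R in at_top. C * u powr (- a) * (G (R * u) / (C * (R * u) powr (- a))) = R powr a * G (R * u)"
      using eventually_gt_at_top[of 0]
      by eventually_elim (use that C in \<open>simp add: powr_mult powr_minus field_simps\<close>)
    ultimately show ?thesis
      by (simp add: tendsto_cong)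
  qed
  have "((\<lambda>R. LINT u|lborel. indicator {0<..} u * (\<phi> u * (R powr a * G (R * u)))) \<longlongrightarrow>
      (LINT u|lborel. indicator {0<..} u * (\<phi> u * (C * u powr (- a))))) at_top"
  proof (rule integral_dominated_convergence_at_top)
    show "integrable lborel (\<lambda>u. K * \<bar>indicator {0<..} u * (\<phi> u * u powr (- a))\<bar>)"
      by (intro integrable_mult_right integrable_abs \<phi>_int)
    show "AE u in lborel. ((\<lambda>R. indicator {0<..} u * (\<phi> u * (R powr a * G (R * u))))
        \<longlongrightarrow> indicator {0<..} u * (\<phi> u * (C * u powr (- a)))) at_top"
    proof (rule AE_I2)
      fix u :: real
      show "((\<lambda>R. indicator {0<..} u * (\<phi> u * (R powr a * G (R * u))))
        \<longlongrightarrow> indicator {0<..} u * (\<phi> u * (C * u powr (- a)))) at_top"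
        by (cases "u > 0") (auto intro!: tendsto_mult tendsto_const pointwise)
    qed
    show "\<forall>\<^sub>F R in at_top. AE u in lborel. norm (indicator {0<..} u * (\<phi> u * (R powr a * G (R * u))))
        \<le> K * \<bar>indicator {0<..} u * (\<phi> u * u powr (- a))\<bar>"
      using eventually_gt_at_top[of 0]
    proof eventually_elim
      case (elim R)
      show ?case
      proof (rule AE_I2)
        fix u :: real
        show "norm (indicator {0<..} u * (\<phi> u * (R powr a * G (R * u))))
          \<le> K * \<bar>indicator {0<..} u * (\<phi> u * u powr (- a))\<bar>"
        proof (cases "u > 0")
          case True
          have "\<bar>\<phi> u\<bar> * (R powr a * G (R * u)) \<le> \<bar>\<phi> u\<bar> * (K * u powr (- a))"
            using scaled_bound[OF elim True] by (intro mult_left_mono) auto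
          then show ?thesis using True G_nonneg[of "R * u"] by (simp add: abs_mult mult_ac)
        qed simp
      qed
    qed
  qed measurable
  also have "(LINT u|lborel. indicator {0<..} u * (\<phi> u * (C * u powr (- a)))) =
      C * (LINT u|lborel. indicator {0<..} u * (\<phi> u * u powr (- a)))"
    by (simp add: mult_ac flip: integral_mult_right_zero)
  finally have "((\<lambda>R. R powr a * (LINT x|P. f (x / R))) \<longlongrightarrow>
      C * (LINT u|lborel. indicator {0<..} u * (\<phi> u * u powr (- a)))) at_top"
  proof (rule Lim_transform_eventually)
    show "\<forall>\<^sub>F R in at_top. (LINT u|lborel. indicator {0<..} u * (\<phi> u * (R powr a * G (R * u)))) = R powr a * (LINT x|P. f (x / R))"
      using eventually_gt_at_top[of 0]
      by eventually_elim (simp add: fubini mult_ac flip: integral_mult_right_zero)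
  qed
  then show ?thesis
    unfolding filterlim_at_right_to_top
    by (rule Lim_transform_eventually)
      (use eventually_gt_at_top[of 0] in \<open>eventually_elim, simp add: powr_minus divide_inverse inverse_powr mult.commute\<close>)
qed

section \<open>The sine integral over full periods\<close>

lemma Gamma_reflection_real:
  fixes x :: real
  shows "Gamma x * Gamma (1 - x) = pi / sin (pi * x)"
proof -
  have "complex_of_real (Gamma x * Gamma (1 - x)) = Gamma (of_real x) * Gamma (1 - of_real x)"
    by (metis Gamma_complex_of_real of_real_1 of_real_diff of_real_mult)
  also have "\<dots> = of_real pi / sin (of_real pi * of_real x)"
    by (rule Gamma_reflection_complex)
  also have "\<dots> = of_real (pi / sin (pi * x))"
    by (metis of_real_divide of_real_mult sin_of_real)
  finally have "complex_of_real (Gamma x * Gamma (1 - x)) = of_real (pi / sin (pi * x))" .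
  then show ?thesis by (simp only: of_real_eq_iff)
qed

text \<open>Write \<open>1 / (1 + w)\<close> as the integral of \<open>exp (- (1 + w) z)\<close> over \<open>z\<close>. Exchanging the integrals yields
  \<open>Gamma p * Gamma (1 - p)\<close>.\<close>

lemma has_bochner_integral_powr_div_1_plus:
  fixes p :: real
  assumes p: "0 < p" "p < 1"
  shows "has_bochner_integral lborel (\<lambda>w. indicator {0..} w * (w powr (p - 1) / (1 + w))) (pi / sin (pi * p))"
proof -
  let ?k = "\<lambda>(w, z). indicator {0..} w * indicator {0..} z * (w powr (p - 1) * exp (- ((1 + w) * z))) :: real"
  have G: "Gamma p > 0" "Gamma (1 - p) > 0" using p by (auto intro: Gamma_real_pos)
  have inner_z: "has_bochner_integral lborel (\<lambda>z. ?k (w, z)) (indicator {0..} w * (w powr (p - 1) / (1 + w)))" for w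
  proof (cases "w \<ge> 0")
    case True
    have "has_bochner_integral lborel (\<lambda>z. indicator {0..} w * w powr (p - 1) * (indicator {0..} z * exp (- (1 + w) * z)))
        (indicator {0..} w * w powr (p - 1) * (exp (- (1 + w) * 0) / (1 + w)))"
      using True by (intro has_bochner_integral_mult_right has_bochner_integral_exp_atLeast) simp
    moreover have "indicator {0..} w * w powr (p - 1) * (indicator {0..} z * exp (- (1 + w) * z)) = ?k (w, z)" for z
      by (simp add: indicator_def algebra_simps)
    ultimately show ?thesis by (simp only: mult_zero_right exp_zero mult.right_neutral times_divide_eq_right minus_zero)
  qed (simp add: has_bochner_integral_zero)
  have inner_w: "has_bochner_integral lborel (\<lambda>w. ?k (w, z)) (indicator {0..} z * exp (- z) * (Gamma p / z powr p))" if "z \<noteq> 0" for z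
  proof (cases "z > 0")
    case True
    have "has_bochner_integral lborel (\<lambda>w. indicator {0..} z * exp (- z) * (indicator {0..} w * (exp (- z * w) * w powr (p - 1))))
        (indicator {0..} z * exp (- z) * (Gamma p / z powr p))"
      using True p by (intro has_bochner_integral_mult_right has_bochner_integral_laplace_powr) auto
    moreover have "indicator {0..} z * exp (- z) * (indicator {0..} w * (exp (- z * w) * w powr (p - 1))) = ?k (w, z)" for w
      by (auto simp: indicator_def exp_add[symmetric] algebra_simps)
    ultimately show ?thesis by (simp only:)
  qed (use that in \<open>simp add: has_bochner_integral_zero\<close>)
  have outer_z: "has_bochner_integral lborel (\<lambda>z. indicator {0..} z * exp (- z) * (Gamma p / z powr p)) (Gamma p * Gamma (1 - p))"
  proof -
    have "has_bochner_integral lborel (\<lambda>z. Gamma p * (indicator {0..} z * (exp (- 1 * z) * z powr ((1 - p) - 1))))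
        (Gamma p * (Gamma (1 - p) / 1 powr (1 - p)))"
      using p by (intro has_bochner_integral_mult_right has_bochner_integral_laplace_powr) auto
    then show ?thesis by (simp add: powr_minus divide_inverse mult_ac)
  qed
  have nonneg: "?k x \<ge> 0" for x by (cases x) (simp add: indicator_def)
  have [measurable]: "?k \<in> borel_measurable (lborel \<Otimes>\<^sub>M lborel)"
    by measurable
  have "(\<integral>\<^sup>+w. ennreal (indicator {0..} w * (w powr (p - 1) / (1 + w))) \<partial>lborel) = (\<integral>\<^sup>+w. \<integral>\<^sup>+z. ?k (w, z) \<partial>lborel \<partial>lborel)"
  proof (rule nn_integral_cong)
    fix w :: real
    show "ennreal (indicator {0..} w * (w powr (p - 1) / (1 + w))) = (\<integral>\<^sup>+z. ?k (w, z) \<partial>lborel)"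
      using inner_z[of w] nonneg by (subst nn_integral_eq_integral) (auto simp: has_bochner_integral_iff)
  qed
  also have "\<dots> = (\<integral>\<^sup>+z. \<integral>\<^sup>+w. ?k (w, z) \<partial>lborel \<partial>lborel)"
    using lborel_pair.Fubini'[of "\<lambda>w z. ennreal (?k (w, z))"] by simp
  also have "\<dots> = (\<integral>\<^sup>+z. ennreal (indicator {0..} z * exp (- z) * (Gamma p / z powr p)) \<partial>lborel)"
  proof (rule nn_integral_cong_AE)
    show "AE z in lborel. (\<integral>\<^sup>+w. ?k (w, z) \<partial>lborel) = ennreal (indicator {0..} z * exp (- z) * (Gamma p / z powr p))"
      using AE_lborel_singleton[of 0]
    proof eventually_elim
      case (elim z)
      then show ?case
        using inner_w[of z] nonneg by (subst nn_integral_eq_integral) (auto simp: has_bochner_integral_iff)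
    qed
  qed
  also have "\<dots> = ennreal (Gamma p * Gamma (1 - p))"
    using outer_z G by (subst nn_integral_eq_integral) (auto simp: has_bochner_integral_iff)
  also have "Gamma p * Gamma (1 - p) = pi / sin (pi * p)"
    using Gamma_reflection_real[of p] by simp
  finally show ?thesis
    using G Gamma_reflection_real[of p] p
    by (intro has_bochner_integral_nn_integral) (auto simp: indicator_def intro!: AE_I2 divide_nonneg_nonneg less_imp_le[OF divide_pos_pos] sin_gt_zero)
qed

text \<open>Substitute \<open>v = sqrt w\<close> in the previous integral, with \<open>p = a / 2\<close>.\<close>

lemma has_bochner_integral_powr_div_1_plus_square:
  fixes a :: real
  assumes a: "0 < a" "a < 2"
  shows "has_bochner_integral lborel (\<lambda>v. indicator {0..} v * (v powr (a - 1) / (1 + v\<^sup>2))) (pi / (2 * sin (a * pi / 2)))"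
proof -
  let ?f = "\<lambda>v::real. v powr (a - 1) / (1 + v\<^sup>2)"
  let ?g' = "\<lambda>w::real. inverse (sqrt w) / 2"
  have B: "has_bochner_integral lborel (\<lambda>w. indicator {0..} w * (w powr (a / 2 - 1) / (1 + w))) (pi / sin (pi * (a / 2)))"
    using a by (intro has_bochner_integral_powr_div_1_plus) auto
  have eq: "?f (sqrt w) * ?g' w = (1 / 2) * (w powr (a / 2 - 1) / (1 + w))" if "w > 0" for w
  proof -
    have "sqrt w powr (a - 1) * inverse (sqrt w) = sqrt w powr (a - 1) * sqrt w powr (- 1)"
      using that by (simp add: powr_minus)
    also have "\<dots> = w powr (a / 2 - 1)"
    proof -
      have "sqrt w powr (a - 1) * sqrt w powr (- 1) = sqrt w powr (a - 2)"
        by (simp only: powr_add[symmetric]) simp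
      also have "\<dots> = w powr (1 / 2 * (a - 2))"
        using that by (simp add: powr_half_sqrt[symmetric] powr_powr)
      finally show ?thesis by (simp add: field_simps)
    qed
    finally show ?thesis using that by (simp add: field_simps)
  qed
  have C: "has_bochner_integral lborel (\<lambda>w. indicator {0<..} w * (?f (sqrt w) * ?g' w)) (1 / 2 * (pi / sin (pi * (a / 2))))"
  proof (rule has_bochner_integralI_AE[OF has_bochner_integral_mult_right[OF B, of "1 / 2"]])
    show "AE w in lborel. 1 / 2 * (indicator {0..} w * (w powr (a / 2 - 1) / (1 + w))) = indicator {0<..} w * (?f (sqrt w) * ?g' w)"
      using AE_lborel_singleton[of 0] by eventually_elim (use eq in \<open>auto simp: indicator_def\<close>)
  qed measurable
  have subst: "set_integrable lborel (einterval 0 \<infinity>) ?f" 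
    "(LBINT x=0..\<infinity>. ?f x) = (LBINT x=0..\<infinity>. ?f (sqrt x) * ?g' x)"
  proof -
    have *: "0 < (0::ereal) \<Longrightarrow> False" by simp
    have A: "((ereal \<circ> sqrt \<circ> real_of_ereal) \<longlongrightarrow> 0) (at_right 0)"
      unfolding zero_ereal_def ereal_tendsto_simps
      using tendsto_real_sqrt[OF tendsto_ident_at, of 0 "{0<..}"] by (simp add: comp_def)
    have Bt: "((ereal \<circ> sqrt \<circ> real_of_ereal) \<longlongrightarrow> \<infinity>) (at_left \<infinity>)"
      unfolding ereal_tendsto_simps using sqrt_at_top by (simp add: comp_def)
    have int: "set_integrable lborel (einterval 0 \<infinity>) (\<lambda>x. ?f (sqrt x) * ?g' x)"
      using C by (simp add: set_integrable_def has_bochner_integral_iff zero_ereal_def)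
    have D: "DERIV sqrt x :> ?g' x" "isCont ?f (sqrt x)" "isCont ?g' x" "0 \<le> ?f (sqrt x)"
      if "0 < ereal x" for x
      using that by (auto intro!: DERIV_real_sqrt continuous_intros simp: add_nonneg_eq_0_iff)
    have D': "0 \<le> ?g' x" if "0 \<le> ereal x" for x
      using that by auto
    note S = interval_integral_substitution_nonneg[of 0 \<infinity> sqrt ?g' ?f, OF _ D(1) D(2) D(3) D(4) D' A Bt int]
    show "set_integrable lborel (einterval 0 \<infinity>) ?f" by (rule S(1)) auto
    show "(LBINT x=0..\<infinity>. ?f x) = (LBINT x=0..\<infinity>. ?f (sqrt x) * ?g' x)" by (rule S(2)) auto
  qed
  have "has_bochner_integral lborel (\<lambda>v. indicator {0<..} v * ?f v) (1 / 2 * (pi / sin (pi * (a / 2))))"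
    using subst C
    by (simp add: set_integrable_def has_bochner_integral_iff zero_ereal_def interval_lebesgue_integral_def set_lebesgue_integral_def)
  then have "has_bochner_integral lborel (\<lambda>v. indicator {0..} v * ?f v) (1 / 2 * (pi / sin (pi * (a / 2))))"
  proof (rule has_bochner_integralI_AE)
    show "AE v in lborel. indicator {0<..} v * ?f v = indicator {0..} v * ?f v"
      using AE_lborel_singleton[of 0] by eventually_elim (auto simp: indicator_def)
  qed measurable
  then show ?thesis by (simp add: mult_ac)
qed

text \<open>At these cut-off points the sine vanishes and the cosine equals 1, so no boundary terms arise below.\<close>

definition full_periods :: "nat \<Rightarrow> real" where
  "full_periods N = 2 * pi * real N"

lemma sin_cos_full_periods [simp]: "sin (full_periods N) = 0" "cos (full_periods N) = 1"
  using sin_int_2pin[of "int N"] cos_int_2pin[of "int N"] by (simp_all add: full_periods_def mult_ac)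

lemma full_periods_nonneg [simp]: "0 \<le> full_periods N"
  by (simp add: full_periods_def)

lemma integral_sin_exp_full_periods:
  "has_bochner_integral lborel (\<lambda>u. indicator {0..full_periods N} u * (sin u * exp (- v * u)))
    ((1 - exp (- v * full_periods N)) / (1 + v\<^sup>2))"
proof -
  let ?F = "\<lambda>u. - exp (- v * u) * (v * sin u + cos u) / (1 + v\<^sup>2)"
  have nz: "1 + v\<^sup>2 \<noteq> 0" by (simp add: add_nonneg_eq_0_iff)
  have "has_bochner_integral lborel (\<lambda>u. indicator {0..full_periods N} u *\<^sub>R (sin u * exp (- v * u)))
      (?F (full_periods N) - ?F 0)"
  proof (rule has_bochner_integral_FTC_Icc)
    fix u
    show "(?F has_vector_derivative sin u * exp (- v * u)) (at u within {0..full_periods N})"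
      unfolding has_real_derivative_iff_has_vector_derivative[symmetric]
      by (rule has_field_derivative_at_within, (rule derivative_eq_intros refl | simp add: nz)+)
        (use nz in \<open>simp add: field_simps power2_eq_square\<close>)
  qed (auto intro!: continuous_intros)
  then show ?thesis by (simp add: field_simps diff_divide_distrib)
qed

lemma integrable_sin_powr:
  fixes a A :: real
  assumes a: "0 < a" "a < 2"
  shows "integrable lborel (\<lambda>u. indicator {0..A} u * (\<bar>sin u\<bar> * u powr (- a)))"
proof (rule Bochner_Integration.integrable_bound)
  show "integrable lborel (\<lambda>u. exp A * (indicator {0..} u * (exp (- 1 * u) * u powr ((2 - a) - 1))))"
    using has_bochner_integral_laplace_powr[of "2 - a" 1] a
    by (intro integrable_mult_right) (simp add: has_bochner_integral_iff)
  show "AE u in lborel. norm (indicator {0..A} u * (\<bar>sin u\<bar> * u powr (- a)))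
      \<le> norm (exp A * (indicator {0..} u * (exp (- 1 * u) * u powr ((2 - a) - 1))))"
  proof (rule AE_I2)
    fix u :: real
    show "norm (indicator {0..A} u * (\<bar>sin u\<bar> * u powr (- a)))
      \<le> norm (exp A * (indicator {0..} u * (exp (- 1 * u) * u powr ((2 - a) - 1))))"
    proof (cases "0 < u \<and> u \<le> A")
      case True
      have "\<bar>sin u\<bar> * u powr (- a) \<le> u * u powr (- a)"
        using True abs_sin_x_le_abs_x[of u] by (intro mult_right_mono) auto
      also have "\<dots> = u powr (1 - a)" using True by (simp add: powr_mult_base)
      also have "\<dots> \<le> exp (A - u) * u powr (1 - a)"
        using True mult_right_mono[of 1 "exp (A - u)" "u powr (1 - a)"] by simp
      also have "\<dots> = exp A * (exp (- u) * u powr (1 - a))" by (simp add: exp_diff exp_minus divide_inverse)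
      finally show ?thesis using True by simp
    qed (auto simp: indicator_def)
  qed
qed measurable

text \<open>Express \<open>u powr (- a)\<close> as a Laplace transform and integrate first over \<open>u\<close>; cutting off at a finite
  point makes the double integral absolutely convergent.\<close>

lemma sine_integral_full_periods:
  fixes a :: real
  assumes a: "0 < a" "a < 2"
  shows "(LINT u|lborel. indicator {0..full_periods N} u * (sin u * u powr (- a))) =
    (1 / Gamma a) * (LINT v|lborel. indicator {0..} v * (v powr (a - 1) / (1 + v\<^sup>2) * (1 - exp (- v * full_periods N))))"
proof -
  let ?A = "full_periods N"
  let ?k = "\<lambda>(u, v). indicator {0..?A} u * indicator {0..} v * (sin u * (exp (- (u * v)) * v powr (a - 1))) :: real"
  have G: "Gamma a > 0" using a by (intro Gamma_real_pos)
  have inner_v: "has_bochner_integral lborel (\<lambda>v. ?k (u, v)) (Gamma a * (indicator {0..?A} u * (sin u * u powr (- a))))"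
    and inner_norm: "has_bochner_integral lborel (\<lambda>v. norm (?k (u, v))) (Gamma a * (indicator {0..?A} u * (\<bar>sin u\<bar> * u powr (- a))))" for u
  proof -
    have *: "has_bochner_integral lborel (\<lambda>v. c * (indicator {0..} v * (exp (- u * v) * v powr (a - 1)))) (c * (Gamma a / u powr a))"
      if "u > 0" for c
      using that a by (intro has_bochner_integral_mult_right has_bochner_integral_laplace_powr) auto
    show "has_bochner_integral lborel (\<lambda>v. ?k (u, v)) (Gamma a * (indicator {0..?A} u * (sin u * u powr (- a))))"
      using *[of "indicator {0..?A} u * sin u"]
      by (cases "u > 0"; cases "u = 0") (auto simp: powr_minus divide_inverse mult_ac)
    show "has_bochner_integral lborel (\<lambda>v. norm (?k (u, v))) (Gamma a * (indicator {0..?A} u * (\<bar>sin u\<bar> * u powr (- a))))"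
      using *[of "indicator {0..?A} u * \<bar>sin u\<bar>"]
      by (cases "u > 0"; cases "u = 0") (auto simp: powr_minus divide_inverse mult_ac abs_mult)
  qed
  have [measurable]: "?k \<in> borel_measurable (lborel \<Otimes>\<^sub>M lborel)"
    by measurable
  have int: "integrable (lborel \<Otimes>\<^sub>M lborel) ?k"
  proof (rule lborel_pair.Fubini_integrable)
    show "integrable lborel (\<lambda>u. LINT v|lborel. norm (?k (u, v)))"
      unfolding has_bochner_integral_integral_eq[OF inner_norm]
      by (intro integrable_mult_right integrable_sin_powr a)
    show "AE u in lborel. integrable lborel (\<lambda>v. ?k (u, v))"
      using inner_v by (auto simp: has_bochner_integral_iff)
  qed measurable
  have inner_u: "(LINT u|lborel. ?k (u, v)) = indicator {0..} v * (v powr (a - 1) / (1 + v\<^sup>2) * (1 - exp (- v * ?A)))" for v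
  proof -
    have "has_bochner_integral lborel (\<lambda>u. indicator {0..} v * v powr (a - 1) * (indicator {0..?A} u * (sin u * exp (- v * u))))
        (indicator {0..} v * v powr (a - 1) * ((1 - exp (- v * ?A)) / (1 + v\<^sup>2)))"
      by (intro has_bochner_integral_mult_right integral_sin_exp_full_periods)
    from has_bochner_integral_integral_eq[OF this] show ?thesis by (simp add: mult_ac)
  qed
  have "Gamma a * (LINT u|lborel. indicator {0..?A} u * (sin u * u powr (- a))) = (LINT u|lborel. LINT v|lborel. ?k (u, v))"
    unfolding has_bochner_integral_integral_eq[OF inner_v] by simp
  also have "\<dots> = (LINT v|lborel. LINT u|lborel. ?k (u, v))"
    using lborel_pair.Fubini_integral[of "\<lambda>u v. ?k (u, v)"] int by simp
  finally show ?thesis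
    unfolding inner_u using G by (simp add: field_simps)
qed

lemma sine_integral_full_periods_limit:
  fixes a :: real
  assumes a: "0 < a" "a < 2"
  shows "(\<lambda>N. LINT u|lborel. indicator {0..full_periods N} u * (sin u * u powr (- a)))
    \<longlonglongrightarrow> pi / (2 * Gamma a * sin (a * pi / 2))"
proof -
  note J = has_bochner_integral_powr_div_1_plus_square[OF a]
  have "(\<lambda>N. LINT v|lborel. indicator {0..} v * (v powr (a - 1) / (1 + v\<^sup>2) * (1 - exp (- v * full_periods N))))
      \<longlonglongrightarrow> (LINT v|lborel. indicator {0..} v * (v powr (a - 1) / (1 + v\<^sup>2)))"
  proof (rule integral_dominated_convergence)
    show "integrable lborel (\<lambda>v. indicator {0..} v * (v powr (a - 1) / (1 + v\<^sup>2)))"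
      using J by (simp add: has_bochner_integral_iff)
    show "AE v in lborel. (\<lambda>N. indicator {0..} v * (v powr (a - 1) / (1 + v\<^sup>2) * (1 - exp (- v * full_periods N))))
        \<longlonglongrightarrow> indicator {0..} v * (v powr (a - 1) / (1 + v\<^sup>2))"
      using AE_lborel_singleton[of 0]
    proof eventually_elim
      case (elim v)
      show ?case
      proof (cases "v > 0")
        case True
        have "(\<lambda>N. exp (- (v * 2 * pi)) ^ N) \<longlonglongrightarrow> 0"
          using True by (intro LIMSEQ_realpow_zero) auto
        then have "(\<lambda>N. exp (- v * full_periods N)) \<longlonglongrightarrow> 0"
          by (simp add: full_periods_def exp_of_nat_mult[symmetric] mult_ac)
        then have "(\<lambda>N. indicator {0..} v * (v powr (a - 1) / (1 + v\<^sup>2) * (1 - exp (- v * full_periods N))))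
            \<longlonglongrightarrow> indicator {0..} v * (v powr (a - 1) / (1 + v\<^sup>2) * (1 - 0))"
          by (intro tendsto_intros)
        then show ?thesis by simp
      qed (use elim in auto)
    qed
    fix N
    show "AE v in lborel. norm (indicator {0..} v * (v powr (a - 1) / (1 + v\<^sup>2) * (1 - exp (- v * full_periods N))))
        \<le> indicator {0..} v * (v powr (a - 1) / (1 + v\<^sup>2))"
    proof (rule AE_I2)
      fix v :: real
      show "norm (indicator {0..} v * (v powr (a - 1) / (1 + v\<^sup>2) * (1 - exp (- v * full_periods N))))
        \<le> indicator {0..} v * (v powr (a - 1) / (1 + v\<^sup>2))"
      proof (cases "v \<ge> 0")
        case True
        then have "0 \<le> v * full_periods N" by simp
        then have "\<bar>1 - exp (- v * full_periods N)\<bar> \<le> 1" by (simp add: abs_if)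
        then have "v powr (a - 1) / (1 + v\<^sup>2) * \<bar>1 - exp (- v * full_periods N)\<bar> \<le> v powr (a - 1) / (1 + v\<^sup>2) * 1"
          by (intro mult_left_mono) (auto simp: add_nonneg_nonneg)
        then show ?thesis using True by (simp add: abs_mult)
      qed simp
    qed
  qed measurable
  then have "(\<lambda>N. (1 / Gamma a) * (LINT v|lborel. indicator {0..} v * (v powr (a - 1) / (1 + v\<^sup>2) * (1 - exp (- v * full_periods N)))))
      \<longlonglongrightarrow> (1 / Gamma a) * (LINT v|lborel. indicator {0..} v * (v powr (a - 1) / (1 + v\<^sup>2)))"
    by (intro tendsto_intros)
  then show ?thesis
    unfolding sine_integral_full_periods[OF a] has_bochner_integral_integral_eq[OF J] by (simp add: mult_ac)
qed

section \<open>Characteristic functions of symmetric laws near the origin\<close>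

lemma integral_tendsto_at_right_0:
  fixes f :: "real \<Rightarrow> 'a \<Rightarrow> real"
  assumes meas: "\<And>\<kappa>. f \<kappa> \<in> borel_measurable M" "g \<in> borel_measurable M"
    and w: "integrable M w"
    and lim: "AE x in M. ((\<lambda>\<kappa>. f \<kappa> x) \<longlongrightarrow> g x) (at_right 0)"
    and bound: "\<And>\<kappa>. \<kappa> > 0 \<Longrightarrow> AE x in M. \<bar>f \<kappa> x\<bar> \<le> w x"
  shows "((\<lambda>\<kappa>. LINT x|M. f \<kappa> x) \<longlongrightarrow> (LINT x|M. g x)) (at_right 0)"
  unfolding filterlim_at_right_to_top
proof (rule integral_dominated_convergence_at_top[OF _ _ w])
  show "\<forall>\<^sub>F R in at_top. AE x in M. norm (f (inverse R) x) \<le> w x"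
    using eventually_gt_at_top[of 0] by eventually_elim (use bound in simp)
  show "AE x in M. ((\<lambda>R. f (inverse R) x) \<longlongrightarrow> g x) at_top"
    using lim by eventually_elim (simp add: filterlim_at_right_to_top)
qed (use meas in auto)

lemma (in real_distribution) one_minus_Re_char: "1 - Re (char M \<kappa>) = (LINT x|M. 1 - cos (\<kappa> * x))"
proof -
  have "Re (char M \<kappa>) = (LINT x|M. cos (\<kappa> * x))"
    unfolding char_def by (subst integral_Re[symmetric]) (auto intro!: integrable_iexp simp: Re_exp)
  moreover have "integrable M (\<lambda>x. cos (\<kappa> * x))"
    by (rule integrable_const_bound[where B=1]) auto
  ultimately show ?thesis using prob_space by simp
qed

text \<open>The complement of a countable set meets every interval to the right of \<open>x\<close>. Exchanging \<open>P\<close> and \<open>Q\<close>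
  gives equality.\<close>

lemma cdf_le_of_eq_off_countable:
  assumes P: "real_distribution P" and Q: "real_distribution Q" and D: "countable D"
    and eq: "\<And>x. x \<notin> D \<Longrightarrow> cdf Q x = cdf P x"
  shows "cdf Q x \<le> cdf P x"
proof -
  interpret P: real_distribution P by fact
  interpret Q: real_distribution Q by fact
  show ?thesis
  proof (rule tendsto_lowerbound)
    show "(cdf P \<longlongrightarrow> cdf P x) (at_right x)"
      using P.cdf_is_right_cont[of x] by (simp add: continuous_within)
    have le: "cdf Q x \<le> cdf P y" if "x < y" for y
    proof -
      have "\<not> {x<..<y} \<subseteq> D"
        using D that countable_subset uncountable_open_interval by blast
      then obtain z where z: "x < z" "z < y" "z \<notin> D"
        by (meson greaterThanLessThan_iff subsetI)
      have "cdf Q x \<le> cdf Q z" using z by (intro Q.cdf_nondecreasing) simp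
      also have "\<dots> = cdf P z" using z by (intro eq)
      also have "\<dots> \<le> cdf P y" using z by (intro P.cdf_nondecreasing) simp
      finally show ?thesis .
    qed
    show "\<forall>\<^sub>F y in at_right x. cdf Q x \<le> cdf P y"
      using eventually_at_right_less[of x] by eventually_elim (rule le)
  qed simp
qed

text \<open>The law of \<open>- x\<close> has the same distribution function outside the countably many atoms of \<open>P\<close> and their
  mirror images, hence everywhere by right continuity.\<close>

lemma symmetric_cdf_imp_symmetric_distribution:
  assumes P: "real_distribution P"
    and sym: "\<And>x. isCont (cdf P) x \<Longrightarrow> cdf P (- x) + cdf P x = 1"
  shows "distr P borel uminus = P"
proof -
  interpret P: real_distribution P by fact
  let ?Q = "distr P borel uminus"
  have Q: "real_distribution ?Q" by (rule P.real_distribution_distr) simp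
  let ?A = "{x. P.prob {x} > 0}"
  define D where "D = ?A \<union> uminus ` ?A"
  have D: "countable D" unfolding D_def using P.countable_atoms by blast
  have eq: "cdf ?Q x = cdf P x" if "x \<notin> D" for x
  proof -
    have nx: "- x \<notin> ?A" using that by (force simp: D_def)
    then have 0: "P.prob {- x} = 0" by (simp add: zero_less_measure_iff measure_eq_emeasure_eq_ennreal)
    have "x \<notin> ?A" using that by (simp add: D_def)
    then have "P.prob {x} = 0" by (simp add: zero_less_measure_iff measure_eq_emeasure_eq_ennreal)
    then have "isCont (cdf P) x" by (simp add: P.isCont_cdf)
    then have s: "cdf P (- x) + cdf P x = 1" by (rule sym)
    have "cdf ?Q x = P.prob {- x..}"
      unfolding cdf_def by (subst measure_distr) (auto simp: vimage_def intro!: arg_cong[where f=P.prob])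
    also have "{- x..} = UNIV - {..< - x}" by auto
    also have "P.prob (UNIV - {..< - x}) = 1 - P.prob {..< - x}"
      using P.prob_compl[of "{..< - x}"] by simp
    also have "P.prob {..< - x} = cdf P (- x)"
    proof -
      have "cdf P (- x) = P.prob ({..< - x} \<union> {- x})"
        unfolding cdf_def by (rule arg_cong[where f=P.prob]) auto
      also have "\<dots> = P.prob {..< - x} + P.prob {- x}"
        by (rule P.finite_measure_Union) auto
      finally show ?thesis using 0 by simp
    qed
    finally show ?thesis using s by simp
  qed
  have "cdf ?Q = cdf P"
    using cdf_le_of_eq_off_countable[OF P Q D eq] cdf_le_of_eq_off_countable[OF Q P D eq[symmetric]]
    by (intro ext antisym)
  then show ?thesis by (rule cdf_unique[OF Q P])
qed

lemma symmetric_distribution_char: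
  assumes P: "real_distribution P" and sym: "distr P borel uminus = P"
  shows "char P \<kappa> = of_real (Re (char P \<kappa>))"
proof -
  interpret real_distribution P by fact
  have "char P \<kappa> = char (distr P borel uminus) \<kappa>" by (simp add: sym)
  also have "\<dots> = (LINT x|P. cnj (iexp (\<kappa> * x)))"
    unfolding char_def by (subst integral_distr) (auto simp: exp_cnj)
  also have "\<dots> = cnj (char P \<kappa>)"
    unfolding char_def by (rule integral_bounded_linear[OF bounded_linear_cnj integrable_iexp]) auto
  finally have "Im (char P \<kappa>) = 0" by (simp add: complex_eq_iff)
  then show ?thesis by (simp add: complex_eq_iff)
qed

lemma (in real_distribution) Re_char_abs: "Re (char M \<bar>\<kappa>\<bar>) = Re (char M \<kappa>)"
proof -
  have "cos (\<bar>\<kappa>\<bar> * x) = cos (\<kappa> * x)" for x by (simp add: abs_if)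
  then show ?thesis using one_minus_Re_char[of "\<bar>\<kappa>\<bar>"] one_minus_Re_char[of \<kappa>] by simp
qed

text \<open>Continue \<open>1 - cos\<close> by 0 after \<open>N\<close> full periods; the result is continuous because \<open>1 - cos\<close> vanishes there,
  and \<open>abelian_regular_tail\<close> applies to it. The error is bounded by the tail beyond the cut-off,
  uniformly in \<open>\<kappa>\<close> and with a bound that tends to 0 as \<open>N\<close> grows.\<close>

lemma half_cosine_tail_asymptotics:
  assumes P: "real_distribution P" and a: "0 < a" "a < 2"
    and tail: "(\<lambda>y. measure P {y<..}) \<sim>[at_top] (\<lambda>y. C * y powr (- a))" and C: "C > 0"
  shows "((\<lambda>\<kappa>. (LINT x|P. indicator {0<..} x * (1 - cos (\<kappa> * x))) / \<kappa> powr a) \<longlongrightarrow>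
    C * (pi / (2 * Gamma a * sin (a * pi / 2)))) (at_right 0)"
proof -
  interpret real_distribution P by fact
  obtain K where K: "K > 0" "\<And>y. y > 0 \<Longrightarrow> measure P {y<..} \<le> K * y powr (- a)"
    using regular_tail_bound[OF P a(1) tail C] by blast
  define f where "f = (\<lambda>N z. LINT u|lborel. indicator {0<..<z} u * (indicator {0..full_periods N} u * sin u))"
  have f_eq: "f N z = indicator {0<..full_periods N} z * (1 - cos z)" for N z
  proof -
    have *: "(LINT u|lborel. indicator {0..b} u * sin u) = 1 - cos b" if "0 \<le> b" for b :: real
    proof -
      have "has_bochner_integral lborel (\<lambda>u. indicator {0..b} u *\<^sub>R sin u) (- cos b - - cos 0)"
        by (rule has_bochner_integral_FTC_Icc)
          (use that in \<open>auto intro!: continuous_intros derivative_eq_intros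
            simp flip: has_real_derivative_iff_has_vector_derivative\<close>)
      then show ?thesis by (simp add: has_bochner_integral_iff)
    qed
    show ?thesis
    proof (cases "z > 0")
      case True
      have "f N z = (LINT u|lborel. indicator {0..min z (full_periods N)} u * sin u)"
        unfolding f_def
      proof (rule integral_cong_AE)
        show "AE u in lborel. indicator {0<..<z} u * (indicator {0..full_periods N} u * sin u)
            = indicator {0..min z (full_periods N)} u * sin u"
          using AE_lborel_singleton[of z] by eventually_elim (auto simp: indicator_def)
      qed measurable
      also have "\<dots> = 1 - cos (min z (full_periods N))"
        using True by (intro *) simp
      finally show ?thesis using True by (auto simp: min_def indicator_def)
    qed (simp add: f_def)
  qed
  have f_lim: "((\<lambda>\<kappa>. (LINT x|P. f N (\<kappa> * x)) / \<kappa> powr a) \<longlongrightarrow>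
      C * (LINT u|lborel. indicator {0..full_periods N} u * (sin u * u powr (- a)))) (at_right 0)" for N
  proof -
    have "((\<lambda>\<kappa>. (LINT x|P. f N (\<kappa> * x)) / \<kappa> powr a) \<longlongrightarrow>
      C * (LINT u|lborel. indicator {0<..} u * ((indicator {0..full_periods N} u * sin u) * u powr (- a)))) (at_right 0)"
    proof (rule abelian_regular_tail[OF P a(1) tail C])
      show "integrable lborel (\<lambda>u. indicator {0<..} u * ((indicator {0..full_periods N} u * sin u) * u powr (- a)))"
        by (rule Bochner_Integration.integrable_bound[OF integrable_sin_powr[OF a, of "full_periods N"]])
          (auto simp: indicator_def abs_mult)
    qed (auto simp: f_def)
    also have "(\<lambda>u. indicator {0<..} u * ((indicator {0..full_periods N} u * sin u) * u powr (- a)))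
        = (\<lambda>u. indicator {0..full_periods N} u * (sin u * u powr (- a)))"
      by (auto simp: fun_eq_iff indicator_def)
    finally show ?thesis .
  qed
  define h where "h = (\<lambda>\<kappa>. (LINT x|P. indicator {0<..} x * (1 - cos (\<kappa> * x))) / \<kappa> powr a)"
  have err: "\<bar>h \<kappa> - (LINT x|P. f N (\<kappa> * x)) / \<kappa> powr a\<bar> \<le> 2 * K * full_periods N powr (- a)"
    if \<kappa>: "\<kappa> > 0" and N: "N > 0" for N \<kappa>
  proof -
    let ?A = "full_periods N"
    have A: "?A > 0" using N by (simp add: full_periods_def)
    have int1: "integrable P (\<lambda>x. indicator {0<..} x * (1 - cos (\<kappa> * x)))"
      by (rule integrable_const_bound[where B=2])
        (auto simp: indicator_def abs_le_iff intro: order_trans[OF cos_le_one] cos_ge_minus_one)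
    have int2: "integrable P (\<lambda>x. f N (\<kappa> * x))"
      unfolding f_eq by (rule integrable_const_bound[where B=2])
        (auto simp: indicator_def abs_le_iff intro: order_trans[OF cos_le_one] cos_ge_minus_one)
    have "\<bar>(LINT x|P. indicator {0<..} x * (1 - cos (\<kappa> * x)) - f N (\<kappa> * x))\<bar>
        \<le> (LINT x|P. 2 * indicator {?A / \<kappa><..} x)"
    proof (rule integral_abs_bound_integral)
      fix x
      show "\<bar>indicator {0<..} x * (1 - cos (\<kappa> * x)) - f N (\<kappa> * x)\<bar> \<le> 2 * indicator {?A / \<kappa><..} x"
      proof (cases "x > 0 \<and> \<kappa> * x > ?A")
        case True
        moreover have "\<bar>1 - cos (\<kappa> * x)\<bar> \<le> 2"
          using cos_ge_minus_one[of "\<kappa> * x"] cos_le_one[of "\<kappa> * x"] by linarith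
        ultimately show ?thesis using \<kappa> by (simp add: f_eq field_simps)
      next
        case False
        then show ?thesis using \<kappa> by (auto simp: f_eq indicator_def zero_less_mult_iff)
      qed
    qed (use int1 int2 in \<open>auto intro!: integrable_const_bound[where B=2] simp: indicator_def\<close>)
    also have "\<dots> = 2 * measure P {?A / \<kappa><..}" by simp
    also have "\<dots> \<le> 2 * (K * (?A / \<kappa>) powr (- a))"
      using A \<kappa> by (intro mult_left_mono K) auto
    also have "\<dots> = 2 * K * ?A powr (- a) * \<kappa> powr a"
      using A \<kappa> by (simp add: powr_divide powr_minus field_simps)
    finally have "\<bar>(LINT x|P. indicator {0<..} x * (1 - cos (\<kappa> * x))) - (LINT x|P. f N (\<kappa> * x))\<bar>
        \<le> 2 * K * ?A powr (- a) * \<kappa> powr a"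
      using int1 int2 by simp
    then show ?thesis
      using \<kappa> by (simp add: h_def diff_divide_distrib[symmetric] abs_divide field_simps)
  qed
  have "(h \<longlongrightarrow> C * (pi / (2 * Gamma a * sin (a * pi / 2)))) (at_right 0)"
  proof (rule tendstoI)
    fix e :: real assume "e > 0"
    let ?S = "\<lambda>N. LINT u|lborel. indicator {0..full_periods N} u * (sin u * u powr (- a))"
    have "(\<lambda>N. C * ?S N) \<longlonglongrightarrow> C * (pi / (2 * Gamma a * sin (a * pi / 2)))"
      by (intro tendsto_mult tendsto_const sine_integral_full_periods_limit a)
    from tendstoD[OF this, of "e / 3"] \<open>e > 0\<close>
    have 1: "\<forall>\<^sub>F N in sequentially. dist (C * ?S N) (C * (pi / (2 * Gamma a * sin (a * pi / 2)))) < e / 3" by simp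
    have "filterlim full_periods at_top sequentially"
      unfolding full_periods_def
      by (intro filterlim_tendsto_pos_mult_at_top[OF tendsto_const] filterlim_real_sequentially) simp
    then have "(\<lambda>N. full_periods N powr (- a)) \<longlonglongrightarrow> 0"
      using a by (intro tendsto_neg_powr) auto
    then have "(\<lambda>N. 2 * K * full_periods N powr (- a)) \<longlonglongrightarrow> 2 * K * 0"
      by (intro tendsto_intros)
    then have 2: "\<forall>\<^sub>F N in sequentially. 2 * K * full_periods N powr (- a) < e / 3"
      using \<open>e > 0\<close> by (intro order_tendstoD) auto
    obtain N where N: "N > 0" "2 * K * full_periods N powr (- a) < e / 3"
      "dist (C * ?S N) (C * (pi / (2 * Gamma a * sin (a * pi / 2)))) < e / 3"
      using eventually_happens[OF eventually_conj[OF eventually_gt_at_top[of 0] eventually_conj[OF 2 1]]] by auto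
    have "\<forall>\<^sub>F \<kappa> in at_right 0. dist ((LINT x|P. f N (\<kappa> * x)) / \<kappa> powr a) (C * ?S N) < e / 3"
      using tendstoD[OF f_lim[of N], of "e / 3"] \<open>e > 0\<close> by simp
    with eventually_at_right_less[of "0::real"]
    show "\<forall>\<^sub>F \<kappa> in at_right 0. dist (h \<kappa>) (C * (pi / (2 * Gamma a * sin (a * pi / 2)))) < e"
    proof eventually_elim
      case (elim \<kappa>)
      have "dist (h \<kappa>) ((LINT x|P. f N (\<kappa> * x)) / \<kappa> powr a) < e / 3"
        using err[OF elim(1) N(1)] N(2) by (simp add: dist_real_def)
      then show ?case
        using elim(2) N(3) unfolding dist_real_def by linarith
    qed
  qed
  then show ?thesis by (simp add: h_def)
qed

section \<open>The two regimes at the origin\<close>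

text \<open>For infinite variance the two half lines contribute equally by symmetry, and twice \<open>b / \<alpha>\<close> times the
  sine integral is \<open>\<mu>\<close> because \<open>Gamma (\<alpha> + 1) = \<alpha> * Gamma \<alpha>\<close>.\<close>

lemma jump_regime_asymptotics:
  assumes P: "real_distribution P" and sym: "distr P borel uminus = P"
    and W: "interval_measure W = P" and regime: "jump_regime W \<alpha> \<mu>"
  shows "((\<lambda>\<kappa>. (1 - Re (char P \<kappa>)) / \<kappa> powr \<alpha>) \<longlongrightarrow> \<mu>) (at_right 0)" (is ?lim)
    and "\<mu> > 0" and "0 < \<alpha>"
proof -
  interpret real_distribution P by fact
  consider (var) "integrable P (\<lambda>x. x\<^sup>2)" "(LINT x|P. x\<^sup>2) > 0" "\<alpha> = 2" "\<mu> = (LINT x|P. x\<^sup>2) / 2"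
    | (stable) b where "0 < \<alpha>" "\<alpha> < 2" "b > 0"
      "(\<lambda>x. measure P {x<..}) \<sim>[at_top] (\<lambda>x. b / \<alpha> * x powr (- \<alpha>))"
      "\<mu> = b * pi / (Gamma (\<alpha> + 1) * sin (\<alpha> * pi / 2))"
    using regime unfolding jump_regime_def W by blast
  then have "?lim \<and> \<mu> > 0 \<and> 0 < \<alpha>"
  proof cases
    case var
    have "((\<lambda>\<kappa>. LINT x|P. (1 - cos (\<kappa> * x)) / \<kappa>\<^sup>2) \<longlongrightarrow> (LINT x|P. x\<^sup>2 / 2)) (at_right 0)"
    proof (rule integral_tendsto_at_right_0)
      show "integrable P (\<lambda>x. x\<^sup>2 / 2)" using var(1) by simp
      \<comment> \<open>The half angle formula gives both the pointwise limit and the bound.\<close>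
      have half: "(1 - cos (\<kappa> * x)) / \<kappa>\<^sup>2 = 2 * (sin (\<kappa> * (x / 2)) / \<kappa>)\<^sup>2" for \<kappa> x :: real
        using cos_double_sin[of "\<kappa> * (x / 2)"] by (simp add: power_divide)
      show "AE x in P. ((\<lambda>\<kappa>. (1 - cos (\<kappa> * x)) / \<kappa>\<^sup>2) \<longlongrightarrow> x\<^sup>2 / 2) (at_right 0)"
      proof (rule AE_I2)
        fix x :: real
        have "((\<lambda>\<kappa>. sin (\<kappa> * (x / 2))) has_real_derivative x / 2) (at 0)"
          by (auto intro!: derivative_eq_intros)
        then have "((\<lambda>\<kappa>. sin (\<kappa> * (x / 2)) / \<kappa>) \<longlongrightarrow> x / 2) (at 0)"
          by (simp add: DERIV_def)
        then have "((\<lambda>\<kappa>. sin (\<kappa> * (x / 2)) / \<kappa>) \<longlongrightarrow> x / 2) (at_right 0)"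
          by (rule filterlim_mono) (simp_all add: at_le)
        then have "((\<lambda>\<kappa>. 2 * (sin (\<kappa> * (x / 2)) / \<kappa>)\<^sup>2) \<longlongrightarrow> 2 * (x / 2)\<^sup>2) (at_right 0)"
          by (intro tendsto_mult tendsto_const tendsto_power)
        then show "((\<lambda>\<kappa>. (1 - cos (\<kappa> * x)) / \<kappa>\<^sup>2) \<longlongrightarrow> x\<^sup>2 / 2) (at_right 0)"
          unfolding half by (simp add: power_divide)
      qed
      fix \<kappa> :: real assume \<kappa>: "\<kappa> > 0"
      show "AE x in P. \<bar>(1 - cos (\<kappa> * x)) / \<kappa>\<^sup>2\<bar> \<le> x\<^sup>2 / 2"
      proof (rule AE_I2)
        fix x :: real
        have "\<bar>sin (\<kappa> * (x / 2)) / \<kappa>\<bar> \<le> \<bar>x / 2\<bar>"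
          using abs_sin_x_le_abs_x[of "\<kappa> * (x / 2)"] \<kappa> by (simp add: abs_mult field_simps)
        then have "(sin (\<kappa> * (x / 2)) / \<kappa>)\<^sup>2 \<le> (x / 2)\<^sup>2"
          by (simp only: abs_le_square_iff)
        then show "\<bar>(1 - cos (\<kappa> * x)) / \<kappa>\<^sup>2\<bar> \<le> x\<^sup>2 / 2"
          unfolding half by (simp add: power_divide mult.commute)
      qed
    qed auto
    then have "((\<lambda>\<kappa>. (1 - Re (char P \<kappa>)) / \<kappa>\<^sup>2) \<longlongrightarrow> \<mu>) (at_right 0)"
      by (simp add: one_minus_Re_char var)
    moreover have "\<forall>\<^sub>F \<kappa>::real in at_right 0. (1 - Re (char P \<kappa>)) / \<kappa>\<^sup>2 = (1 - Re (char P \<kappa>)) / \<kappa> powr \<alpha>"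
      using eventually_at_right_less by eventually_elim (simp add: var(3))
    ultimately have ?lim by (rule Lim_transform_eventually)
    with var show ?thesis by simp
  next
    case stable
    let ?S = "pi / (2 * Gamma \<alpha> * sin (\<alpha> * pi / 2))"
    have "((\<lambda>\<kappa>. (LINT x|P. indicator {0<..} x * (1 - cos (\<kappa> * x))) / \<kappa> powr \<alpha>) \<longlongrightarrow> b / \<alpha> * ?S) (at_right 0)"
      using stable by (intro half_cosine_tail_asymptotics P) auto
    then have "((\<lambda>\<kappa>. 2 * ((LINT x|P. indicator {0<..} x * (1 - cos (\<kappa> * x))) / \<kappa> powr \<alpha>)) \<longlongrightarrow> 2 * (b / \<alpha> * ?S)) (at_right 0)"
      by (intro tendsto_intros)
    moreover have "2 * (LINT x|P. indicator {0<..} x * (1 - cos (\<kappa> * x))) = 1 - Re (char P \<kappa>)" for \<kappa>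
    proof -
      let ?I = "LINT x|P. indicator {0<..} x * (1 - cos (\<kappa> * x))"
      have int: "integrable P (\<lambda>x. indicator S x * (1 - cos (\<kappa> * x)))" if "S \<in> sets borel" for S
        using that by (intro integrable_const_bound[where B=2])
          (auto simp: indicator_def abs_le_iff intro: order_trans[OF cos_le_one] cos_ge_minus_one)
      have "?I = (LINT x|distr P borel uminus. indicator {0<..} x * (1 - cos (\<kappa> * x)))"
        by (simp only: sym)
      also have "\<dots> = (LINT x|P. indicator {..<0} x * (1 - cos (\<kappa> * x)))"
        by (subst integral_distr) (auto intro!: Bochner_Integration.integral_cong simp: indicator_def)
      finally have "2 * ?I = ?I + (LINT x|P. indicator {..<0} x * (1 - cos (\<kappa> * x)))" by simp
      also have "\<dots> = (LINT x|P. indicator {0<..} x * (1 - cos (\<kappa> * x)) + indicator {..<0} x * (1 - cos (\<kappa> * x)))"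
        by (intro Bochner_Integration.integral_add[symmetric] int) auto
      also have "\<dots> = (LINT x|P. 1 - cos (\<kappa> * x))"
      proof (rule Bochner_Integration.integral_cong[OF refl])
        fix x :: real
        show "indicator {0<..} x * (1 - cos (\<kappa> * x)) + indicator {..<0} x * (1 - cos (\<kappa> * x)) = 1 - cos (\<kappa> * x)"
          by (cases "x = 0") (auto simp: indicator_def)
      qed
      finally show ?thesis by (simp add: one_minus_Re_char)
    qed
    moreover have "2 * (b / \<alpha> * ?S) = \<mu>"
    proof -
      have "\<alpha> \<notin> \<int>\<^sub>\<le>\<^sub>0" using stable(1) by (auto elim!: nonpos_Ints_cases)
      then have "Gamma (\<alpha> + 1) = \<alpha> * Gamma \<alpha>" by (rule Gamma_plus1)
      then show ?thesis using stable by simp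
    qed
    ultimately have ?lim by (simp add: mult.assoc[symmetric] times_divide_eq_right)
    moreover have "\<mu> > 0"
    proof -
      have "sin (\<alpha> * pi / 2) > 0" using stable by (intro sin_gt_zero) (auto simp: field_simps)
      moreover have "Gamma (\<alpha> + 1) > 0" using stable by (intro Gamma_real_pos) simp
      ultimately show ?thesis using stable by simp
    qed
    ultimately show ?thesis using stable by simp
  qed
  then show ?lim "\<mu> > 0" "0 < \<alpha>" by auto
qed

text \<open>For infinite mean the Abelian theorem with \<open>\<phi> u = exp (- u)\<close> yields \<open>c / \<beta> * Gamma (1 - \<beta>)\<close>, which is
  \<open>lam\<close> by the reflection formula.\<close>

lemma waiting_regime_asymptotics:
  assumes P: "real_distribution P" and pos: "AE x in P. 0 < x"
    and cdf: "cdf P = \<Phi>" and \<Phi>: "interval_measure \<Phi> = P" and regime: "waiting_regime \<Phi> \<beta> lam"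
  shows "((\<lambda>s. (1 - (LINT x|P. exp (- s * x))) / s powr \<beta>) \<longlongrightarrow> lam) (at_right 0)" (is ?lim)
    and "lam > 0" and "0 < \<beta>"
proof -
  interpret real_distribution P by fact
  have laplace: "1 - (LINT x|P. exp (- s * x)) = (LINT x|P. 1 - exp (- s * x))" if "s > 0" for s
  proof -
    have "integrable P (\<lambda>x. exp (- s * x))"
      using pos that by (intro integrable_const_bound[where B=1]) (auto elim!: eventually_mono)
    then show ?thesis using prob_space by simp
  qed
  consider (mean) "set_integrable P {0..} (\<lambda>t. t)" "\<beta> = 1" "lam = (LINT t:{0..}|P. t)"
    | (stable) c where "0 < \<beta>" "\<beta> < 1" "c > 0" "(\<lambda>t. 1 - \<Phi> t) \<sim>[at_top] (\<lambda>t. c / \<beta> * t powr (- \<beta>))"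
      "lam = c * pi / (Gamma (\<beta> + 1) * sin (\<beta> * pi))"
    using regime unfolding waiting_regime_def \<Phi> by blast
  then have "?lim \<and> lam > 0 \<and> 0 < \<beta>"
  proof cases
    case mean
    have int: "integrable P (\<lambda>x. indicator {0..} x * x)"
      using mean(1) by (simp add: set_integrable_def)
    have lam: "lam = (LINT x|P. indicator {0..} x * x)"
      using mean(3) by (simp add: set_lebesgue_integral_def)
    have "((\<lambda>s. LINT x|P. (1 - exp (- s * x)) / s) \<longlongrightarrow> (LINT x|P. indicator {0..} x * x)) (at_right 0)"
    proof (rule integral_tendsto_at_right_0[OF _ _ int])
      show "AE x in P. ((\<lambda>s. (1 - exp (- s * x)) / s) \<longlongrightarrow> indicator {0..} x * x) (at_right 0)"
        using pos
      proof eventually_elim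
        case (elim x)
        have "((\<lambda>s. 1 - exp (- s * x)) has_real_derivative x) (at 0)"
          by (auto intro!: derivative_eq_intros)
        then have "((\<lambda>s. (1 - exp (- s * x)) / s) \<longlongrightarrow> x) (at 0)"
          by (simp add: DERIV_def)
        then have "((\<lambda>s. (1 - exp (- s * x)) / s) \<longlongrightarrow> x) (at_right 0)"
          by (rule filterlim_mono) (simp_all add: at_le)
        then show ?case using elim by simp
      qed
      fix s :: real assume s: "s > 0"
      show "AE x in P. \<bar>(1 - exp (- s * x)) / s\<bar> \<le> indicator {0..} x * x"
        using pos
      proof eventually_elim
        case (elim x)
        have "1 - exp (- s * x) \<le> s * x" using exp_ge_add_one_self[of "- s * x"] by simp
        moreover have "0 \<le> s * x" using elim s by simp
        ultimately show ?case using elim s by (simp add: field_simps)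
      qed
    qed auto
    moreover have "\<forall>\<^sub>F s in at_right 0. (LINT x|P. (1 - exp (- s * x)) / s) = (1 - (LINT x|P. exp (- s * x))) / s powr \<beta>"
      using eventually_at_right_less
    proof eventually_elim
      case (elim s)
      then show ?case using laplace[OF elim] by (simp add: mean(2))
    qed
    ultimately have ?lim unfolding lam by (rule Lim_transform_eventually)
    moreover have "lam > 0"
    proof -
      have "lam \<noteq> 0"
      proof
        assume "lam = 0"
        then have "AE x in P. indicator {0..} x * x = (0::real)"
          using integral_nonneg_eq_0_iff_AE[OF int] lam by (simp add: indicator_def)
        with pos have "AE x in P. False" by eventually_elim (auto simp: indicator_def)
        then show False using AE_False by simp
      qed
      moreover have "lam \<ge> 0" unfolding lam by (intro Bochner_Integration.integral_nonneg) (simp add: indicator_def)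
      ultimately show ?thesis by simp
    qed
    ultimately show ?thesis by (simp add: mean(2))
  next
    case stable
    define f where "f = (\<lambda>z. LINT u|lborel. indicator {0<..<z} u * exp (- u :: real))"
    have f_eq: "f z = 1 - exp (- z)" if "z > 0" for z
    proof -
      have "has_bochner_integral lborel (\<lambda>u. indicator {0..z} u *\<^sub>R exp (- u)) (- exp (- z) - - exp (- 0))"
        by (rule has_bochner_integral_FTC_Icc)
          (use that in \<open>auto intro!: continuous_intros derivative_eq_intros
            simp flip: has_real_derivative_iff_has_vector_derivative\<close>)
      then have "(LINT u|lborel. indicator {0..z} u * exp (- u)) = 1 - exp (- z)"
        by (simp add: has_bochner_integral_iff)
      moreover have "f z = (LINT u|lborel. indicator {0..z} u * exp (- u))"
        unfolding f_def
      proof (rule integral_cong_AE)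
        show "AE u in lborel. indicator {0<..<z} u * exp (- u) = indicator {0..z} u * exp (- u)"
          using AE_lborel_singleton[of z] AE_lborel_singleton[of 0]
          by eventually_elim (auto simp: indicator_def)
      qed measurable
      ultimately show ?thesis by simp
    qed
    have L: "has_bochner_integral lborel (\<lambda>u. indicator {0<..} u * (exp (- u) * u powr (- \<beta>))) (Gamma (1 - \<beta>))"
    proof -
      have "has_bochner_integral lborel (\<lambda>u. indicator {0..} u * (exp (- 1 * u) * u powr (1 - \<beta> - 1))) (Gamma (1 - \<beta>) / 1 powr (1 - \<beta>))"
        using stable by (intro has_bochner_integral_laplace_powr) auto
      also have "(\<lambda>u. indicator {0..} u * (exp (- 1 * u) * u powr (1 - \<beta> - 1))) = (\<lambda>u. indicator {0<..} u * (exp (- u) * u powr (- \<beta>)))"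
        by (auto simp: fun_eq_iff indicator_def)
      finally show ?thesis by simp
    qed
    have tail: "(\<lambda>y. measure P {y<..}) \<sim>[at_top] (\<lambda>y. c / \<beta> * y powr (- \<beta>))"
    proof -
      have "1 - \<Phi> y = measure P {y<..}" for y
        using prob_compl[of "{..y}"] by (simp add: cdf[symmetric] cdf_def Compl_eq_Diff_UNIV[symmetric])
      then show ?thesis using stable(4) by simp
    qed
    have "((\<lambda>s. (LINT x|P. f (s * x)) / s powr \<beta>) \<longlongrightarrow>
        c / \<beta> * (LINT u|lborel. indicator {0<..} u * (exp (- u) * u powr (- \<beta>)))) (at_right 0)"
      using stable L by (intro abelian_regular_tail[OF P _ tail]) (auto simp: f_def has_bochner_integral_iff)
    also have "(LINT u|lborel. indicator {0<..} u * (exp (- u) * u powr (- \<beta>))) = Gamma (1 - \<beta>)"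
      by (rule has_bochner_integral_integral_eq[OF L])
    also have "c / \<beta> * Gamma (1 - \<beta>) = lam"
    proof -
      have "\<beta> \<notin> \<int>\<^sub>\<le>\<^sub>0" using stable(1) by (auto elim!: nonpos_Ints_cases)
      then have G: "Gamma (\<beta> + 1) = \<beta> * Gamma \<beta>" by (rule Gamma_plus1)
      have "Gamma \<beta> > 0" using stable by (intro Gamma_real_pos)
      then have "Gamma (1 - \<beta>) = pi / (Gamma \<beta> * sin (\<beta> * pi))"
        using Gamma_reflection_real[of \<beta>]
        by (metis divide_divide_eq_left less_irrefl mult.commute nonzero_mult_div_cancel_left)
      then show ?thesis using stable G by simp
    qed
    finally have "((\<lambda>s. (LINT x|P. f (s * x)) / s powr \<beta>) \<longlongrightarrow> lam) (at_right 0)" .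
    moreover have "\<forall>\<^sub>F s in at_right 0. (LINT x|P. f (s * x)) / s powr \<beta> = (1 - (LINT x|P. exp (- s * x))) / s powr \<beta>"
      using eventually_at_right_less
    proof eventually_elim
      case (elim s)
      have "(LINT x|P. f (s * x)) = (LINT x|P. 1 - exp (- s * x))"
      proof (rule integral_cong_AE)
        show "AE x in P. f (s * x) = 1 - exp (- s * x)"
          using pos by eventually_elim (use elim in \<open>simp add: f_eq\<close>)
        have "f = (\<lambda>z. if z > 0 then 1 - exp (- z) else 0)"
        proof
          fix z show "f z = (if z > 0 then 1 - exp (- z) else 0)"
            by (cases "z > 0") (simp add: f_eq, simp add: f_def)
        qed
        moreover have "(\<lambda>x. if s * x > 0 then 1 - exp (- (s * x)) else 0) \<in> borel_measurable P"
          by measurable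
        ultimately show "(\<lambda>x. f (s * x)) \<in> borel_measurable P" by simp
      qed measurable
      then show ?case by (simp only: laplace[OF elim])
    qed
    ultimately have ?lim by (rule Lim_transform_eventually)
    moreover have "lam > 0"
    proof -
      have "sin (\<beta> * pi) > 0" using stable by (intro sin_gt_zero) auto
      moreover have "Gamma (\<beta> + 1) > 0" using stable by (intro Gamma_real_pos) simp
      ultimately show ?thesis using stable by simp
    qed
    ultimately show ?thesis using stable by simp
  qed
  then show ?lim "lam > 0" "0 < \<beta>" by auto
qed

section \<open>The Fourier-Laplace transform of the walk\<close>

lemma jump_instant_measurable:
  "(\<And>n. T n \<in> borel_measurable M) \<Longrightarrow> jump_instant T n \<in> borel_measurable M"
  unfolding jump_instant_def[abs_def] by measurable

lemma position_after_measurable: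
  "(\<And>n. X n \<in> borel_measurable M) \<Longrightarrow> position_after X n \<in> borel_measurable M"
  unfolding position_after_def[abs_def] by measurable

lemma ctrw_measurable:
  assumes [measurable]: "\<And>n. T n \<in> borel_measurable M" "\<And>n. X n \<in> borel_measurable M"
  shows "ctrw T X t \<in> borel_measurable M"
proof -
  note [measurable] = jump_instant_measurable[of T, OF assms(1)] position_after_measurable[of X, OF assms(2)]
  have [measurable]: "jump_count T t \<in> measurable M (count_space UNIV)"
    unfolding jump_count_def[abs_def] by measurable
  show ?thesis
    unfolding ctrw_def[abs_def] by (rule measurable_compose_countable) measurable
qed

text \<open>The symmetry of the jumps is recorded as reality of their characteristic function, the only form in
  which it enters the analysis of the walk.\<close>

locale ctrw_model = prob_space M for M :: "'a measure" +
  fixes T X :: "nat \<Rightarrow> 'a \<Rightarrow> real" and P Q :: "real measure"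
  assumes T_indep: "indep_vars (\<lambda>_. borel) T UNIV"
    and T_law: "\<And>n. distr M borel (T n) = P"
    and T_pos: "\<And>n. AE \<omega> in M. 0 < T n \<omega>"
    and X_indep: "indep_vars (\<lambda>_. borel) X UNIV"
    and X_law: "\<And>n. distr M borel (X n) = Q"
    and X_symmetric: "\<And>\<kappa>. char Q \<kappa> = of_real (Re (char Q \<kappa>))"
    and TX_indep: "indep_sequences M T X"
begin

lemma T_measurable [measurable]: "T n \<in> borel_measurable M"
  using T_indep by (simp add: indep_vars_def)

lemma X_measurable [measurable]: "X n \<in> borel_measurable M"
  using X_indep by (simp add: indep_vars_def)

lemmas measurable_variables [measurable] =
  jump_instant_measurable[of T, OF T_measurable] position_after_measurable[of X, OF X_measurable]
  ctrw_measurable[of T _ X, OF T_measurable X_measurable]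

lemma P_distribution: "real_distribution P"
  using real_distribution_distr[of "T 0"] T_law by simp

lemma Q_distribution: "real_distribution Q"
  using real_distribution_distr[of "X 0"] X_law by simp

lemma AE_T_pos: "AE \<omega> in M. \<forall>n. 0 < T n \<omega>"
  using T_pos by (simp add: AE_all_countable)

lemma P_pos: "AE x in P. 0 < x"
  unfolding T_law[of 0, symmetric] using T_pos[of 0] by (subst AE_distr_iff) auto

definition waiting_laplace :: "real \<Rightarrow> real" where
  "waiting_laplace s = (LINT x|P. exp (- s * x))"

definition jump_char :: "real \<Rightarrow> real" where
  "jump_char \<kappa> = Re (char Q \<kappa>)"

definition arrived :: "nat \<Rightarrow> real \<Rightarrow> real" where
  "arrived n t = prob {\<omega> \<in> space M. jump_instant T n \<omega> \<le> t}"

lemma integrable_exp_T: "s \<ge> 0 \<Longrightarrow> integrable M (\<lambda>\<omega>. exp (- s * T n \<omega>))"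
  using T_pos[of n] by (intro integrable_const_bound[where B=1]) (auto elim!: eventually_mono)

lemma waiting_laplace_bounds:
  assumes "s > 0"
  shows "0 \<le> waiting_laplace s" "waiting_laplace s < 1"
proof -
  interpret P: real_distribution P by (rule P_distribution)
  have int: "integrable P (\<lambda>x. exp (- s * x))"
    using P_pos assms by (intro P.integrable_const_bound[where B=1]) (auto elim!: eventually_mono)
  show "0 \<le> waiting_laplace s"
    unfolding waiting_laplace_def by (intro Bochner_Integration.integral_nonneg) simp
  have nonneg: "AE x in P. 0 \<le> 1 - exp (- s * x)"
    using P_pos by eventually_elim (use assms in simp)
  have eq: "1 - waiting_laplace s = (LINT x|P. 1 - exp (- s * x))"
    unfolding waiting_laplace_def using int P.prob_space by simp
  have "(LINT x|P. 1 - exp (- s * x)) \<noteq> 0"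
  proof
    assume "(LINT x|P. 1 - exp (- s * x)) = 0"
    then have "AE x in P. 1 - exp (- s * x) = 0"
      using integral_nonneg_eq_0_iff_AE[OF _ nonneg] int by simp
    with P_pos have "AE x in P. False" by eventually_elim (use assms in simp)
    then show False using P.AE_False by simp
  qed
  moreover have "(LINT x|P. 1 - exp (- s * x)) \<ge> 0"
    using nonneg by (rule integral_nonneg_AE)
  ultimately show "waiting_laplace s < 1" using eq by simp
qed

lemma abs_jump_char_le_1: "\<bar>jump_char \<kappa>\<bar> \<le> 1"
  using order_trans[OF abs_Re_le_cmod real_distribution.cmod_char_le_1[OF Q_distribution]]
  by (simp add: jump_char_def)

lemma laplace_jump_instant:
  assumes "s \<ge> 0"
  shows "expectation (\<lambda>\<omega>. exp (- s * jump_instant T n \<omega>)) = waiting_laplace s ^ n"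
proof -
  have "indep_vars (\<lambda>_. borel) (\<lambda>k \<omega>. exp (- s * T k \<omega>)) {..<n}"
    by (rule indep_vars_compose2[OF indep_vars_subset[OF T_indep], of _ "\<lambda>_ x. exp (- s * x)"]) auto
  then have "expectation (\<lambda>\<omega>. \<Prod>k<n. exp (- s * T k \<omega>)) = (\<Prod>k<n. expectation (\<lambda>\<omega>. exp (- s * T k \<omega>)))"
    using assms by (intro indep_vars_lebesgue_integral integrable_exp_T) auto
  moreover have "expectation (\<lambda>\<omega>. exp (- s * T k \<omega>)) = waiting_laplace s" for k
  proof -
    have "waiting_laplace s = (LINT x|distr M borel (T k). exp (- s * x))"
      by (simp add: waiting_laplace_def T_law)
    then show ?thesis by (subst (asm) integral_distr) auto
  qed
  moreover have "(\<Prod>k<n. exp (- s * T k \<omega>)) = exp (- s * jump_instant T n \<omega>)" for \<omega>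
    by (simp add: jump_instant_def sum_distrib_left exp_sum[symmetric] sum_negf)
  ultimately show ?thesis by simp
qed

lemma AE_jump_instant_nonneg: "AE \<omega> in M. 0 \<le> jump_instant T n \<omega>"
  using AE_T_pos by eventually_elim (simp add: jump_instant_def sum_nonneg less_imp_le)

lemma integrable_exp_jump_instant: "s \<ge> 0 \<Longrightarrow> integrable M (\<lambda>\<omega>. exp (- s * jump_instant T n \<omega>))"
  using AE_jump_instant_nonneg[of n]
  by (intro integrable_const_bound[where B=1]) (auto elim!: eventually_mono)

text \<open>Markov's inequality for \<open>exp (- S\<^sub>n)\<close>. It gives geometric decay in \<open>n\<close>, and in particular shows that
  infinitely many jumps in finite time have probability 0.\<close>

lemma arrived_le: "arrived n t \<le> exp t * waiting_laplace 1 ^ n"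
proof -
  have "arrived n t = (LINT \<omega>|M. indicator {\<omega> \<in> space M. jump_instant T n \<omega> \<le> t} \<omega>)"
    by (simp add: arrived_def)
  also have "\<dots> \<le> (LINT \<omega>|M. exp t * exp (- 1 * jump_instant T n \<omega>))"
    proof (rule integral_mono)
    show "integrable M (\<lambda>\<omega>. exp t * exp (- 1 * jump_instant T n \<omega>))"
      by (intro integrable_mult_right integrable_exp_jump_instant) simp
    fix \<omega>
    show "indicator {\<omega> \<in> space M. jump_instant T n \<omega> \<le> t} \<omega> \<le> exp t * exp (- 1 * jump_instant T n \<omega>)"
      by (simp add: indicator_def exp_add[symmetric])
  qed (auto intro!: integrable_const_bound[where B=1] simp: indicator_def)
  also have "\<dots> = exp t * waiting_laplace 1 ^ n"
    using laplace_jump_instant[of 1 n] by simp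
  finally show ?thesis .
qed

lemma arrived_nonneg [simp]: "0 \<le> arrived n t"
  by (simp add: arrived_def)

lemma arrived_le_1 [simp]: "arrived n t \<le> 1"
  by (simp add: arrived_def)

lemma arrived_0: "t \<ge> 0 \<Longrightarrow> arrived 0 t = 1"
  by (simp add: arrived_def jump_instant_def prob_space)

lemma arrived_mono: "t \<le> t' \<Longrightarrow> arrived n t \<le> arrived n t'"
  unfolding arrived_def by (intro finite_measure_mono) auto

lemma arrived_measurable [measurable]: "arrived n \<in> borel_measurable borel"
  by (rule borel_measurable_mono) (simp add: mono_def arrived_mono)

lemma arrived_neg:
  assumes "t < 0"
  shows "arrived n t = 0"
proof -
  have "AE \<omega> in M. \<not> jump_instant T n \<omega> \<le> t"
    using AE_jump_instant_nonneg[of n] by eventually_elim (use assms in simp)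
  moreover have "{\<omega> \<in> space M. jump_instant T n \<omega> \<le> t} \<in> events"
    by measurable
  ultimately show ?thesis
    unfolding arrived_def by (simp only: prob_Collect_eq_0)
qed

lemma arrived_summable: "\<bar>w\<bar> \<le> 1 \<Longrightarrow> summable (\<lambda>n. w ^ n * arrived (n + k) t)"
proof (rule summable_comparison_test')
  show "summable (\<lambda>n. exp t * waiting_laplace 1 ^ k * waiting_laplace 1 ^ n)"
    using waiting_laplace_bounds[of 1] by (intro summable_mult summable_geometric) auto
  fix n :: nat assume w: "\<bar>w\<bar> \<le> 1"
  have "\<bar>w\<bar> ^ n * arrived (n + k) t \<le> 1 * arrived (n + k) t"
    using w by (intro mult_right_mono power_le_one) auto
  also have "\<dots> \<le> exp t * waiting_laplace 1 ^ k * waiting_laplace 1 ^ n"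
    using arrived_le[of "n + k" t] by (simp add: power_add mult_ac)
  finally show "norm (w ^ n * arrived (n + k) t) \<le> exp t * waiting_laplace 1 ^ k * waiting_laplace 1 ^ n"
    by (simp add: abs_mult power_abs)
qed

text \<open>This is the expectation of \<open>w\<close> raised to the number of jumps up to time \<open>t\<close>, after summation by parts.
  In this form the dependence on \<open>t\<close> is visibly monotone for \<open>0 \<le> w \<le> 1\<close>.\<close>

definition count_transform :: "real \<Rightarrow> real \<Rightarrow> real" where
  "count_transform w t = 1 - (1 - w) * (\<Sum>n. w ^ n * arrived (n + 1) t)"

lemma count_transform_measurable [measurable]: "count_transform w \<in> borel_measurable borel"
  unfolding count_transform_def[abs_def] by measurable

lemma count_transform_antimono:
  assumes "0 \<le> w" "w \<le> 1" "t \<le> t'"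
  shows "count_transform w t' \<le> count_transform w t"
  unfolding count_transform_def
  using assms by (intro diff_left_mono mult_left_mono suminf_le arrived_summable arrived_mono) auto

text \<open>Decompose according to the number of jumps up to time \<open>t\<close>. The event of exactly \<open>n\<close> jumps depends on the
  waiting times only, so it is independent of the position after \<open>n\<close> jumps.\<close>

lemma char_ctrw:
  assumes t: "t \<ge> 0"
  shows "char (distr M borel (ctrw T X t)) \<kappa> = of_real (count_transform (jump_char \<kappa>) t)"
proof -
  define w where "w = jump_char \<kappa>"
  have w: "\<bar>w\<bar> \<le> 1" unfolding w_def by (rule abs_jump_char_le_1)
  define A where "A = (\<lambda>n. {\<omega> \<in> space M. jump_instant T n \<omega> \<le> t \<and> t < jump_instant T (Suc n) \<omega>})"
  have A [measurable]: "A n \<in> sets M" for n unfolding A_def by measurable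
  have prob_A: "prob (A n) = arrived n t - arrived (Suc n) t" for n
  proof -
    have "prob (A n) = prob ({\<omega> \<in> space M. jump_instant T n \<omega> \<le> t} - {\<omega> \<in> space M. jump_instant T (Suc n) \<omega> \<le> t})"
      by (rule arg_cong[where f=prob]) (auto simp: A_def)
    also have "\<dots> = arrived n t - prob ({\<omega> \<in> space M. jump_instant T n \<omega> \<le> t} \<inter> {\<omega> \<in> space M. jump_instant T (Suc n) \<omega> \<le> t})"
      unfolding arrived_def by (rule finite_measure_Diff') auto
    also have "prob ({\<omega> \<in> space M. jump_instant T n \<omega> \<le> t} \<inter> {\<omega> \<in> space M. jump_instant T (Suc n) \<omega> \<le> t}) = arrived (Suc n) t"
      unfolding arrived_def
      by (rule finite_measure_eq_AE) (use AE_T_pos in \<open>auto simp: jump_instant_def elim!: eventually_mono\<close>,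
          smt (verit))
    finally show ?thesis .
  qed
  have arrived_lim: "(\<lambda>n. arrived n t) \<longlonglongrightarrow> 0"
    using summable_LIMSEQ_zero[OF arrived_summable[of 1 0 t]] by simp
  have A_summable: "summable (\<lambda>n. prob (A n))"
    unfolding prob_A using telescope_summable'[OF arrived_lim] by simp
  have strict: "AE \<omega> in M. strict_mono (\<lambda>n. jump_instant T n \<omega>)"
    using AE_T_pos by eventually_elim (auto simp: strict_mono_Suc_iff jump_instant_def)
  \<comment> \<open>Almost surely the jump instants increase and exceed \<open>t\<close>, so the number of jumps is well defined.\<close>
  have reach: "AE \<omega> in M. \<exists>n. t < jump_instant T n \<omega>"
  proof -
    have "prob {\<omega> \<in> space M. \<forall>n. jump_instant T n \<omega> \<le> t} \<le> 0"
    proof (rule LIMSEQ_le_const[OF arrived_lim], intro exI allI impI)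
      fix n
      show "prob {\<omega> \<in> space M. \<forall>n. jump_instant T n \<omega> \<le> t} \<le> arrived n t"
        unfolding arrived_def by (intro finite_measure_mono) auto
    qed
    then have "prob {\<omega> \<in> space M. \<forall>n. jump_instant T n \<omega> \<le> t} = 0"
      by (simp add: measure_le_0_iff)
    then have "AE \<omega> in M. \<not> (\<forall>n. jump_instant T n \<omega> \<le> t)"
      by (subst (asm) prob_Collect_eq_0) auto
    then show ?thesis by eventually_elim (auto simp: not_le)
  qed
  have count: "AE \<omega> in M. \<forall>n. \<omega> \<in> A n \<longleftrightarrow> n = jump_count T t \<omega>"
    using strict reach AE_space
  proof eventually_elim
    case (elim \<omega>)
    let ?S = "\<lambda>n. jump_instant T n \<omega>"
    define m where "m = (LEAST n. t < ?S n)"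
    have m: "t < ?S m" using elim(2) unfolding m_def by (rule LeastI_ex)
    have "m \<noteq> 0" using m t by (auto simp: jump_instant_def intro!: Nat.gr0I)
    then obtain k where k: "m = Suc k" using not0_implies_Suc by blast
    have "\<not> t < ?S k" using k not_less_Least[of k "\<lambda>n. t < ?S n"] by (simp add: m_def)
    then have k_in: "?S k \<le> t \<and> t < ?S (Suc k)" using m k by simp
    have unique: "n = k" if "?S n \<le> t \<and> t < ?S (Suc n)" for n
    proof (rule antisym)
      have "?S n < ?S (Suc k)" "?S k < ?S (Suc n)" using that k_in by auto
      then show "n \<le> k" "k \<le> n" using strict_mono_less[OF elim(1)] by auto
    qed
    have "jump_count T t \<omega> = k"
      unfolding jump_count_def by (rule Least_equality, rule k_in, metis order_refl unique)
    moreover have "\<omega> \<in> A n \<longleftrightarrow> n = k" for n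
      unfolding A_def using elim(3) k_in unique by blast
    ultimately show ?case by simp
  qed
  let ?f = "\<lambda>n \<omega>. indicator (A n) \<omega> * iexp (\<kappa> * position_after X n \<omega>)"
  have factor: "expectation (?f n) = of_real (prob (A n) * w ^ n)" for n
  proof -
    let ?Y1 = "\<lambda>y::nat \<Rightarrow> real. (if (\<Sum>k<n. y k) \<le> t \<and> t < (\<Sum>k<Suc n. y k) then 1 else 0) :: complex"
    let ?Y2 = "\<lambda>x::nat \<Rightarrow> real. iexp (\<kappa> * (\<Sum>k<n. x k))"
    have "indep_var borel (?Y1 \<circ> (\<lambda>\<omega> n. T n \<omega>)) borel (?Y2 \<circ> (\<lambda>\<omega> n. X n \<omega>))"
      by (rule indep_var_compose[OF TX_indep[unfolded indep_sequences_def]]) measurable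
    moreover have "?Y1 \<circ> (\<lambda>\<omega> n. T n \<omega>) = (\<lambda>\<omega>. ?Y1 (\<lambda>n. T n \<omega>))" "?Y2 \<circ> (\<lambda>\<omega> n. X n \<omega>) = (\<lambda>\<omega>. ?Y2 (\<lambda>n. X n \<omega>))"
      by (simp_all add: comp_def)
    ultimately have ind: "indep_var borel (\<lambda>\<omega>. ?Y1 (\<lambda>n. T n \<omega>)) borel (\<lambda>\<omega>. ?Y2 (\<lambda>n. X n \<omega>))"
      by simp
    have "expectation (?f n) = expectation (\<lambda>\<omega>. ?Y1 (\<lambda>n. T n \<omega>) * ?Y2 (\<lambda>n. X n \<omega>))"
    proof (rule Bochner_Integration.integral_cong[OF refl])
      fix \<omega> assume "\<omega> \<in> space M"
      then have "?Y1 (\<lambda>n. T n \<omega>) = indicator (A n) \<omega>"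
        by (simp only: A_def jump_instant_def indicator_def mem_Collect_eq simp_thms of_bool_def)
      then show "?f n \<omega> = ?Y1 (\<lambda>n. T n \<omega>) * ?Y2 (\<lambda>n. X n \<omega>)"
        by (simp only: position_after_def)
    qed
    also have "\<dots> = expectation (\<lambda>\<omega>. ?Y1 (\<lambda>n. T n \<omega>)) * expectation (\<lambda>\<omega>. ?Y2 (\<lambda>n. X n \<omega>))"
    proof (rule indep_var_lebesgue_integral[OF ind])
      show "integrable M (\<lambda>\<omega>. ?Y1 (\<lambda>n. T n \<omega>))"
        by (rule integrable_const_bound[where B=1]) auto
      show "integrable M (\<lambda>\<omega>. ?Y2 (\<lambda>n. X n \<omega>))"
        by (rule integrable_iexp) measurable
    qed
    also have "expectation (\<lambda>\<omega>. ?Y1 (\<lambda>n. T n \<omega>)) = expectation (\<lambda>\<omega>. of_real (indicator (A n) \<omega>))"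
      by (rule Bochner_Integration.integral_cong[OF refl])
        (simp only: A_def jump_instant_def indicator_def mem_Collect_eq simp_thms of_bool_def of_real_1 of_real_0 if_distrib[of of_real])
    also have "\<dots> = of_real (prob (A n))"
      by (subst integral_complex_of_real) simp
    also have "expectation (\<lambda>\<omega>. ?Y2 (\<lambda>n. X n \<omega>)) = char (distr M borel (\<lambda>\<omega>. \<Sum>k<n. X k \<omega>)) \<kappa>"
      unfolding char_def by (subst integral_distr) auto
    also have "\<dots> = (\<Prod>k<n. char (distr M borel (X k)) \<kappa>)"
      by (rule char_distr_sum[OF indep_vars_subset[OF X_indep]]) simp
    also have "\<dots> = of_real (w ^ n)"
      by (simp add: X_law w_def jump_char_def X_symmetric[symmetric])
    finally show ?thesis by simp
  qed
  have f_int: "integrable M (?f n)" for n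
    by (rule integrable_const_bound[where B=1]) (auto simp: indicator_def norm_mult)
  have f_norm: "norm (?f n \<omega>) = indicator (A n) \<omega>" for n \<omega>
    by (simp add: norm_mult indicator_def)
  have series: "(\<lambda>n. expectation (?f n)) sums (expectation (\<lambda>\<omega>. \<Sum>n. ?f n \<omega>))"
  proof (rule sums_integral[OF f_int])
    show "AE \<omega> in M. summable (\<lambda>n. norm (?f n \<omega>))"
      using count unfolding f_norm
    proof eventually_elim
      case (elim \<omega>)
      then show ?case
        by (intro summable_finite[of "{jump_count T t \<omega>}"]) (auto simp: indicator_def)
    qed
    show "summable (\<lambda>n. expectation (\<lambda>\<omega>. norm (?f n \<omega>)))"
      unfolding f_norm using A_summable by simp
  qed
  have "char (distr M borel (ctrw T X t)) \<kappa> = expectation (\<lambda>\<omega>. iexp (\<kappa> * ctrw T X t \<omega>))"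
    unfolding char_def by (subst integral_distr) auto
  also have "\<dots> = expectation (\<lambda>\<omega>. \<Sum>n. ?f n \<omega>)"
  proof (rule integral_cong_AE)
    show "AE \<omega> in M. iexp (\<kappa> * ctrw T X t \<omega>) = (\<Sum>n. ?f n \<omega>)"
      using count
    proof eventually_elim
      case (elim \<omega>)
      have "(\<Sum>n. ?f n \<omega>) = (\<Sum>n\<in>{jump_count T t \<omega>}. ?f n \<omega>)"
        using elim by (intro suminf_finite) auto
      then show ?case using elim by (simp add: ctrw_def)
    qed
  qed measurable
  also have "\<dots> = (\<Sum>n. of_real (prob (A n) * w ^ n))"
    using sums_unique[OF series] unfolding factor by simp
  also have "\<dots> = of_real (count_transform w t)"
  proof -
    have s0: "(\<lambda>n. w ^ n * arrived n t) sums (\<Sum>n. w ^ n * arrived n t)"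
      using arrived_summable[OF w, of 0 t] by (simp add: summable_sums)
    have s1: "(\<lambda>n. w ^ n * arrived (n + 1) t) sums (\<Sum>n. w ^ n * arrived (n + 1) t)"
      using arrived_summable[OF w, of 1 t] by (simp only: summable_sums)
    have "(\<Sum>n. w ^ n * arrived n t) = 1 + w * (\<Sum>n. w ^ n * arrived (n + 1) t)"
      using suminf_split_head[of "\<lambda>n. w ^ n * arrived n t"] arrived_summable[OF w, of 0 t]
        suminf_mult[OF sums_summable[OF s1], of w] by (simp add: arrived_0[OF t] mult.assoc)
    then have "(\<lambda>n. w ^ n * arrived n t - w ^ n * arrived (n + 1) t) sums count_transform w t"
      using sums_diff[OF s0 s1] by (simp add: count_transform_def algebra_simps)
    then have "(\<lambda>n. prob (A n) * w ^ n) sums count_transform w t"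
      by (simp add: prob_A algebra_simps)
    then have "(\<lambda>n. of_real (prob (A n) * w ^ n)) sums (of_real (count_transform w t) :: complex)"
      by (rule sums_of_real)
    then show ?thesis by (rule sums_unique[symmetric])
  qed
  finally show ?thesis by (simp add: w_def)
qed

lemma abs_count_transform_le_1: "\<bar>count_transform (jump_char \<kappa>) t\<bar> \<le> 1"
proof (cases "t \<ge> 0")
  case True
  have "norm (char (distr M borel (ctrw T X t)) \<kappa>) \<le> 1"
    by (intro real_distribution.cmod_char_le_1 real_distribution_distr) measurable
  then show ?thesis unfolding char_ctrw[OF True] by simp
next
  case False
  then show ?thesis by (simp add: count_transform_def arrived_neg)
qed

lemma scaled_ctrw:
  assumes "\<tau> > 0"
  shows "ctrw (\<lambda>n \<omega>. \<tau> * T n \<omega>) (\<lambda>n \<omega>. h * X n \<omega>) t \<omega> = h * ctrw T X (t / \<tau>) \<omega>"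
proof -
  have "jump_instant (\<lambda>n \<omega>. \<tau> * T n \<omega>) n \<omega> = \<tau> * jump_instant T n \<omega>" for n
    by (simp add: jump_instant_def sum_distrib_left)
  then have "jump_count (\<lambda>n \<omega>. \<tau> * T n \<omega>) t \<omega> = jump_count T (t / \<tau>) \<omega>"
    unfolding jump_count_def using assms by (simp add: field_simps)
  then show ?thesis by (simp add: ctrw_def position_after_def sum_distrib_left)
qed

lemma scaled_law_eq:
  assumes "\<tau> > 0"
  shows "scaled_law M T X h \<tau> t = distr M borel (\<lambda>\<omega>. h * ctrw T X (t / \<tau>) \<omega>)"
  unfolding scaled_law_def using scaled_ctrw[OF assms] by (intro distr_cong) auto

lemma scaled_law_distribution: "real_distribution (scaled_law M T X h \<tau> t)"
  unfolding scaled_law_def by (intro real_distribution_distr ctrw_measurable) measurable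

lemma char_scaled_law:
  assumes "\<tau> > 0" "t \<ge> 0"
  shows "char (scaled_law M T X h \<tau> t) \<kappa> = of_real (count_transform (jump_char (h * \<kappa>)) (t / \<tau>))"
proof -
  have "char (scaled_law M T X h \<tau> t) \<kappa> = char (distr M borel (ctrw T X (t / \<tau>))) (h * \<kappa>)"
    unfolding scaled_law_eq[OF assms(1)] char_def by (subst (1 2) integral_distr) (auto simp: mult_ac)
  then show ?thesis using assms by (simp add: char_ctrw)
qed

text \<open>By Fubini this is the expectation of the integral of \<open>exp (- s t)\<close> over \<open>t \<ge> \<tau> S\<^sub>n\<close>.\<close>

lemma laplace_arrived:
  assumes s: "s > 0" and \<tau>: "\<tau> > 0"
  shows "has_bochner_integral lborel (\<lambda>t. indicator {0..} t * (exp (- s * t) * arrived n (t / \<tau>)))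
    (waiting_laplace (s * \<tau>) ^ n / s)"
proof -
  interpret pair_sigma_finite lborel M ..
  let ?k = "\<lambda>(t, \<omega>). indicator {0..} t * exp (- s * t) * (if jump_instant T n \<omega> \<le> t / \<tau> then 1 else 0) :: real"
  have k_eq: "?k (t, \<omega>) = indicator {0..} t * exp (- s * t) * indicator {\<omega> \<in> space M. jump_instant T n \<omega> \<le> t / \<tau>} \<omega>"
    if "\<omega> \<in> space M" for t \<omega>
    using that by (simp add: indicator_def)
  have inner: "(LINT \<omega>|M. ?k (t, \<omega>)) = indicator {0..} t * (exp (- s * t) * arrived n (t / \<tau>))" for t
  proof -
    have "(LINT \<omega>|M. ?k (t, \<omega>)) =
        (LINT \<omega>|M. indicator {0..} t * exp (- s * t) * indicator {\<omega> \<in> space M. jump_instant T n \<omega> \<le> t / \<tau>} \<omega>)"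
      by (rule Bochner_Integration.integral_cong[OF refl k_eq])
    then show ?thesis by (simp add: arrived_def)
  qed
  have exp_int: "integrable lborel (\<lambda>t. indicator {0..} t * exp (- s * t))"
    using has_bochner_integral_exp_atLeast[OF s, of 0] by (simp add: has_bochner_integral_iff)
  have int_t: "integrable lborel (\<lambda>t. indicator {0..} t * (exp (- s * t) * arrived n (t / \<tau>)))"
  proof (rule Bochner_Integration.integrable_bound[OF exp_int])
    show "AE t in lborel. norm (indicator {0..} t * (exp (- s * t) * arrived n (t / \<tau>)))
        \<le> norm (indicator {0..} t * exp (- s * t))"
      by (intro AE_I2) (simp add: indicator_def mult_left_le)
  qed measurable
  have k_meas: "?k \<in> borel_measurable (lborel \<Otimes>\<^sub>M M)"
    by measurable
  have k_nonneg: "norm (?k x) = ?k x" for x by (cases x) (simp add: indicator_def)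
  have k_int: "integrable (lborel \<Otimes>\<^sub>M M) ?k"
  proof (rule Fubini_integrable[OF k_meas])
    show "integrable lborel (\<lambda>t. LINT \<omega>|M. norm (?k (t, \<omega>)))"
      unfolding k_nonneg inner by (rule int_t)
    show "AE t in lborel. integrable M (\<lambda>\<omega>. ?k (t, \<omega>))"
      unfolding prod.case by (intro AE_I2 integrable_mult_right integrable_const_bound[where B=1]) auto
  qed
  have "(LINT t|lborel. indicator {0..} t * (exp (- s * t) * arrived n (t / \<tau>))) = (LINT \<omega>|M. LINT t|lborel. ?k (t, \<omega>))"
    unfolding inner[symmetric] using Fubini_integral[of "\<lambda>t \<omega>. ?k (t, \<omega>)"] k_int by simp
  also have "\<dots> = (LINT \<omega>|M. exp (- (s * \<tau>) * jump_instant T n \<omega>) / s)"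
  proof (rule integral_cong_AE)
    show "AE \<omega> in M. (LINT t|lborel. ?k (t, \<omega>)) = exp (- (s * \<tau>) * jump_instant T n \<omega>) / s"
      using AE_jump_instant_nonneg[of n]
    proof eventually_elim
      case (elim \<omega>)
      let ?a = "\<tau> * jump_instant T n \<omega>"
      have "0 \<le> ?a" using elim \<tau> by simp
      then have "?k (t, \<omega>) = indicator {?a..} t * exp (- s * t)" for t
        using \<tau> by (auto simp: indicator_def field_simps)
      then have "(LINT t|lborel. ?k (t, \<omega>)) = (LINT t|lborel. indicator {?a..} t * exp (- s * t))"
        by (simp only:)
      also have "\<dots> = exp (- s * ?a) / s"
        by (rule has_bochner_integral_integral_eq[OF has_bochner_integral_exp_atLeast[OF s]])
      finally show ?case by (simp add: mult_ac)
    qed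
  qed (use k_meas in \<open>measurable\<close>)
  also have "\<dots> = waiting_laplace (s * \<tau>) ^ n / s"
    using laplace_jump_instant[of "s * \<tau>" n] s \<tau> by simp
  finally show ?thesis using int_t by (simp add: has_bochner_integral_iff)
qed

lemma laplace_count_transform:
  assumes w: "\<bar>w\<bar> \<le> 1" and s: "s > 0" and \<tau>: "\<tau> > 0"
  shows "has_bochner_integral lborel (\<lambda>t. indicator {0..} t * (exp (- s * t) * count_transform w (t / \<tau>)))
    ((1 - waiting_laplace (s * \<tau>)) / (s * (1 - w * waiting_laplace (s * \<tau>))))"
proof -
  define q where "q = waiting_laplace (s * \<tau>)"
  have q: "0 \<le> q" "q < 1" using waiting_laplace_bounds[of "s * \<tau>"] s \<tau> by (auto simp: q_def)
  let ?f = "\<lambda>w n t. w ^ n * (indicator {0..} t * (exp (- s * t) * arrived (n + 1) (t / \<tau>))) :: real"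
  have f: "has_bochner_integral lborel (?f v n) (v ^ n * (q ^ (n + 1) / s))" for v n
    unfolding q_def by (intro has_bochner_integral_mult_right laplace_arrived s \<tau>)
  have f_norm: "norm (?f w n t) = ?f \<bar>w\<bar> n t" for n t
    by (simp add: abs_mult power_abs indicator_def)
  have f_int: "integrable lborel (?f w n)" for n using f by (simp add: has_bochner_integral_iff)
  have f_sums: "(\<lambda>n. ?f v n t) sums (indicator {0..} t * (exp (- s * t) * (\<Sum>n. v ^ n * arrived (n + 1) (t / \<tau>))))"
    if "\<bar>v\<bar> \<le> 1" for v t
    using sums_mult[OF summable_sums[OF arrived_summable[OF that, of 1 "t / \<tau>"]], of "indicator {0..} t * exp (- s * t)"]
    by (simp add: mult_ac)
  have 1: "AE t in lborel. summable (\<lambda>n. norm (?f w n t))"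
    unfolding f_norm using f_sums[of "\<bar>w\<bar>"] w by (intro AE_I2) (auto dest: sums_summable)
  have geo: "(\<lambda>n. v ^ n * (q ^ (n + 1) / s)) sums (q / s * (1 / (1 - v * q)))" if "\<bar>v\<bar> \<le> 1" for v
  proof -
    have "\<bar>v * q\<bar> < 1" using that q mult_mono[of "\<bar>v\<bar>" 1 q q] by (simp add: abs_mult)
    then have "(\<lambda>n. q / s * (v * q) ^ n) sums (q / s * (1 / (1 - v * q)))"
      by (intro sums_mult geometric_sums) simp
    then show ?thesis by (simp add: power_mult_distrib mult_ac)
  qed
  have 2: "summable (\<lambda>n. LINT t|lborel. norm (?f w n t))"
    unfolding f_norm has_bochner_integral_integral_eq[OF f] by (rule sums_summable[OF geo]) (use w in simp)
  have suminf_f: "(\<Sum>n. ?f w n t) = indicator {0..} t * (exp (- s * t) * (\<Sum>n. w ^ n * arrived (n + 1) (t / \<tau>)))" for t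
    by (rule sums_unique[OF f_sums[OF w], symmetric])
  have "integrable lborel (\<lambda>t. \<Sum>n. ?f w n t)"
    by (rule integrable_suminf[OF f_int 1 2])
  moreover have "(LINT t|lborel. (\<Sum>n. ?f w n t)) = q / s * (1 / (1 - w * q))"
    unfolding integral_suminf[OF f_int 1 2] has_bochner_integral_integral_eq[OF f]
    by (rule sums_unique[OF geo[OF w], symmetric])
  ultimately have "has_bochner_integral lborel
      (\<lambda>t. indicator {0..} t * (exp (- s * t) * (\<Sum>n. w ^ n * arrived (n + 1) (t / \<tau>)))) (q / s * (1 / (1 - w * q)))"
    unfolding suminf_f by (simp add: has_bochner_integral_iff)
  from has_bochner_integral_diff[OF has_bochner_integral_exp_atLeast[OF s, of 0] has_bochner_integral_mult_right[OF this, of "1 - w"]]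
  have "has_bochner_integral lborel (\<lambda>t. indicator {0..} t * (exp (- s * t) * count_transform w (t / \<tau>)))
      (exp (- s * 0) / s - (1 - w) * (q / s * (1 / (1 - w * q))))"
    by (simp add: count_transform_def algebra_simps)
  moreover have "exp (- s * 0) / s - (1 - w) * (q / s * (1 / (1 - w * q))) = (1 - q) / (s * (1 - w * q))"
  proof -
    have "w * q < 1"
      using w q mult_mono[of w 1 q q] by (auto simp: abs_le_iff)
    then have "1 - w * q \<noteq> 0" by simp
    then show ?thesis using s by (simp add: divide_simps) (simp add: algebra_simps)
  qed
  ultimately show ?thesis by (simp add: q_def)
qed

text \<open>The Montroll-Weiss formula.\<close>

lemma fourier_laplace_scaled_law:
  assumes s: "s > 0" and \<tau>: "\<tau> > 0"
  shows "fourier_laplace (scaled_law M T X h \<tau>) \<kappa> s =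
    of_real ((1 - waiting_laplace (s * \<tau>)) / (s * (1 - jump_char (h * \<kappa>) * waiting_laplace (s * \<tau>))))"
proof -
  have "fourier_laplace (scaled_law M T X h \<tau>) \<kappa> s =
      (LINT t|lborel. of_real (indicator {0..} t * (exp (- s * t) * count_transform (jump_char (h * \<kappa>)) (t / \<tau>))))"
    unfolding fourier_laplace_def set_lebesgue_integral_def
    by (rule Bochner_Integration.integral_cong) (auto simp: indicator_def char_scaled_law[OF \<tau>] scaleR_conv_of_real)
  also have "\<dots> = of_real (LINT t|lborel. indicator {0..} t * (exp (- s * t) * count_transform (jump_char (h * \<kappa>)) (t / \<tau>)))"
    by (rule integral_complex_of_real)
  also have "(LINT t|lborel. indicator {0..} t * (exp (- s * t) * count_transform (jump_char (h * \<kappa>)) (t / \<tau>))) =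
      (1 - waiting_laplace (s * \<tau>)) / (s * (1 - jump_char (h * \<kappa>) * waiting_laplace (s * \<tau>)))"
    by (rule has_bochner_integral_integral_eq[OF laplace_count_transform[OF abs_jump_char_le_1 s \<tau>]])
  finally show ?thesis .
qed

end

section \<open>The scaling limit\<close>

lemma filterlim_at_right_0D:
  fixes f :: "'b \<Rightarrow> real"
  assumes "filterlim f (at_right 0) F"
  shows "\<forall>\<^sub>F n in F. f n > 0" and "(f \<longlongrightarrow> 0) F"
  using assms by (auto simp: filterlim_at elim: eventually_mono)

locale ctrw_scaling = ctrw_model M T X P Q
  for M :: "'a measure" and T X :: "nat \<Rightarrow> 'a \<Rightarrow> real" and P Q :: "real measure" +
  fixes \<alpha> \<beta> \<mu> lam :: real
  assumes \<alpha>: "0 < \<alpha>" and \<beta>: "0 < \<beta>" and \<mu>: "0 < \<mu>" and lam: "0 < lam"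
    and jump_asymptotics: "((\<lambda>\<kappa>. (1 - jump_char \<kappa>) / \<kappa> powr \<alpha>) \<longlongrightarrow> \<mu>) (at_right 0)"
    and waiting_asymptotics: "((\<lambda>s. (1 - waiting_laplace s) / s powr \<beta>) \<longlongrightarrow> lam) (at_right 0)"
begin

text \<open>Divide numerator and denominator by the common scale \<open>\<mu> h powr \<alpha> = lam \<tau> powr \<beta>\<close> and use
  \<open>1 - w \<phi> = (1 - w) \<phi> + (1 - \<phi>)\<close>.\<close>

lemma laplace_transform_limit:
  assumes h: "filterlim h (at_right 0) F" and \<tau>: "filterlim \<tau> (at_right 0) F"
    and scaling: "\<forall>\<^sub>F n in F. \<mu> * h n powr \<alpha> = lam * \<tau> n powr \<beta>" and s: "s > 0"
  shows "((\<lambda>n. (1 - waiting_laplace (s * \<tau> n)) / (s * (1 - jump_char (h n * \<kappa>) * waiting_laplace (s * \<tau> n))))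
      \<longlongrightarrow> s powr (\<beta> - 1) / (\<bar>\<kappa>\<bar> powr \<alpha> + s powr \<beta>)) F" (is "?lim")
    and "((\<lambda>n. jump_char (h n * \<kappa>)) \<longlongrightarrow> 1) F"
proof -
  define A where "A = (\<lambda>n. (1 - waiting_laplace (s * \<tau> n)) / (lam * \<tau> n powr \<beta>))"
  define B where "B = (\<lambda>n. (1 - jump_char (h n * \<kappa>)) / (lam * \<tau> n powr \<beta>))"
  have \<tau>_pos: "\<forall>\<^sub>F n in F. \<tau> n > 0" and h_pos: "\<forall>\<^sub>F n in F. h n > 0"
    by (rule filterlim_at_right_0D[OF \<tau>], rule filterlim_at_right_0D[OF h])
  have \<tau>0: "(\<tau> \<longlongrightarrow> 0) F" and h0: "(h \<longlongrightarrow> 0) F"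
    by (rule filterlim_at_right_0D[OF \<tau>], rule filterlim_at_right_0D[OF h])
  have scale_0: "((\<lambda>n. lam * \<tau> n powr \<beta>) \<longlongrightarrow> 0) F"
  proof -
    have "((\<lambda>n. \<tau> n powr \<beta>) \<longlongrightarrow> 0 powr \<beta>) F"
      using \<beta> \<tau>_pos by (intro tendsto_powr' \<tau>0 tendsto_const) (auto elim!: eventually_mono)
    then show ?thesis using tendsto_mult[OF tendsto_const[of lam]] by fastforce
  qed
  have "(A \<longlongrightarrow> s powr \<beta> / lam * lam) F"
  proof -
    have "((\<lambda>n. s * \<tau> n) \<longlongrightarrow> s * 0) F" by (intro tendsto_intros \<tau>0)
    then have "filterlim (\<lambda>n. s * \<tau> n) (at_right 0) F"
      using \<tau>_pos s by (auto simp: filterlim_at elim!: eventually_mono)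
    from filterlim_compose[OF waiting_asymptotics this]
    have "((\<lambda>n. s powr \<beta> / lam * ((1 - waiting_laplace (s * \<tau> n)) / (s * \<tau> n) powr \<beta>)) \<longlongrightarrow> s powr \<beta> / lam * lam) F"
      by (intro tendsto_mult tendsto_const)
    then show ?thesis
    proof (rule Lim_transform_eventually)
      show "\<forall>\<^sub>F n in F. s powr \<beta> / lam * ((1 - waiting_laplace (s * \<tau> n)) / (s * \<tau> n) powr \<beta>) = A n"
        using \<tau>_pos by eventually_elim (use s in \<open>simp add: A_def powr_mult\<close>)
    qed
  qed
  then have A: "(A \<longlongrightarrow> s powr \<beta>) F" using lam by simp
  have B: "(B \<longlongrightarrow> \<bar>\<kappa>\<bar> powr \<alpha>) F"
  proof (cases "\<kappa> = 0")
    case True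
    have "jump_char 0 = 1"
      by (simp add: jump_char_def real_distribution.char_zero[OF Q_distribution])
    then have "B = (\<lambda>_. 0)" using True by (simp add: B_def)
    then show ?thesis using True by simp
  next
    case False
    have "((\<lambda>n. h n * \<bar>\<kappa>\<bar>) \<longlongrightarrow> 0 * \<bar>\<kappa>\<bar>) F" by (intro tendsto_intros h0)
    then have "filterlim (\<lambda>n. h n * \<bar>\<kappa>\<bar>) (at_right 0) F"
      using h_pos False by (auto simp: filterlim_at elim!: eventually_mono)
    from filterlim_compose[OF jump_asymptotics this]
    have "((\<lambda>n. \<bar>\<kappa>\<bar> powr \<alpha> / \<mu> * ((1 - jump_char (h n * \<bar>\<kappa>\<bar>)) / (h n * \<bar>\<kappa>\<bar>) powr \<alpha>)) \<longlongrightarrow> \<bar>\<kappa>\<bar> powr \<alpha> / \<mu> * \<mu>) F"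
      by (intro tendsto_mult tendsto_const)
    then have "(B \<longlongrightarrow> \<bar>\<kappa>\<bar> powr \<alpha> / \<mu> * \<mu>) F"
    proof (rule Lim_transform_eventually)
      show "\<forall>\<^sub>F n in F. \<bar>\<kappa>\<bar> powr \<alpha> / \<mu> * ((1 - jump_char (h n * \<bar>\<kappa>\<bar>)) / (h n * \<bar>\<kappa>\<bar>) powr \<alpha>) = B n"
        using h_pos scaling
      proof eventually_elim
        case (elim n)
        have "jump_char (h n * \<bar>\<kappa>\<bar>) = jump_char (h n * \<kappa>)"
          using real_distribution.Re_char_abs[OF Q_distribution, of "h n * \<kappa>"] elim(1)
          by (simp add: jump_char_def abs_mult)
        then show ?case
          unfolding B_def elim(2)[symmetric] using \<mu> elim(1) False by (simp add: powr_mult)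
      qed
    qed
    then show ?thesis using \<mu> by simp
  qed
  have scale_ne: "\<forall>\<^sub>F n in F. lam * \<tau> n powr \<beta> \<noteq> 0"
    using \<tau>_pos by eventually_elim (use lam in simp)
  have "((\<lambda>n. 1 - A n * (lam * \<tau> n powr \<beta>)) \<longlongrightarrow> 1 - s powr \<beta> * 0) F"
    by (intro tendsto_intros A scale_0)
  then have "((\<lambda>n. waiting_laplace (s * \<tau> n)) \<longlongrightarrow> 1 - s powr \<beta> * 0) F"
    by (rule Lim_transform_eventually) (use scale_ne in \<open>eventually_elim, simp add: A_def\<close>)
  then have W: "((\<lambda>n. waiting_laplace (s * \<tau> n)) \<longlongrightarrow> 1) F" by simp
  have "((\<lambda>n. 1 - B n * (lam * \<tau> n powr \<beta>)) \<longlongrightarrow> 1 - \<bar>\<kappa>\<bar> powr \<alpha> * 0) F"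
    by (intro tendsto_intros B scale_0)
  then have "((\<lambda>n. jump_char (h n * \<kappa>)) \<longlongrightarrow> 1 - \<bar>\<kappa>\<bar> powr \<alpha> * 0) F"
    by (rule Lim_transform_eventually) (use scale_ne in \<open>eventually_elim, simp add: B_def\<close>)
  then show "((\<lambda>n. jump_char (h n * \<kappa>)) \<longlongrightarrow> 1) F" by simp
  have sum_pos: "\<bar>\<kappa>\<bar> powr \<alpha> + s powr \<beta> > 0" using s by (simp add: add_nonneg_pos)
  have "((\<lambda>n. A n / (s * (B n * waiting_laplace (s * \<tau> n) + A n)))
      \<longlongrightarrow> s powr \<beta> / (s * (\<bar>\<kappa>\<bar> powr \<alpha> * 1 + s powr \<beta>))) F"
    using sum_pos s by (intro tendsto_intros A B W) simp
  also have "s powr \<beta> / (s * (\<bar>\<kappa>\<bar> powr \<alpha> * 1 + s powr \<beta>)) = s powr (\<beta> - 1) / (\<bar>\<kappa>\<bar> powr \<alpha> + s powr \<beta>)"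
    using s by (simp add: powr_diff)
  finally show ?lim
  proof (rule Lim_transform_eventually)
    show "\<forall>\<^sub>F n in F. A n / (s * (B n * waiting_laplace (s * \<tau> n) + A n)) =
        (1 - waiting_laplace (s * \<tau> n)) / (s * (1 - jump_char (h n * \<kappa>) * waiting_laplace (s * \<tau> n)))"
      using scale_ne
    proof eventually_elim
      case (elim n)
      define q where "q = lam * \<tau> n powr \<beta>"
      have q: "q \<noteq> 0" using elim by (simp add: q_def)
      have "B n * waiting_laplace (s * \<tau> n) + A n = (1 - jump_char (h n * \<kappa>) * waiting_laplace (s * \<tau> n)) / q"
        unfolding A_def B_def q_def[symmetric] using q by (simp add: field_simps)
      then show ?case
        unfolding A_def q_def[symmetric] using q by simp
    qed
  qed
qed

text \<open>Near the origin the jump characteristic function is positive, so the functions of \<open>t\<close> are eventually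
  nonincreasing and the continuity theorem for Laplace transforms applies.\<close>

lemma count_transform_limit:
  assumes h: "filterlim h (at_right 0) F" and \<tau>: "filterlim \<tau> (at_right 0) F"
    and scaling: "\<forall>\<^sub>F n in F. \<mu> * h n powr \<alpha> = lam * \<tau> n powr \<beta>" and t: "t > 0"
  shows "((\<lambda>n. count_transform (jump_char (h n * \<kappa>)) (t / \<tau> n))
      \<longlongrightarrow> mittag_leffler \<beta> (- (\<bar>\<kappa>\<bar> powr \<alpha>) * t powr \<beta>)) F"
proof -
  define c where "c = \<bar>\<kappa>\<bar> powr \<alpha>"
  have c: "c \<ge> 0" by (simp add: c_def)
  \<comment> \<open>The Mittag-Leffler series can be integrated termwise for all \<open>s \<ge> s0\<close>.\<close>
  define s0 where "s0 = (c + 1) powr (1 / \<beta>)"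
  have s0: "s0 > 0" using c by (simp add: s0_def)
  have "s0 powr \<beta> = c + 1" using c \<beta> by (simp add: s0_def powr_powr)
  then have large: "c < s powr \<beta>" if "s \<ge> s0" for s
    using powr_mono2[of \<beta> s0 s] that s0 \<beta> by simp
  have \<tau>_pos: "\<forall>\<^sub>F n in F. \<tau> n > 0" using \<tau> by (rule filterlim_at_right_0D)
  let ?g = "\<lambda>t. mittag_leffler \<beta> (- c * t powr \<beta>)"
  have L: "has_bochner_integral lborel (\<lambda>t. indicator {0..} t *\<^sub>R (exp (- s * t) * ?g t)) (s powr (\<beta> - 1) / (c + s powr \<beta>))"
    if "s \<ge> s0" for s
    using that s0 large[OF that] by (intro has_bochner_integral_laplace_mittag_leffler \<beta> c) auto
  have "((\<lambda>n. count_transform (jump_char (h n * \<kappa>)) (t / \<tau> n)) \<longlongrightarrow> ?g t) F"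
  proof (rule laplace_continuity_monotone[OF s0 _ _ _ _ _ _ t])
    show "(\<lambda>t. count_transform (jump_char (h n * \<kappa>)) (t / \<tau> n)) \<in> borel_measurable borel" for n
      by measurable
    show "\<bar>count_transform (jump_char (h n * \<kappa>)) (t / \<tau> n)\<bar> \<le> 1" for n t
      by (rule abs_count_transform_le_1)
    have "\<forall>\<^sub>F n in F. jump_char (h n * \<kappa>) > 0"
      using laplace_transform_limit(2)[OF h \<tau> scaling zero_less_one, of \<kappa>] by (rule order_tendstoD) simp
    with \<tau>_pos show "\<forall>\<^sub>F n in F. \<forall>t\<ge>0. \<forall>t'\<ge>t.
        count_transform (jump_char (h n * \<kappa>)) (t' / \<tau> n) \<le> count_transform (jump_char (h n * \<kappa>)) (t / \<tau> n)"
    proof eventually_elim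
      case (elim n)
      have "jump_char (h n * \<kappa>) \<le> 1" using abs_jump_char_le_1 abs_le_iff by blast
      then show ?case
        using elim by (intro allI impI count_transform_antimono divide_right_mono) auto
    qed
    show "set_integrable lborel {0..} (\<lambda>t. exp (- s0 * t) * ?g t)"
      using L[of s0] by (simp add: set_integrable_def has_bochner_integral_iff)
    show "continuous_on {0<..} ?g"
      by (intro continuous_intros \<beta>) auto
    fix s assume s: "s \<ge> s0"
    then have "s > 0" using s0 by simp
    have "(LBINT t:{0..}. exp (- s * t) * ?g t) = s powr (\<beta> - 1) / (c + s powr \<beta>)"
      using L[OF s] by (simp add: set_lebesgue_integral_def has_bochner_integral_iff)
    moreover have "((\<lambda>n. LBINT t:{0..}. exp (- s * t) * count_transform (jump_char (h n * \<kappa>)) (t / \<tau> n))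
        \<longlongrightarrow> s powr (\<beta> - 1) / (c + s powr \<beta>)) F"
      unfolding c_def
    proof (rule Lim_transform_eventually[OF laplace_transform_limit(1)[OF h \<tau> scaling \<open>s > 0\<close>, of \<kappa>]])
      show "\<forall>\<^sub>F n in F. (1 - waiting_laplace (s * \<tau> n)) / (s * (1 - jump_char (h n * \<kappa>) * waiting_laplace (s * \<tau> n)))
          = (LBINT t:{0..}. exp (- s * t) * count_transform (jump_char (h n * \<kappa>)) (t / \<tau> n))"
        using \<tau>_pos
      proof eventually_elim
        case (elim n)
        from has_bochner_integral_integral_eq[OF laplace_count_transform[OF abs_jump_char_le_1 \<open>s > 0\<close> elim]]
        show ?case by (simp add: set_lebesgue_integral_def)
      qed
    qed
    ultimately show "((\<lambda>n. LBINT t:{0..}. exp (- s * t) * count_transform (jump_char (h n * \<kappa>)) (t / \<tau> n))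
        \<longlongrightarrow> (LBINT t:{0..}. exp (- s * t) * ?g t)) F" by simp
  qed
  then show ?thesis by (simp add: c_def)
qed

text \<open>A particular sequence along the scaling relation, used to construct the limit laws.\<close>

definition sample_h :: "nat \<Rightarrow> real" where
  "sample_h n = inverse (real (Suc n))"

definition sample_\<tau> :: "nat \<Rightarrow> real" where
  "sample_\<tau> n = (\<mu> * sample_h n powr \<alpha> / lam) powr (1 / \<beta>)"

lemma sample_h_lim: "filterlim sample_h (at_right 0) sequentially"
  unfolding filterlim_at sample_h_def[abs_def] using LIMSEQ_inverse_real_of_nat by auto

lemma sample_\<tau>_pos: "sample_\<tau> n > 0"
  using \<mu> lam by (simp add: sample_\<tau>_def sample_h_def)

lemma sample_scaling: "\<mu> * sample_h n powr \<alpha> = lam * sample_\<tau> n powr \<beta>"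
  using \<mu> lam \<beta> by (simp add: sample_\<tau>_def powr_powr sample_h_def)

lemma sample_\<tau>_lim: "filterlim sample_\<tau> (at_right 0) sequentially"
proof -
  have "(\<lambda>n. sample_h n powr \<alpha>) \<longlonglongrightarrow> 0 powr \<alpha>"
    by (rule tendsto_powr'[OF filterlim_at_right_0D(2)[OF sample_h_lim] tendsto_const])
      (use \<alpha> in \<open>simp add: sample_h_def\<close>)
  then have "(\<lambda>n. \<mu> * sample_h n powr \<alpha> / lam) \<longlonglongrightarrow> \<mu> * 0 / lam"
    using lam by (intro tendsto_intros) auto
  then have "(\<lambda>n. (\<mu> * sample_h n powr \<alpha> / lam) powr (1 / \<beta>)) \<longlonglongrightarrow> 0 powr (1 / \<beta>)"
    using \<beta> \<mu> lam by (intro tendsto_powr') auto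
  then show ?thesis
    using sample_\<tau>_pos by (auto simp: filterlim_at sample_\<tau>_def[abs_def] less_imp_neq)
qed

lemma limit_law_exists:
  assumes t: "t > 0"
  shows "\<exists>\<nu>. real_distribution \<nu> \<and> (\<forall>\<kappa>. char \<nu> \<kappa> = of_real (mittag_leffler \<beta> (- (\<bar>\<kappa>\<bar> powr \<alpha>) * t powr \<beta>)))"
proof -
  let ?g = "\<lambda>\<kappa>. mittag_leffler \<beta> (- (\<bar>\<kappa>\<bar> powr \<alpha>) * t powr \<beta>)"
  obtain \<nu> where "real_distribution \<nu>" "\<And>\<kappa>. char \<nu> \<kappa> = complex_of_real (?g \<kappa>)"
  proof (rule levy_limit_is_char[of "\<lambda>n. scaled_law M T X (sample_h n) (sample_\<tau> n) t" "\<lambda>\<kappa>. complex_of_real (?g \<kappa>)"])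
    show "(\<lambda>n. char (scaled_law M T X (sample_h n) (sample_\<tau> n) t) \<kappa>) \<longlonglongrightarrow> complex_of_real (?g \<kappa>)" for \<kappa>
      unfolding char_scaled_law[OF sample_\<tau>_pos less_imp_le[OF t]]
      by (intro tendsto_of_real count_transform_limit sample_h_lim sample_\<tau>_lim t always_eventually allI sample_scaling)
    have "continuous_on UNIV (\<lambda>\<kappa>. complex_of_real (?g \<kappa>))"
      using \<alpha> by (intro continuous_intros continuous_on_powr' \<beta>) auto
    then show "isCont (\<lambda>\<kappa>. complex_of_real (?g \<kappa>)) 0"
      by (simp add: continuous_on_eq_continuous_at)
  qed (blast intro: scaled_law_distribution)+
  then show ?thesis by blast
qed

text \<open>Unlike \<open>has_bochner_integral_laplace_mittag_leffler\<close>, this covers all \<open>s > 0\<close>. There the series cannot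
  be integrated termwise; instead the formula is inherited from the transforms of the rescaled walks,
  which are dominated by \<open>exp (- s t)\<close>.\<close>

lemma laplace_mittag_leffler:
  assumes s: "s > 0"
  shows "has_bochner_integral lborel
    (\<lambda>t. indicator {0..} t * (exp (- s * t) * mittag_leffler \<beta> (- (\<bar>\<kappa>\<bar> powr \<alpha>) * t powr \<beta>)))
    (s powr (\<beta> - 1) / (\<bar>\<kappa>\<bar> powr \<alpha> + s powr \<beta>))"
proof -
  let ?g = "\<lambda>t. mittag_leffler \<beta> (- (\<bar>\<kappa>\<bar> powr \<alpha>) * t powr \<beta>)"
  let ?m = "\<lambda>n t. count_transform (jump_char (sample_h n * \<kappa>)) (t / sample_\<tau> n)"
  have bound_int: "integrable lborel (\<lambda>t. indicator {0..} t * exp (- s * t))"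
    using has_bochner_integral_exp_atLeast[OF s, of 0] by (simp add: has_bochner_integral_iff)
  have [measurable]: "mittag_leffler \<beta> \<in> borel_measurable borel"
    using isCont_mittag_leffler[OF \<beta>]
    by (intro borel_measurable_continuous_onI continuous_at_imp_continuous_on) auto
  have lim: "AE t in lborel. (\<lambda>n. indicator {0..} t * (exp (- s * t) * ?m n t)) \<longlonglongrightarrow> indicator {0..} t * (exp (- s * t) * ?g t)"
    using AE_lborel_singleton[of 0]
  proof eventually_elim
    case (elim t)
    show ?case
    proof (cases "t > 0")
      case True
      then show ?thesis
        by (intro tendsto_mult tendsto_const count_transform_limit sample_h_lim sample_\<tau>_lim always_eventually allI sample_scaling)
    qed (use elim in auto)
  qed
  have bound: "AE t in lborel. norm (indicator {0..} t * (exp (- s * t) * ?m n t)) \<le> indicator {0..} t * exp (- s * t)" for n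
  proof (rule AE_I2)
    fix t
    show "norm (indicator {0..} t * (exp (- s * t) * ?m n t)) \<le> indicator {0..} t * exp (- s * t)"
      using abs_count_transform_le_1[of "sample_h n * \<kappa>" "t / sample_\<tau> n"]
      by (simp add: indicator_def abs_mult mult_left_le)
  qed
  have meas: "(\<lambda>t. indicator {0..} t * (exp (- s * t) * ?m n t)) \<in> borel_measurable lborel"
    "(\<lambda>t. indicator {0..} t * (exp (- s * t) * ?g t)) \<in> borel_measurable lborel" for n
    by measurable
  have "(\<lambda>n. LINT t|lborel. indicator {0..} t * (exp (- s * t) * ?m n t)) \<longlonglongrightarrow> (LINT t|lborel. indicator {0..} t * (exp (- s * t) * ?g t))"
    by (rule integral_dominated_convergence[OF meas(2) meas(1) bound_int lim bound])
  moreover have "(LINT t|lborel. indicator {0..} t * (exp (- s * t) * ?m n t)) =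
      (1 - waiting_laplace (s * sample_\<tau> n)) / (s * (1 - jump_char (sample_h n * \<kappa>) * waiting_laplace (s * sample_\<tau> n)))" for n
    by (rule has_bochner_integral_integral_eq[OF laplace_count_transform[OF abs_jump_char_le_1 s sample_\<tau>_pos]])
  moreover have "(\<lambda>n. (1 - waiting_laplace (s * sample_\<tau> n)) / (s * (1 - jump_char (sample_h n * \<kappa>) * waiting_laplace (s * sample_\<tau> n))))
      \<longlonglongrightarrow> s powr (\<beta> - 1) / (\<bar>\<kappa>\<bar> powr \<alpha> + s powr \<beta>)"
    by (intro laplace_transform_limit sample_h_lim sample_\<tau>_lim always_eventually allI sample_scaling s)
  ultimately have "(LINT t|lborel. indicator {0..} t * (exp (- s * t) * ?g t)) = s powr (\<beta> - 1) / (\<bar>\<kappa>\<bar> powr \<alpha> + s powr \<beta>)"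
    using LIMSEQ_unique by fastforce
  moreover have "integrable lborel (\<lambda>t. indicator {0..} t * (exp (- s * t) * ?g t))"
    by (rule integrable_dominated_convergence[OF meas(2) meas(1) bound_int lim bound])
  ultimately show ?thesis by (simp add: has_bochner_integral_iff)
qed

theorem ctrw_limit:
  "\<exists>u :: real \<Rightarrow> real measure.
      solves_fractional_cauchy \<alpha> \<beta> u \<and>
      (\<forall>t\<ge>0. \<forall>\<kappa>. char (u t) \<kappa> = of_real (mittag_leffler \<beta> (- (\<bar>\<kappa>\<bar> powr \<alpha>) * t powr \<beta>))) \<and>
      (\<forall>\<kappa> s. \<kappa> \<noteq> 0 \<longrightarrow> s > 0 \<longrightarrow>
         ((\<lambda>(h, \<tau>). fourier_laplace (scaled_law M T X h \<tau>) \<kappa> s)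
            \<longlongrightarrow> of_real (s powr (\<beta> - 1) / (\<bar>\<kappa>\<bar> powr \<alpha> + s powr \<beta>)))
           (scaling_limit \<alpha> \<beta> \<mu> lam) \<and>
         fourier_laplace u \<kappa> s = of_real (s powr (\<beta> - 1) / (\<bar>\<kappa>\<bar> powr \<alpha> + s powr \<beta>))) \<and>
      (\<forall>t>0. weak_conv_along (\<lambda>(h, \<tau>). scaled_law M T X h \<tau> t) (u t) (scaling_limit \<alpha> \<beta> \<mu> lam))"
proof -
  let ?g = "\<lambda>\<kappa> t. mittag_leffler \<beta> (- (\<bar>\<kappa>\<bar> powr \<alpha>) * t powr \<beta>)"
  let ?target = "\<lambda>\<kappa> s. s powr (\<beta> - 1) / (\<bar>\<kappa>\<bar> powr \<alpha> + s powr \<beta>)"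
  let ?F = "scaling_limit \<alpha> \<beta> \<mu> lam"
  obtain \<nu> where \<nu>: "\<And>t. t > 0 \<Longrightarrow> real_distribution (\<nu> t)"
    "\<And>t \<kappa>. t > 0 \<Longrightarrow> char (\<nu> t) \<kappa> = of_real (?g \<kappa> t)"
    using limit_law_exists by metis
  define u where "u = (\<lambda>t. if t > 0 then \<nu> t else return borel 0)"
  have u_distr: "real_distribution (u t)" for t
    using \<nu>(1) by (auto simp: u_def real_distribution_def real_distribution_axioms_def intro!: prob_space_return)
  have u_char: "char (u t) \<kappa> = of_real (?g \<kappa> t)" if "t \<ge> 0" for t \<kappa>
  proof (cases "t > 0")
    case True
    then show ?thesis by (simp add: u_def \<nu>(2))
  next
    case False
    with that have "t = 0" by simp
    then show ?thesis by (simp add: u_def char_def integral_return)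
  qed
  have u_eq: "indicator {0..} t *\<^sub>R (exp (- s * t) *\<^sub>R char (u t) \<kappa>) =
      complex_of_real (indicator {0..} t * (exp (- s * t) * ?g \<kappa> t))" for s \<kappa> t
    by (simp add: indicator_def u_char scaleR_conv_of_real)
  have u_int: "set_integrable lborel {0..} (\<lambda>t. exp (- s * t) *\<^sub>R char (u t) \<kappa>)" if "s > 0" for s \<kappa>
    unfolding set_integrable_def u_eq using laplace_mittag_leffler[OF that, of \<kappa>]
    by (intro integrable_of_real) (simp add: has_bochner_integral_iff)
  have u_laplace: "fourier_laplace u \<kappa> s = of_real (?target \<kappa> s)" if "s > 0" for s \<kappa>
    unfolding fourier_laplace_def set_lebesgue_integral_def u_eq integral_complex_of_real
    by (simp only: has_bochner_integral_integral_eq[OF laplace_mittag_leffler[OF that]])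
  have solves: "solves_fractional_cauchy \<alpha> \<beta> u"
    unfolding solves_fractional_cauchy_def
  proof (intro conjI allI impI)
    show "real_distribution (u t)" for t by (rule u_distr)
    show "u 0 = return borel 0" by (simp add: u_def)
    fix \<kappa> s :: real assume s: "s > 0"
    show "set_integrable lborel {0..} (\<lambda>t. exp (- s * t) *\<^sub>R char (u t) \<kappa>)" by (rule u_int[OF s])
    have "\<bar>\<kappa>\<bar> powr \<alpha> + s powr \<beta> > 0" using s by (simp add: add_nonneg_pos)
    then have "s powr \<beta> * ?target \<kappa> s - s powr (\<beta> - 1) = - (\<bar>\<kappa>\<bar> powr \<alpha>) * ?target \<kappa> s"
      by (simp add: divide_simps) (simp add: algebra_simps)
    then have "complex_of_real (s powr \<beta> * ?target \<kappa> s - s powr (\<beta> - 1)) = of_real (- (\<bar>\<kappa>\<bar> powr \<alpha>) * ?target \<kappa> s)"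
      by (rule arg_cong)
    then show "of_real (s powr \<beta>) * fourier_laplace u \<kappa> s - of_real (s powr (\<beta> - 1)) =
        - of_real (\<bar>\<kappa>\<bar> powr \<alpha>) * fourier_laplace u \<kappa> s"
      unfolding u_laplace[OF s] by (simp only: of_real_mult of_real_diff of_real_minus)
  qed
  have fst_lim: "filterlim fst (at_right 0) ?F"
    unfolding scaling_limit_def by (rule filterlim_mono[OF filterlim_fst order_refl inf_le1])
  have snd_lim: "filterlim snd (at_right 0) ?F"
    unfolding scaling_limit_def by (rule filterlim_mono[OF filterlim_snd order_refl inf_le1])
  have scaling: "\<forall>\<^sub>F p in ?F. \<mu> * fst p powr \<alpha> = lam * snd p powr \<beta>"
    unfolding scaling_limit_def eventually_inf_principal
    by (rule always_eventually) (auto simp: divide_eq_1_iff)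
  have FL: "((\<lambda>(h, \<tau>). fourier_laplace (scaled_law M T X h \<tau>) \<kappa> s) \<longlongrightarrow> of_real (?target \<kappa> s)) ?F"
    if s: "s > 0" for \<kappa> s
  proof (rule Lim_transform_eventually[OF tendsto_of_real[OF laplace_transform_limit(1)[OF fst_lim snd_lim scaling s]]])
    have "\<forall>\<^sub>F p in ?F. snd p > 0" using snd_lim by (rule filterlim_at_right_0D)
    then show "\<forall>\<^sub>F p in ?F. of_real ((1 - waiting_laplace (s * snd p)) /
        (s * (1 - jump_char (fst p * \<kappa>) * waiting_laplace (s * snd p))))
        = (case p of (h, \<tau>) \<Rightarrow> fourier_laplace (scaled_law M T X h \<tau>) \<kappa> s)"
    proof eventually_elim
      case (elim p)
      then show ?case
        by (cases p) (simp only: prod.case snd_conv fst_conv fourier_laplace_scaled_law[OF s])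
    qed
  qed
  have WC: "weak_conv_along (\<lambda>(h, \<tau>). scaled_law M T X h \<tau> t) (u t) ?F" if t: "t > 0" for t
    unfolding weak_conv_along_def
  proof (intro allI impI)
    fix g :: "nat \<Rightarrow> real \<times> real" assume g: "filterlim g ?F sequentially"
    have h: "filterlim (\<lambda>n. fst (g n)) (at_right 0) sequentially"
      and \<tau>: "filterlim (\<lambda>n. snd (g n)) (at_right 0) sequentially"
      using filterlim_compose[OF fst_lim g] filterlim_compose[OF snd_lim g] by auto
    have sc: "\<forall>\<^sub>F n in sequentially. \<mu> * fst (g n) powr \<alpha> = lam * snd (g n) powr \<beta>"
      using scaling g by (rule eventually_compose_filterlim)
    show "weak_conv_m (\<lambda>n. case g n of (h, \<tau>) \<Rightarrow> scaled_law M T X h \<tau> t) (u t)"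
    proof (rule levy_continuity)
      show "real_distribution (case g n of (h, \<tau>) \<Rightarrow> scaled_law M T X h \<tau> t)" for n
        by (simp add: scaled_law_distribution split: prod.split)
      show "real_distribution (u t)" by (rule u_distr)
      fix \<kappa>
      show "(\<lambda>n. char (case g n of (h, \<tau>) \<Rightarrow> scaled_law M T X h \<tau> t) \<kappa>) \<longlonglongrightarrow> char (u t) \<kappa>"
        unfolding u_char[OF less_imp_le[OF t]]
      proof (rule Lim_transform_eventually[OF tendsto_of_real[OF count_transform_limit[OF h \<tau> sc t]]])
        have "\<forall>\<^sub>F n in sequentially. snd (g n) > 0" using \<tau> by (rule filterlim_at_right_0D)
        then show "\<forall>\<^sub>F n in sequentially. of_real (count_transform (jump_char (fst (g n) * \<kappa>)) (t / snd (g n)))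
            = char (case g n of (h, \<tau>) \<Rightarrow> scaled_law M T X h \<tau> t) \<kappa>"
        proof eventually_elim
          case (elim n)
          then show ?case
            by (cases "g n") (simp only: prod.case fst_conv snd_conv char_scaled_law less_imp_le[OF t])
        qed
      qed
    qed
  qed
  show ?thesis
    using solves u_char FL u_laplace WC by (intro exI[of _ u] conjI allI impI) auto
qed

end

lemma interval_measure_cdf:
  assumes "real_distribution P"
  shows "interval_measure (cdf P) = P"
proof -
  interpret real_distribution P by fact
  show ?thesis
    by (intro cdf_unique real_distribution_interval_measure cdf_interval_measure assms)
      (auto simp: cdf_nondecreasing cdf_is_right_cont cdf_lim_at_bot cdf_lim_at_top_prob)
qed

theorem mainTheorem2:
  fixes M :: "'a measure"
    and T X :: "nat \<Rightarrow> 'a \<Rightarrow> real"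
    and \<Phi> W :: "real \<Rightarrow> real"
    and \<alpha> \<beta> \<mu> lam :: real
  assumes "prob_space M"
    and "iid M T \<Phi>"
    and "\<And>n. AE \<omega> in M. 0 < T n \<omega>"
    and "iid M X W"
    and "indep_sequences M T X"
    and W_symmetric: "\<And>x. isCont W x \<Longrightarrow> W (- x) + W x = 1"
    and "jump_regime W \<alpha> \<mu>"
    and "\<Phi> 0 = 0"
    and "(\<Phi> \<longlongrightarrow> 1) at_top"
    and "waiting_regime \<Phi> \<beta> lam"
  shows "\<exists>u :: real \<Rightarrow> real measure.
      solves_fractional_cauchy \<alpha> \<beta> u \<and>
      (\<forall>t\<ge>0. \<forall>\<kappa>. char (u t) \<kappa> = of_real (mittag_leffler \<beta> (- (\<bar>\<kappa>\<bar> powr \<alpha>) * t powr \<beta>))) \<and>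
      (\<forall>\<kappa> s. \<kappa> \<noteq> 0 \<longrightarrow> s > 0 \<longrightarrow>
         ((\<lambda>(h, \<tau>). fourier_laplace (scaled_law M T X h \<tau>) \<kappa> s)
            \<longlongrightarrow> of_real (s powr (\<beta> - 1) / (\<bar>\<kappa>\<bar> powr \<alpha> + s powr \<beta>)))
           (scaling_limit \<alpha> \<beta> \<mu> lam) \<and>
         fourier_laplace u \<kappa> s = of_real (s powr (\<beta> - 1) / (\<bar>\<kappa>\<bar> powr \<alpha> + s powr \<beta>))) \<and>
      (\<forall>t>0. weak_conv_along (\<lambda>(h, \<tau>). scaled_law M T X h \<tau> t) (u t) (scaling_limit \<alpha> \<beta> \<mu> lam))"
proof -
  interpret prob_space M by fact
  define P where "P = distr M borel (T 0)"
  define Q where "Q = distr M borel (X 0)"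
  have T_indep: "indep_vars (\<lambda>_. borel) T UNIV" and T_cdf: "cdf (distr M borel (T n)) = \<Phi>" for n
    using assms(2) by (auto simp: iid_def)
  have X_indep: "indep_vars (\<lambda>_. borel) X UNIV" and X_cdf: "cdf (distr M borel (X n)) = W" for n
    using assms(4) by (auto simp: iid_def)
  have [measurable]: "T n \<in> borel_measurable M" "X n \<in> borel_measurable M" for n
    using T_indep X_indep by (auto simp: indep_vars_def)
  have P: "real_distribution P" and Q: "real_distribution Q"
    unfolding P_def Q_def by (intro real_distribution_distr; measurable)+
  have P_cdf: "cdf P = \<Phi>" and Q_cdf: "cdf Q = W"
    by (simp_all add: P_def Q_def T_cdf X_cdf)
  have P_interval: "interval_measure \<Phi> = P" and Q_interval: "interval_measure W = Q"
    using interval_measure_cdf[OF P] interval_measure_cdf[OF Q] by (simp_all add: P_cdf Q_cdf)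
  have Q_sym: "distr Q borel uminus = Q"
    using W_symmetric by (intro symmetric_cdf_imp_symmetric_distribution Q) (simp add: Q_cdf)
  interpret ctrw_model M T X P Q
  proof
    show "distr M borel (T n) = P" for n
      by (intro cdf_unique P real_distribution_distr) (simp_all add: T_cdf P_cdf)
    show "distr M borel (X n) = Q" for n
      by (intro cdf_unique Q real_distribution_distr) (simp_all add: X_cdf Q_cdf)
    show "char Q \<kappa> = of_real (Re (char Q \<kappa>))" for \<kappa>
      by (rule symmetric_distribution_char[OF Q Q_sym])
  qed (use assms T_indep X_indep in auto)
  note J = jump_regime_asymptotics[OF Q Q_sym Q_interval \<open>jump_regime W \<alpha> \<mu>\<close>]
  note L = waiting_regime_asymptotics[OF P P_pos P_cdf P_interval \<open>waiting_regime \<Phi> \<beta> lam\<close>]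
  interpret ctrw_scaling M T X P Q \<alpha> \<beta> \<mu> lam
    by unfold_locales (use J L in \<open>simp_all add: jump_char_def waiting_laplace_def\<close>)
  show ?thesis by (rule ctrw_limit)
qed

end
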